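(* Let $n\ge 2$, let $v$ be a weight in $\mathbb R^n$, $p\ge1$ ($p<\infty$), and let $k\ge 1$ be an integer (with $k\le n$). The following facts are equivalent: (a) The functional $\|\cdot\|_{\Lambda^p_{\mathcal S_k}(v)}$ is a norm. (b) For all measurable $A,B\subset\mathbb R^n$, $V(\mathcal S_k(A\cup B))+V(\mathcal S_k(A\cap B))\le V(\mathcal S_k(A))+V(\mathcal S_k(B))$. (c) The weight $$\bar v(\bar x,s):=\int_{\Sigma_{k-1}}v\bigl(\bar x,(s/\sigma_k)^{1/k}\theta_{k-1}\bigr)\,d\theta_{k-1},\qquad(\bar x,s)\in\mathbb R^{n-k}\times\mathbb R^+,$$ is a decreasing function in the variable $s$. (d) For all measurable functions $f$ in $\mathbb R^n$, the equality $$\sup_{(\mathcal S_k h)^*=\bar v}\int_{\mathbb R^n}|f(x)h(x)|\,dx=\int_{\mathbb R^{n-k}\times\mathbb R^+}(\mathcal S_kf)^*(\bar x,s)\,\bar v(\bar x,s)\,d\bar x\,ds$$ holds, the supremum being over all measurable $h$ on $\mathbb R^n$ with $(\mathcal S_kh)^*(\bar x,s)=\bar v(\bar x,s)$ for a.e. $(\bar x,s)\in\mathbb R^{n-k}\times\mathbb R^+$.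
   Context: Points of $\mathbb R^n$ are written $x=(\bar x,y)$ with $\bar x\in\mathbb R^{n-k}$, $y\in\mathbb R^k$ (if $k=n$, $\mathbb R^{0}$ is a single point). $\sigma_k$ is the volume of the unit ball of $\mathbb R^k$, $\Sigma_{k-1}$ the unit sphere of $\mathbb R^k$ with surface measure $d\theta_{k-1}$ (counting measure on $\{\pm1\}$ if $k=1$), $\mathbb R^+=(0,\infty)$. The Steiner symmetrization of order $k$ of a measurable $A\subset\mathbb R^n$ is the set $\mathcal S_k(A)$ whose cross section $\{y\in\mathbb R^k:(\bar x,y)\in\mathcal S_k(A)\}$, for each $\bar x$, is the open ball of $\mathbb R^k$ centred at $0$ with the same $k$-dimensional measure as the cross section $\{y:(\bar x,y)\in A\}$ (empty if that measure is $0$, $\mathbb R^k$ if infinite). For measurable $f$ on $\mathbb R^n$, $(\mathcal S_kf)^*(x)=\int_0^\infty\chi_{\mathcal S_k(\{|f|>t\})}(x)\,dt$, $x\in\mathbb R^n$. One has $(\mathcal S_kf)^*(\bar x,y)=(f_{\bar x})^*(\sigma_k|y|^k)$, where $f_{\bar x}=f(\bar x,\cdot)$ and $(f_{\bar x})^*$ is its classical decreasing rearrangement on $(0,\infty)$; for $(\bar x,s)\in\mathbb R^{n-k}\times\mathbb R^+$ the notation $(\mathcal S_kf)^*(\bar x,s)$ means $(f_{\bar x})^*(s)$. A weight in $\mathbb R^n$ is a non-negative locally integrable function $v$ such that $|A|>0$ implies $\int_{\mathcal S_k(A)}v\,dx>0$. $V(E)=\int_Ev(x)\,dx$. The space $\Lambda^p_{\mathcal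 S_k}(v)$ consists of the measurable $f$ (modulo a.e. equality) for which $\|f\|_{\Lambda^p_{\mathcal S_k}(v)}=\bigl(\int_{\mathbb R^n}((\mathcal S_kf)^*(x))^pv(x)\,dx\bigr)^{1/p}$ is finite. In (c), "decreasing in $s$" means that for a.e. $\bar x$ the function $s\mapsto\bar v(\bar x,s)$ is non-increasing, up to modification on a null set. *)

theory Defs
  imports "HOL-Analysis.Analysis"
begin

text \<open>
  A point \<open>x\<close> of \<open>R\<^sup>n\<close> is a pair \<open>(xb, y)\<close> with \<open>y :: real^'k\<close>, where \<open>k = CARD('k)\<close>, and with \<open>xb\<close>
  in the space of extensional functions \<open>{..<n - k} \<rightarrow>\<^sub>E UNIV\<close>. Index types are nonempty, so a second
  Cartesian power could not express \<open>k = n\<close>; here \<open>R\<^sup>0\<close> is the one-point space \<open>{..<0} \<rightarrow>\<^sub>E UNIV\<close> with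
  a unit point mass. All definitions below assume \<open>CARD('k) \<le> n\<close>.

  ``Measurable'' means Lebesgue measurable (completed product measure). A cross section of a
  Lebesgue measurable set may fail to be measurable for a null set of \<open>xb\<close>; \<open>emeasure\<close> gives it the
  value 0, which has no effect on any integral or almost-everywhere statement.
\<close>

abbreviation lebesgue_base :: "nat \<Rightarrow> (nat \<Rightarrow> real) measure" where
  "lebesgue_base m \<equiv> Pi\<^sub>M {..<m} (\<lambda>_. lborel)"

definition lebesgue_Rn :: "nat \<Rightarrow> ((nat \<Rightarrow> real) \<times> (real^'k)) measure" where
  "lebesgue_Rn n = completion (lebesgue_base (n - CARD('k)) \<Otimes>\<^sub>M lborel)"

text \<open>The measure space \<open>R\<^bsup>n-k\<^esup> \<times> (0,\<infinity>)\<close>; the first argument of the function below is \<open>n - k\<close>.\<close>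

definition lebesgue_half_space :: "nat \<Rightarrow> ((nat \<Rightarrow> real) \<times> real) measure" where
  "lebesgue_half_space m = completion (lebesgue_base m \<Otimes>\<^sub>M restrict_space lborel {0<..})"

definition unit_vol :: "'k::finite itself \<Rightarrow> real" where
  "unit_vol _ = measure lborel (ball (0 :: real^'k) 1)"

text \<open>
  The surface measure of the unit sphere, in its polar-coordinates form: a Borel set \<open>E\<close> of the
  sphere has \<open>k\<close> times the volume of the cone \<open>{r \<theta> | 0 < r < 1, \<theta> \<in> E}\<close> over it (see
  \<open>emeasure_sphere_measure\<close>). For \<open>k = 1\<close> this is the counting measure on the two unit vectors.
\<close>

definition sphere_measure :: "(real^'k) measure" where
  "sphere_measure = completion (scale_measure (of_nat CARD('k))
     (distr (restrict_space lborel (ball 0 1 - {0})) (restrict_space borel (sphere 0 1))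
       (\<lambda>y. y /\<^sub>R norm y)))"

lemma emeasure_sphere_measure:
  fixes E :: "(real^'k) set"
  assumes E: "E \<in> sets borel" "E \<subseteq> sphere 0 1"
  shows "emeasure sphere_measure E =
    of_nat CARD('k) * emeasure lborel {r *\<^sub>R \<theta> | r \<theta>. 0 < r \<and> r < 1 \<and> \<theta> \<in> E}"
proof -
  let ?B = "ball 0 1 - {0::real^'k}" and ?p = "\<lambda>y::real^'k. y /\<^sub>R norm y"
  have m: "?p \<in> measurable (restrict_space lborel ?B) (restrict_space borel (sphere 0 1))"
    by (intro measurable_restrict_space2 measurable_restrict_space1) (auto simp: space_restrict_space)
  have E': "E \<in> sets (restrict_space borel (sphere 0 1))"
    using E by (auto simp: sets_restrict_space_iff)
  have B: "?B \<in> sets borel"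
    by auto
  have eq: "?p -` E \<inter> ?B = {r *\<^sub>R \<theta> | r \<theta>. 0 < r \<and> r < 1 \<and> \<theta> \<in> E}" (is "?L = ?R")
  proof (intro set_eqI iffI)
    fix y assume y: "y \<in> ?L"
    then have "y = norm y *\<^sub>R ?p y" "0 < norm y" "norm y < 1" "?p y \<in> E"
      by auto
    then show "y \<in> ?R" by blast
  next
    fix y assume "y \<in> ?R"
    then obtain r \<theta> where *: "y = r *\<^sub>R \<theta>" "0 < r" "r < 1" "\<theta> \<in> E" by auto
    then have "norm \<theta> = 1" using E by auto
    then have "\<theta> \<noteq> 0" by auto
    with * \<open>norm \<theta> = 1\<close> show "y \<in> ?L" by simp
  qed
  have "emeasure sphere_measure E = of_nat CARD('k) *
     emeasure (distr (restrict_space lborel ?B) (restrict_space borel (sphere 0 1)) ?p) E"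
    unfolding sphere_measure_def using E' by (subst emeasure_completion) auto
  also have "\<dots> = of_nat CARD('k) * emeasure (restrict_space lborel ?B) (?p -` E \<inter> ?B)"
    using m E' by (subst emeasure_distr) (auto simp: space_restrict_space)
  also have "emeasure (restrict_space lborel ?B) (?p -` E \<inter> ?B) = emeasure lborel (?p -` E \<inter> ?B)"
    using B by (intro emeasure_restrict_space) auto
  finally show ?thesis by (simp only: eq)
qed

definition ball_of_measure :: "ennreal \<Rightarrow> (real^'k) set" where
  "ball_of_measure m = (if m = \<infinity> then UNIV
     else ball 0 (root CARD('k) (enn2real m / unit_vol TYPE('k))))"

lemma emeasure_ball_of_measure: "emeasure lebesgue (ball_of_measure m :: (real^'k) set) = m"
proof (cases "m = \<infinity>")
  case True
  then show ?thesis by (simp add: ball_of_measure_def)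
next
  case False
  have pos: "0 < unit_vol TYPE('k)"
    by (simp add: unit_vol_def content_ball_pos)
  have r: "0 \<le> root CARD('k) (enn2real m / unit_vol TYPE('k))"
    using pos by simp
  have "measure lborel (ball (0::real^'k) (root CARD('k) (enn2real m / unit_vol TYPE('k)))) = enn2real m"
    using pos r by (subst content_ball_conv_unit_ball) (simp_all add: unit_vol_def real_root_pow_pos2)
  moreover have "emeasure lborel (ball (0::real^'k) r) = ennreal (measure lborel (ball (0::real^'k) r))" for r
    by (intro emeasure_eq_ennreal_measure) (metis bounded_ball emeasure_bounded_finite less_irrefl infinity_ennreal_def)
  ultimately show ?thesis
    using False by (simp add: ball_of_measure_def less_top)
qed

definition steiner :: "nat \<Rightarrow> ((nat \<Rightarrow> real) \<times> (real^'k)) set \<Rightarrow> ((nat \<Rightarrow> real) \<times> (real^'k)) set" where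
  "steiner n A = {(xb, y). xb \<in> space (lebesgue_base (n - CARD('k))) \<and>
     y \<in> ball_of_measure (emeasure lebesgue {y'. (xb, y') \<in> A})}"

definition steiner_rearr ::
  "nat \<Rightarrow> ((nat \<Rightarrow> real) \<times> (real^'k) \<Rightarrow> real) \<Rightarrow> (nat \<Rightarrow> real) \<times> (real^'k) \<Rightarrow> ennreal" where
  "steiner_rearr n f x =
     (\<integral>\<^sup>+t\<in>{0<..}. indicator (steiner n {x \<in> space (lebesgue_Rn n). \<bar>f x\<bar> > t}) x \<partial>lborel)"

definition decr_rearr :: "(real^'k \<Rightarrow> real) \<Rightarrow> real \<Rightarrow> ennreal" where
  "decr_rearr g s = (INF t \<in> {t. 0 \<le> t \<and> emeasure lebesgue {y. \<bar>g y\<bar> > t} \<le> ennreal s}. ennreal t)"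

text \<open>The same rearrangement in the variables \<open>(xb, s)\<close> of \<open>R\<^bsup>n-k\<^esup> \<times> (0,\<infinity>)\<close>.\<close>

definition steiner_rearr_half ::
  "((nat \<Rightarrow> real) \<times> (real^'k) \<Rightarrow> real) \<Rightarrow> (nat \<Rightarrow> real) \<Rightarrow> real \<Rightarrow> ennreal" where
  "steiner_rearr_half f xb s = decr_rearr (\<lambda>y. f (xb, y)) s"

definition locally_integrable :: "nat \<Rightarrow> ((nat \<Rightarrow> real) \<times> (real^'k) \<Rightarrow> real) \<Rightarrow> bool" where
  "locally_integrable n v \<longleftrightarrow> v \<in> borel_measurable (lebesgue_Rn n) \<and>
     (\<forall>R. set_integrable (lebesgue_Rn n)
        {(xb, y) \<in> space (lebesgue_Rn n). (\<forall>i < n - CARD('k). \<bar>xb i\<bar> \<le> R) \<and> norm y \<le> R} v)"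

definition weight :: "nat \<Rightarrow> ((nat \<Rightarrow> real) \<times> (real^'k) \<Rightarrow> real) \<Rightarrow> bool" where
  "weight n v \<longleftrightarrow> (\<forall>x \<in> space (lebesgue_Rn n). 0 \<le> v x) \<and> locally_integrable n v \<and>
     (\<forall>A \<in> sets (lebesgue_Rn n). emeasure (lebesgue_Rn n) A > 0 \<longrightarrow>
        (\<integral>\<^sup>+x\<in>steiner n A. ennreal (v x) \<partial>lebesgue_Rn n) > 0)"

definition weighted_vol ::
  "nat \<Rightarrow> ((nat \<Rightarrow> real) \<times> (real^'k) \<Rightarrow> real) \<Rightarrow> ((nat \<Rightarrow> real) \<times> (real^'k)) set \<Rightarrow> ennreal" where
  "weighted_vol n v E = (\<integral>\<^sup>+x\<in>E. ennreal (v x) \<partial>lebesgue_Rn n)"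

definition weight_bar ::
  "((nat \<Rightarrow> real) \<times> (real^'k) \<Rightarrow> real) \<Rightarrow> (nat \<Rightarrow> real) \<Rightarrow> real \<Rightarrow> ennreal" where
  "weight_bar v xb s =
     (\<integral>\<^sup>+\<theta>. ennreal (v (xb, root CARD('k) (s / unit_vol TYPE('k)) *\<^sub>R \<theta>)) \<partial>sphere_measure)"

text \<open>Real powers with exponent \<open>a > 0\<close> on \<open>[0,\<infinity>]\<close>.\<close>

definition ennreal_powr :: "ennreal \<Rightarrow> real \<Rightarrow> ennreal" where
  "ennreal_powr x a = (if x = \<infinity> then \<infinity> else ennreal (enn2real x powr a))"

definition lorentz_norm ::
  "nat \<Rightarrow> real \<Rightarrow> ((nat \<Rightarrow> real) \<times> (real^'k) \<Rightarrow> real) \<Rightarrow> ((nat \<Rightarrow> real) \<times> (real^'k) \<Rightarrow> real) \<Rightarrow> ennreal" where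
  "lorentz_norm n p v f =
     ennreal_powr (\<integral>\<^sup>+x. ennreal_powr (steiner_rearr n f x) p * ennreal (v x) \<partial>lebesgue_Rn n) (1 / p)"

definition lorentz_space ::
  "nat \<Rightarrow> real \<Rightarrow> ((nat \<Rightarrow> real) \<times> (real^'k) \<Rightarrow> real) \<Rightarrow> ((nat \<Rightarrow> real) \<times> (real^'k) \<Rightarrow> real) set" where
  "lorentz_space n p v = {f \<in> borel_measurable (lebesgue_Rn n). lorentz_norm n p v f < \<infinity>}"

text \<open>
  \<open>N\<close> is a norm on the set \<open>L\<close> of functions modulo equality almost everywhere; this includes that
  \<open>L\<close> is a vector space. That \<open>N\<close> respects almost everywhere equality follows from the
  triangle inequality and definiteness.
\<close>

definition is_norm_mod_ae :: "'a measure \<Rightarrow> ('a \<Rightarrow> real) set \<Rightarrow> (('a \<Rightarrow> real) \<Rightarrow> ennreal) \<Rightarrow> bool" where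
  "is_norm_mod_ae M L N \<longleftrightarrow>
     (\<lambda>_. 0) \<in> L \<and>
     (\<forall>f\<in>L. \<forall>g\<in>L. (\<lambda>x. f x + g x) \<in> L) \<and>
     (\<forall>f\<in>L. \<forall>c. (\<lambda>x. c * f x) \<in> L) \<and>
     (\<forall>f\<in>L. N f < \<infinity>) \<and>
     (\<forall>f\<in>L. N f = 0 \<longleftrightarrow> (AE x in M. f x = 0)) \<and>
     (\<forall>f\<in>L. \<forall>c. N (\<lambda>x. c * f x) = ennreal \<bar>c\<bar> * N f) \<and>
     (\<forall>f\<in>L. \<forall>g\<in>L. N (\<lambda>x. f x + g x) \<le> N f + N g)"

text \<open>``Non-increasing on \<open>(0,\<infinity>)\<close> up to modification on a null set.''\<close>

definition ae_nonincreasing :: "(real \<Rightarrow> ennreal) \<Rightarrow> bool" where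
  "ae_nonincreasing w \<longleftrightarrow>
     (\<exists>g. antimono_on {0<..} g \<and> (AE s in lborel. 0 < s \<longrightarrow> w s = g s))"

end

theory Submission
  imports Defs
begin

text \<open>
  Everything reduces to the \<open>k\<close>-dimensional fibres and to one functional, the integral of the
  symmetrization \<open>C(f) = \<integral> (S f) v\<close> (\<open>choquet\<close>). In polar coordinates on the fibres, \<open>C(f)\<close> is
  up to the constant \<open>k \<sigma>\<^sub>k\<close> the integral over base and half-line of the fibrewise
  rearrangement of \<open>f\<close> against the averaged weight (\<open>choquet_eq_half_integral\<close>), which is the
  right-hand side of the duality formula (d). On indicator functions \<open>C\<close> is \<open>V\<close> of the symmetrized
  set, and the \<open>p\<close>-th power of the norm of \<open>f\<close> is \<open>C\<close> of \<open>|f|\<^sup>p\<close>.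

  (c) implies (d). By the Hardy-Littlewood inequality on every fibre no admissible \<open>h\<close> exceeds the
  right-hand side. The value is approached, because \<open>|f|\<close> is the supremum of simple functions
  and for a simple function \<open>F\<close> there is an explicit measure preserving map \<open>T\<close> from (a part of) the
  fibre onto the half-line along which \<open>F\<close> is arranged in decreasing order: \<open>T y\<close> is the measure of
  the set of points that precede \<open>y\<close> when points are ordered by the value of \<open>F\<close> and ties are broken
  by the distance to the origin (\<open>level_rank\<close>). Then \<open>h\<close> is the averaged weight composed with \<open>T\<close>, and
  since the averaged weight decreases, it is its own rearrangement (\<open>ex_admissible_for_simple\<close>).

  (d) implies (c), (a) and (b). As the weight is non-trivial, (d) for a positive constant
  shows that an admissible \<open>h\<close> exists; its rearrangement is decreasing and equals the averaged weight.
  By (d) the functional \<open>C\<close> is a supremum of functionals that are sublinear, so it is sublinear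
  itself. Applied to two indicators, using that \<open>C\<close> is additive on \<open>\<chi>\<^sub>A + \<chi>\<^sub>B\<close> with \<open>A \<subseteq> B\<close>, this is
  (b). Applied to \<open>p\<close>-th powers it makes the unit ball of the norm convex, which is (a).

  (a) implies (b) if \<open>A \<union> B\<close> has a symmetrization of finite weighted volume. The triangle inequality for \<open>\<delta> \<chi>\<^sub>A + \<chi>\<close> and
  \<open>\<delta> \<chi>\<^sub>B + \<chi>\<close>, where \<open>\<chi>\<close> is the indicator of \<open>A \<union> B\<close>, is an equality at \<open>\<delta> = 0\<close>, and its derivative
  there is (b) (\<open>submodular_of_norm\<close>).

  (b) under this restriction implies (c). For products of a base set with a ball and with a
  ball united with a ring, (b) says that the averaged weight has, on almost every fibre, an integral
  over an interval of the half-line that is at most its integral over any interval of the same length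
  to the left. Its averages over the intervals \<open>[s, s + 2\<^sup>-\<^sup>n)\<close> are then decreasing in \<open>s\<close> and increasing
  in \<open>n\<close>, and their supremum is a decreasing version (\<open>antimono_of_shift_inequality\<close>).
\<close>

section \<open>Rearrangement on a measure space\<close>

definition distrib :: "'a measure \<Rightarrow> ('a \<Rightarrow> ennreal) \<Rightarrow> ennreal \<Rightarrow> ennreal" where
  "distrib N F t = emeasure N {y \<in> space N. t < F y}"

text \<open>
  The decreasing rearrangement as a generalized inverse of the distribution function. Both are
  defined on \<open>[0,\<infinity>]\<close>, which makes the Galois connection \<open>less_rearr_iff\<close> hold without exceptions;
  most properties of rearrangements below are read off from it.
\<close>

definition rearr :: "'a measure \<Rightarrow> ('a \<Rightarrow> ennreal) \<Rightarrow> ennreal \<Rightarrow> ennreal" where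
  "rearr N F s = Sup {t. s < distrib N F t}"

lemma distrib_antimono:
  assumes "F \<in> borel_measurable N" "t \<le> t'"
  shows "distrib N F t' \<le> distrib N F t"
  unfolding distrib_def using assms by (intro emeasure_mono) auto

text \<open>
  Continuity of the measure along the increasing sets \<open>{F > t + 1/(n+1)}\<close>. It makes the supremum
  in the definition of \<open>rearr\<close> a strict inverse.
\<close>

lemma distrib_right_continuous:
  assumes F[measurable]: "F \<in> borel_measurable N" and s: "s < distrib N F t"
  shows "\<exists>t'>t. s < distrib N F t'"
proof -
  have fin: "t < top"
  proof (rule ccontr)
    assume "\<not> t < top"
    then have "t = top" by (metis less_top)
    with s show False by (simp add: distrib_def)
  qed
  define u where "u n = t + ennreal (inverse (real (Suc n)))" for n :: nat
  have u_lim: "u \<longlonglongrightarrow> t + ennreal 0"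
    unfolding u_def by (intro tendsto_add tendsto_const tendsto_ennrealI LIMSEQ_inverse_real_of_nat) 
  have u_gt: "t < u n" for n
    using fin by (cases t) (auto simp: u_def ennreal_plus[symmetric] ennreal_less_iff simp del: ennreal_plus)
  have dec: "u n \<le> u m" if "m \<le> n" for m n
    using that by (auto simp: u_def intro!: add_left_mono ennreal_leI le_imp_inverse_le)
  have inc: "incseq (\<lambda>n. {y \<in> space N. u n < F y})"
    by (auto simp: incseq_def intro: le_less_trans[OF dec])
  have un: "(\<Union>n. {y \<in> space N. u n < F y}) = {y \<in> space N. t < F y}"
  proof (intro set_eqI iffI)
    fix y assume "y \<in> {y \<in> space N. t < F y}"
    then have "y \<in> space N" "t < F y" by auto
    moreover have "\<forall>\<^sub>F n in sequentially. u n < F y"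
      using u_lim \<open>t < F y\<close> by (intro order_tendstoD(2)[of _ t]) auto
    then obtain n where "u n < F y" by (auto simp: eventually_sequentially)
    ultimately show "y \<in> (\<Union>n. {y \<in> space N. u n < F y})" by auto
  qed (auto intro: less_trans[OF u_gt])
  have "(SUP n. emeasure N {y \<in> space N. u n < F y}) = emeasure N (\<Union>n. {y \<in> space N. u n < F y})"
    using inc by (intro SUP_emeasure_incseq) auto
  then have "(SUP n. distrib N F (u n)) = distrib N F t"
    unfolding un by (simp add: distrib_def)
  with s have "s < (SUP n. distrib N F (u n))" by simp
  then obtain n where "s < distrib N F (u n)" by (auto simp: less_SUP_iff)
  with u_gt show ?thesis by blast
qed

lemma less_rearr_iff:
  assumes F: "F \<in> borel_measurable N"
  shows "t < rearr N F s \<longleftrightarrow> s < distrib N F t"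
proof
  assume "t < rearr N F s"
  then obtain t' where "t < t'" "s < distrib N F t'"
    unfolding rearr_def by (auto simp: less_Sup_iff)
  with distrib_antimono[OF F, of t t'] show "s < distrib N F t" by (auto intro: less_le_trans)
next
  assume "s < distrib N F t"
  from distrib_right_continuous[OF F this] show "t < rearr N F s"
    unfolding rearr_def by (auto simp: less_Sup_iff)
qed

lemma ennreal_eqI_less: "(\<And>t::ennreal. t < a \<longleftrightarrow> t < b) \<Longrightarrow> a = b"
  by (meson linorder_less_linear order_less_irrefl)

lemma ennreal_leI_less: "(\<And>t::ennreal. t < a \<Longrightarrow> t < b) \<Longrightarrow> a \<le> b"
  by (meson leI less_irrefl)

lemma rearr_antimono: "s \<le> s' \<Longrightarrow> rearr N F s' \<le> rearr N F s"
  unfolding rearr_def by (intro Sup_subset_mono) auto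

lemma rearr_mono:
  assumes [measurable]: "F \<in> borel_measurable N" "G \<in> borel_measurable N" and le: "AE y in N. F y \<le> G y"
  shows "rearr N F s \<le> rearr N G s"
proof (rule ennreal_leI_less)
  fix t assume "t < rearr N F s"
  then have "s < distrib N F t" using assms by (simp add: less_rearr_iff)
  also have "\<dots> \<le> distrib N G t"
    unfolding distrib_def
  proof (rule emeasure_mono_AE)
    show "AE y in N. y \<in> {y \<in> space N. t < F y} \<longrightarrow> y \<in> {y \<in> space N. t < G y}"
      using le by eventually_elim (auto intro: less_le_trans)
  qed measurable
  finally show "t < rearr N G s" using assms by (simp add: less_rearr_iff)
qed

lemma rearr_SUP:
  assumes F[measurable]: "\<And>n. F n \<in> borel_measurable N" and "incseq F"
  shows "rearr N (\<lambda>y. SUP n. F n y) s = (SUP n. rearr N (F n) s)"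
proof (rule ennreal_eqI_less)
  fix t
  have "(SUP n. distrib N (F n) t) = emeasure N (\<Union>n. {y \<in> space N. t < F n y})"
    unfolding distrib_def
    using \<open>incseq F\<close> by (intro SUP_emeasure_incseq) (auto simp: incseq_def le_fun_def intro: less_le_trans)
  also have "(\<Union>n. {y \<in> space N. t < F n y}) = {y \<in> space N. t < (SUP n. F n y)}"
    by (auto simp: less_SUP_iff)
  finally have eq: "(SUP n. distrib N (F n) t) = distrib N (\<lambda>y. SUP n. F n y) t"
    by (simp add: distrib_def)
  have "t < rearr N (\<lambda>y. SUP n. F n y) s \<longleftrightarrow> s < (SUP n. distrib N (F n) t)"
    unfolding eq by (subst less_rearr_iff) auto
  also have "\<dots> \<longleftrightarrow> t < (SUP n. rearr N (F n) s)"
    by (simp add: less_SUP_iff less_rearr_iff)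
  finally show "t < rearr N (\<lambda>y. SUP n. F n y) s \<longleftrightarrow> t < (SUP n. rearr N (F n) s)" .
qed

abbreviation pos_line :: "real measure" where
  "pos_line \<equiv> restrict_space lborel {0<..}"

lemma sigma_finite_pos_line: "sigma_finite_measure pos_line"
  by (intro sigma_finite_measure_restrict_space sigma_finite_lborel) auto

interpretation pos_line: sigma_finite_measure pos_line
  by (rule sigma_finite_pos_line)

lemma space_pos_line[simp]: "space pos_line = {0<..}"
  by (simp add: space_restrict_space)

lemma AE_pos_line_iff: "(AE s in pos_line. P s) \<longleftrightarrow> (AE s in lborel. 0 < s \<longrightarrow> P s)"
  by (subst AE_restrict_space_iff) auto

lemma emeasure_pos_line_less: "emeasure pos_line {s \<in> {0<..}. ennreal s < a} = a"
proof -
  have "emeasure pos_line {s \<in> {0<..}. ennreal s < a} = emeasure lborel {s \<in> {0<..}. ennreal s < a}"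
    by (intro emeasure_restrict_space) auto
  also have "\<dots> = a"
  proof (cases a)
    case (real r)
    have "{s \<in> {0<..}. ennreal s < a} = {0<..<r}"
      using real by (auto simp: ennreal_less_iff)
    with real show ?thesis by simp
  next
    case top
    have eq: "{s \<in> {0<..}. ennreal s < a} = {0<..}"
      using top by auto
    have "ennreal (real n) \<le> emeasure lborel ({0<..} :: real set)" for n
    proof -
      have "ennreal (real n) = emeasure lborel {0<..<real n}" by simp
      also have "\<dots> \<le> emeasure lborel ({0<..} :: real set)" by (intro emeasure_mono) auto
      finally show ?thesis .
    qed
    then have "emeasure lborel ({0<..} :: real set) = top"
      by (metis ennreal_SUP_of_nat_eq_top SUP_least ennreal_of_nat_eq_real_of_nat top_unique)
    with eq top show ?thesis by simp
  qed
  finally show ?thesis .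
qed

lemma nn_integral_less_ennreal: "(\<integral>\<^sup>+s. indicator {s. ennreal s < a} s \<partial>pos_line) = a"
proof -
  have "(\<integral>\<^sup>+s. indicator {s. ennreal s < a} s \<partial>pos_line) = (\<integral>\<^sup>+s. indicator {s \<in> {0<..}. ennreal s < a} s \<partial>pos_line)"
    by (intro nn_integral_cong) (auto simp: indicator_def)
  also have "\<dots> = emeasure pos_line {s \<in> {0<..}. ennreal s < a}"
    by (intro nn_integral_indicator) (auto simp: sets_restrict_space_iff)
  also have "\<dots> = a" by (rule emeasure_pos_line_less)
  finally show ?thesis .
qed

lemma borel_measurable_pos_line: "f \<in> borel_measurable borel \<Longrightarrow> f \<in> borel_measurable pos_line"
  by (intro measurable_restrict_space1) simp

lemma measurable_id_pos_line[measurable]: "(\<lambda>x. x) \<in> measurable pos_line borel"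
  by (intro measurable_restrict_space1) simp

text \<open>
  By the Galois connection a superlevel set of the rearrangement is a set on which two measurable
  functions are compared.
\<close>

lemma borel_measurable_rearr_param:
  fixes F :: "'x \<Rightarrow> 'y \<Rightarrow> ennreal"
  assumes N: "sigma_finite_measure N"
    and F[measurable]: "(\<lambda>(x, y). F x y) \<in> borel_measurable (M \<Otimes>\<^sub>M N)"
    and u[measurable]: "u \<in> borel_measurable M'" and g[measurable]: "g \<in> measurable M' M"
  shows "(\<lambda>z. rearr N (F (g z)) (u z)) \<in> borel_measurable M'"
proof (rule borel_measurableI_greater)
  fix t :: ennreal
  interpret N: sigma_finite_measure N by (rule N)
  have sec: "F x \<in> borel_measurable N" if "x \<in> space M" for x
    using measurable_compose[OF measurable_Pair1'[OF that] F] by simp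
  show "{z \<in> space M'. t < rearr N (F (g z)) (u z)} \<in> sets M'"
  proof -
    have "(\<lambda>x. distrib N (F x) t) \<in> borel_measurable M"
      unfolding distrib_def by measurable
    then have [measurable]: "(\<lambda>z. distrib N (F (g z)) t) \<in> borel_measurable M'"
      by measurable
    have "{z \<in> space M'. t < rearr N (F (g z)) (u z)} = {z \<in> space M'. u z < distrib N (F (g z)) t}"
      using measurable_space[OF g] by (auto simp: less_rearr_iff sec)
    also have "\<dots> \<in> sets M'" by measurable
    finally show ?thesis .
  qed
qed

text \<open>
  This links the rearrangement as a generalized inverse with the integral over levels that
  defines the Steiner rearrangement.
\<close>

lemma rearr_eq_integral:
  assumes "F \<in> borel_measurable N"
  shows "rearr N F s = (\<integral>\<^sup>+t. indicator {t. s < distrib N F (ennreal t)} t \<partial>pos_line)"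
proof -
  have "rearr N F s = (\<integral>\<^sup>+t. indicator {t. ennreal t < rearr N F s} t \<partial>pos_line)"
    by (simp only: nn_integral_less_ennreal)
  then show ?thesis using assms by (simp only: less_rearr_iff)
qed

text \<open>
  Both functions are written as integrals of the indicators of their superlevel sets. The
  intersection of two superlevel sets is at most as large as the smaller one, while the superlevel
  sets of the rearrangements are nested intervals, for which this bound is attained.
\<close>

theorem Hardy_Littlewood:
  assumes N: "sigma_finite_measure N"
    and F[measurable]: "F \<in> borel_measurable N" and G[measurable]: "G \<in> borel_measurable N"
  shows "(\<integral>\<^sup>+y. F y * G y \<partial>N) \<le> (\<integral>\<^sup>+s. rearr N F (ennreal s) * rearr N G (ennreal s) \<partial>pos_line)"
proof -
  interpret N: sigma_finite_measure N by (rule N)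
  interpret PN: pair_sigma_finite pos_line N
    by (intro pair_sigma_finite.intro sigma_finite_pos_line N)
  interpret PP: pair_sigma_finite pos_line pos_line
    by (intro pair_sigma_finite.intro sigma_finite_pos_line)
  let ?i = "\<lambda>(a::ennreal) t. if ennreal t < a then 1 else 0 :: ennreal"
  have ind: "indicator {t. ennreal t < a} t = ?i a t" for a t by (simp add: indicator_def)
  have int: "(\<integral>\<^sup>+t. ?i a t \<partial>pos_line) = a" for a
    using nn_integral_less_ennreal[of a] by (simp only: ind)
  have dm[measurable]: "(\<lambda>x. distrib N H (ennreal (g x))) \<in> borel_measurable K"
    if [measurable]: "H \<in> borel_measurable N" "g \<in> borel_measurable K" for g H and K :: "'z measure"
    unfolding distrib_def by measurable
  have int2: "(\<integral>\<^sup>+t. (\<integral>\<^sup>+\<tau>. f t * g \<tau> \<partial>pos_line) \<partial>pos_line) = integral\<^sup>N pos_line f * integral\<^sup>N pos_line g"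
    if [measurable]: "f \<in> borel_measurable pos_line" "g \<in> borel_measurable pos_line" for f g :: "real \<Rightarrow> ennreal"
  proof -
    have "(\<integral>\<^sup>+t. (\<integral>\<^sup>+\<tau>. f t * g \<tau> \<partial>pos_line) \<partial>pos_line) = (\<integral>\<^sup>+t. f t * integral\<^sup>N pos_line g \<partial>pos_line)"
      by (intro nn_integral_cong nn_integral_cmult that)
    also have "\<dots> = integral\<^sup>N pos_line f * integral\<^sup>N pos_line g"
      by (intro nn_integral_multc that)
    finally show ?thesis .
  qed
  have prod: "F y * G y = (\<integral>\<^sup>+t. (\<integral>\<^sup>+\<tau>. ?i (F y) t * ?i (G y) \<tau> \<partial>pos_line) \<partial>pos_line)"
    if "y \<in> space N" for y
  proof -
    have "(\<integral>\<^sup>+t. (\<integral>\<^sup>+\<tau>. ?i (F y) t * ?i (G y) \<tau> \<partial>pos_line) \<partial>pos_line)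
        = (\<integral>\<^sup>+t. ?i (F y) t \<partial>pos_line) * (\<integral>\<^sup>+t. ?i (G y) t \<partial>pos_line)"
      by (rule int2) measurable
    then show ?thesis by (simp only: int)
  qed
  have le: "(\<integral>\<^sup>+y. ?i (F y) t * ?i (G y) \<tau> \<partial>N)
      \<le> (\<integral>\<^sup>+s. ?i (distrib N F t) s * ?i (distrib N G \<tau>) s \<partial>pos_line)" for t \<tau>
  proof -
    have "(\<integral>\<^sup>+y. ?i (F y) t * ?i (G y) \<tau> \<partial>N) = (\<integral>\<^sup>+y. indicator {y \<in> space N. ennreal t < F y \<and> ennreal \<tau> < G y} y \<partial>N)"
      by (intro nn_integral_cong) (auto simp: indicator_def)
    also have "\<dots> = emeasure N {y \<in> space N. ennreal t < F y \<and> ennreal \<tau> < G y}"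
      by (intro nn_integral_indicator) measurable
    also have "\<dots> \<le> min (distrib N F t) (distrib N G \<tau>)"
      unfolding distrib_def by (intro min.boundedI emeasure_mono) auto
    also have "\<dots> = (\<integral>\<^sup>+s. ?i (min (distrib N F t) (distrib N G \<tau>)) s \<partial>pos_line)"
      by (simp only: int)
    also have "\<dots> = (\<integral>\<^sup>+s. ?i (distrib N F t) s * ?i (distrib N G \<tau>) s \<partial>pos_line)"
      by (intro nn_integral_cong) (auto simp: indicator_def)
    finally show ?thesis .
  qed
  have "(\<integral>\<^sup>+y. F y * G y \<partial>N) = (\<integral>\<^sup>+y. (\<integral>\<^sup>+t. (\<integral>\<^sup>+\<tau>. ?i (F y) t * ?i (G y) \<tau> \<partial>pos_line) \<partial>pos_line) \<partial>N)"
    by (intro nn_integral_cong prod)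
  also have "\<dots> = (\<integral>\<^sup>+t. (\<integral>\<^sup>+y. (\<integral>\<^sup>+\<tau>. ?i (F y) t * ?i (G y) \<tau> \<partial>pos_line) \<partial>N) \<partial>pos_line)"
    by (intro PN.Fubini') measurable
  also have "\<dots> = (\<integral>\<^sup>+t. (\<integral>\<^sup>+\<tau>. (\<integral>\<^sup>+y. ?i (F y) t * ?i (G y) \<tau> \<partial>N) \<partial>pos_line) \<partial>pos_line)"
    by (intro nn_integral_cong PN.Fubini') measurable
  also have "\<dots> \<le> (\<integral>\<^sup>+t. (\<integral>\<^sup>+\<tau>. (\<integral>\<^sup>+s. ?i (distrib N F t) s * ?i (distrib N G \<tau>) s \<partial>pos_line) \<partial>pos_line) \<partial>pos_line)"
    by (intro nn_integral_mono le)
  also have "\<dots> = (\<integral>\<^sup>+t. (\<integral>\<^sup>+s. (\<integral>\<^sup>+\<tau>. ?i (distrib N F t) s * ?i (distrib N G \<tau>) s \<partial>pos_line) \<partial>pos_line) \<partial>pos_line)"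
    by (intro nn_integral_cong PP.Fubini') measurable
  also have "\<dots> = (\<integral>\<^sup>+s. (\<integral>\<^sup>+t. (\<integral>\<^sup>+\<tau>. ?i (distrib N F t) s * ?i (distrib N G \<tau>) s \<partial>pos_line) \<partial>pos_line) \<partial>pos_line)"
    by (intro PP.Fubini') measurable
  also have "\<dots> = (\<integral>\<^sup>+s. rearr N F s * rearr N G s \<partial>pos_line)"
  proof (intro nn_integral_cong)
    fix s :: real
    have r: "(\<integral>\<^sup>+\<tau>. ?i (distrib N H \<tau>) s \<partial>pos_line) = rearr N H s" if "H \<in> borel_measurable N" for H
      using rearr_eq_integral[OF that, of s] by (simp only: indicator_def mem_Collect_eq of_bool_def)
    show "(\<integral>\<^sup>+t. (\<integral>\<^sup>+\<tau>. ?i (distrib N F t) s * ?i (distrib N G \<tau>) s \<partial>pos_line) \<partial>pos_line) = rearr N F s * rearr N G s"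
    proof -
      have "(\<integral>\<^sup>+t. (\<integral>\<^sup>+\<tau>. ?i (distrib N F t) s * ?i (distrib N G \<tau>) s \<partial>pos_line) \<partial>pos_line)
        = (\<integral>\<^sup>+t. ?i (distrib N F t) s \<partial>pos_line) * (\<integral>\<^sup>+t. ?i (distrib N G t) s \<partial>pos_line)"
        by (rule int2) measurable
      then show ?thesis by (simp only: r F G)
    qed
  qed
  finally show ?thesis .
qed

text \<open>
  The superlevel set \<open>{g > t}\<close> is an interval from \<open>0\<close> to its own measure. So \<open>g s > t\<close> can differ from
  \<open>rearr g s > t\<close> only if \<open>s\<close> is the endpoint of that interval, and rational \<open>t\<close> suffice.
\<close>

lemma rearr_pos_line_antimono:
  fixes w g :: "real \<Rightarrow> ennreal"
  assumes w[measurable]: "w \<in> borel_measurable pos_line"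
    and g: "antimono_on {0<..} g" and ae: "AE s in pos_line. w s = g s"
  shows "AE s in pos_line. rearr pos_line w (ennreal s) = w s"
proof -
  define d where "d t = distrib pos_line w t" for t
  have le_d: "ennreal s \<le> d t" if "0 < s" "t < g s" for s t
  proof -
    have "ennreal s = emeasure pos_line {0<..<s}"
      using that by (subst emeasure_restrict_space) auto
    also have "\<dots> \<le> emeasure pos_line {s \<in> space pos_line. t < w s}"
    proof (rule emeasure_mono_AE)
      show "AE x in pos_line. x \<in> {0<..<s} \<longrightarrow> x \<in> {s \<in> space pos_line. t < w s}"
        using ae AE_space
      proof eventually_elim
        case (elim x)
        have "g s \<le> g x" if "x < s" 
          using g that elim \<open>0 < s\<close> unfolding monotone_on_def by auto
        with elim \<open>t < g s\<close> show ?case by (auto intro: less_le_trans)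
      qed
    qed measurable
    finally show ?thesis by (simp add: d_def distrib_def)
  qed
  have d_le: "d t \<le> ennreal s" if "0 < s" "g s \<le> t" for s t
  proof -
    have "d t \<le> emeasure pos_line {0<..<s}"
      unfolding d_def distrib_def
    proof (rule emeasure_mono_AE)
      have "AE x in lborel. x \<noteq> s" by (rule AE_lborel_singleton)
      then have "AE x in pos_line. x \<noteq> s" by (subst AE_restrict_space_iff) auto
      with ae AE_space show "AE x in pos_line. x \<in> {s \<in> space pos_line. t < w s} \<longrightarrow> x \<in> {0<..<s}"
      proof eventually_elim
        case (elim x)
        have "g x \<le> g s" if "s \<le> x" 
          using g that elim \<open>0 < s\<close> unfolding monotone_on_def by auto
        with elim \<open>g s \<le> t\<close> show ?case by fastforce
      qed
      show "{0<..<s} \<in> sets pos_line" by (auto simp: sets_restrict_space_iff)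
    qed
    also have "\<dots> = ennreal s" using that by (subst emeasure_restrict_space) auto
    finally show ?thesis .
  qed
  have le: "rearr pos_line w s \<le> g s" if "0 < s" for s :: real
  proof (rule ennreal_leI_less)
    fix t assume "t < rearr pos_line w s"
    then have "s < d t" by (simp add: less_rearr_iff d_def)
    with d_le[OF that, of t] show "t < g s" by (meson leD leI)
  qed
  \<comment> \<open>The endpoints of the superlevel intervals of rational level.\<close>
  define D where "D = (\<lambda>q::rat. enn2real (d (ennreal (real_of_rat q)))) ` UNIV"
  have "countable D" unfolding D_def by simp
  then have "AE s in lborel. s \<notin> D"
    by (intro AE_not_in countable_imp_null_set_lborel)
  then have "AE s in pos_line. s \<notin> D" by (subst AE_restrict_space_iff) auto
  then show ?thesis using ae AE_space
  proof eventually_elim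
    case (elim s)
    then have s: "0 < s" "s \<notin> D" "w s = g s" by auto
    have "\<not> rearr pos_line w s < g s"
    proof
      assume "rearr pos_line w s < g s"
      then obtain r :: rat where r: "rearr pos_line w s < ennreal (real_of_rat r)" "ennreal (real_of_rat r) < g s"
        using ennreal_rat_dense by blast
      define q where "q = real_of_rat r"
      have q: "rearr pos_line w s < ennreal q" "ennreal q < g s" using r by (auto simp: q_def)
      have "\<not> ennreal q < rearr pos_line w s" using q by auto
      then have "\<not> s < d (ennreal q)" by (simp add: less_rearr_iff d_def)
      with le_d[OF s(1) q(2)] have "d (ennreal q) = ennreal s" by auto
      then have "s \<in> D" unfolding D_def using s by (auto simp: image_iff q_def intro!: exI[of _ r])
      with s show False by simp
    qed
    with le[OF s(1)] s show ?case by auto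
  qed
qed

section \<open>Arranging a simple function in decreasing order\<close>

text \<open>
  The radii \<open>r\<close> for which \<open>E \<inter> ball 0 r\<close> has measure at most \<open>u\<close> form an interval \<open>[0, r\<^sub>0]\<close>, and
  continuity in the radius gives \<open>E \<inter> ball 0 r\<^sub>0\<close> the measure \<open>u\<close>.
\<close>

lemma emeasure_sublevel_of_ball_content:
  fixes E :: "'a::euclidean_space set"
  assumes E[measurable]: "E \<in> sets borel" and u: "u < emeasure lborel E"
  shows "emeasure lborel {y \<in> E. emeasure lborel (E \<inter> ball 0 (norm y)) \<le> u} = u"
proof -
  define m where "m r = emeasure lborel (E \<inter> ball 0 r)" for r :: real
  define I where "I = {r. 0 \<le> r \<and> m r \<le> u}"
  have m_mono: "m r \<le> m r'" if "r \<le> r'" for r r'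
    unfolding m_def using that by (intro emeasure_mono) auto
  have I0: "0 \<in> I" by (simp add: I_def m_def)
  have "(SUP n. m (real n)) = emeasure lborel (\<Union>n. E \<inter> ball 0 (real n))"
    unfolding m_def by (intro SUP_emeasure_incseq) (auto simp: incseq_def)
  also have "(\<Union>n. E \<inter> ball 0 (real n)) = E"
    by (auto intro: reals_Archimedean2)
  finally have "u < (SUP n. m (real n))" using u by simp
  then obtain n where n: "u < m (real n)" by (auto simp: less_SUP_iff)
  have bdd: "r \<le> real n" if "r \<in> I" for r
    using that n m_mono[of "real n" r] by (auto simp: I_def intro: ccontr)
  then have bdd_above: "bdd_above I" by (auto simp: bdd_above_def)
  define r where "r = Sup I"
  have r0: "0 \<le> r" unfolding r_def using I0 bdd_above by (rule cSup_upper)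
  have below: "m x \<le> u" if xr: "x < r" for x
  proof -
    obtain z where "z \<in> I" "x < z"
    proof (rule less_cSupE[of x I])
      show "x < Sup I" using xr by (simp add: r_def)
      show "I \<noteq> {}" using I0 by auto
    qed
    then show ?thesis using m_mono[of x z] by (auto simp: I_def)
  qed
  have above: "u < m x" if "r < x" for x
  proof (rule ccontr)
    assume "\<not> u < m x"
    with that r0 have "x \<in> I" by (auto simp: I_def)
    with bdd_above that show False unfolding r_def by (meson cSup_upper leD)
  qed
  have inv_le: "inverse (real (Suc n)) \<le> inverse (real (Suc m))" if "m \<le> n" for m n
    using that by (intro le_imp_inverse_le) auto
  \<comment> \<open>Continuity from the left and from the right; spheres are null sets.\<close>
  have "m r \<le> u"
  proof -
    have "(SUP n. m (r - inverse (Suc n))) = emeasure lborel (\<Union>n. E \<inter> ball 0 (r - inverse (Suc n)))"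
      unfolding m_def 
    proof (intro SUP_emeasure_incseq)
      show "incseq (\<lambda>n. E \<inter> ball 0 (r - inverse (real (Suc n))))"
        unfolding incseq_def using inv_le by (intro allI impI Int_mono subset_ball) (auto simp del: of_nat_Suc)
    qed auto
    also have "(\<Union>n. E \<inter> ball 0 (r - inverse (Suc n))) = E \<inter> ball 0 r"
    proof (intro set_eqI iffI)
      fix y assume y: "y \<in> E \<inter> ball 0 r"
      then have "0 < r - norm y" by simp
      then obtain n where "inverse (real (Suc n)) < r - norm y" using reals_Archimedean by blast
      with y show "y \<in> (\<Union>n. E \<inter> ball 0 (r - inverse (Suc n)))" by (auto intro!: exI[of _ n] simp del: of_nat_Suc)
    next
      fix y assume "y \<in> (\<Union>n. E \<inter> ball 0 (r - inverse (Suc n)))"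
      then obtain n where "y \<in> E" "norm y < r - inverse (real (Suc n))" by auto
      moreover have "0 < inverse (real (Suc n))" by simp
      ultimately have "norm y < r" by linarith
      with \<open>y \<in> E\<close> show "y \<in> E \<inter> ball 0 r" by simp
    qed
    finally have "m r = (SUP n. m (r - inverse (Suc n)))" by (simp add: m_def)
    also have "\<dots> \<le> u" by (intro SUP_least below) simp
    finally show ?thesis .
  qed
  have null: "sphere (0::'a) r \<in> null_sets lborel"
    using negligible_sphere[of "0::'a" r]
    by (auto simp: null_sets_completion_iff negligible_iff_null_sets)
  have cb: "emeasure lborel (E \<inter> cball 0 r) = m r"
    unfolding m_def
  proof (rule emeasure_eq_AE)
    show "AE x in lborel. (x \<in> E \<inter> cball 0 r) = (x \<in> E \<inter> ball 0 r)"
      using AE_not_in[OF null] by eventually_elim auto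
  qed auto
  have "u \<le> m r"
  proof -
    have "(INF n. emeasure lborel (E \<inter> ball 0 (r + inverse (Suc n)))) = emeasure lborel (\<Inter>n. E \<inter> ball 0 (r + inverse (Suc n)))"
    proof (intro INF_emeasure_decseq)
      show "decseq (\<lambda>n. E \<inter> ball 0 (r + inverse (Suc n)))"
        unfolding decseq_def using inv_le by (intro allI impI Int_mono subset_ball) (auto simp del: of_nat_Suc)
      fix i show "emeasure lborel (E \<inter> ball 0 (r + inverse (Suc i))) \<noteq> \<infinity>"
        using emeasure_bounded_finite[of "E \<inter> ball 0 (r + inverse (Suc i))"]
        by (simp add: bounded_Int less_top)
    qed auto
    also have "(\<Inter>n. E \<inter> ball 0 (r + inverse (Suc n))) = E \<inter> cball 0 r"
    proof (intro set_eqI iffI)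
      fix y assume y: "y \<in> (\<Inter>n. E \<inter> ball 0 (r + inverse (Suc n)))"
      have "norm y \<le> r"
      proof (rule ccontr)
        assume "\<not> norm y \<le> r"
        then have "0 < norm y - r" by simp
        then obtain n where "inverse (real (Suc n)) < norm y - r" using reals_Archimedean by blast
        moreover have "y \<in> ball 0 (r + inverse (real (Suc n)))" using y by blast
        then have "norm y < r + inverse (real (Suc n))" by (simp only: mem_ball_0)
        ultimately show False by linarith
      qed
      moreover have "y \<in> E" using y by blast
      ultimately show "y \<in> E \<inter> cball 0 r" by simp
    next
      fix y assume y: "y \<in> E \<inter> cball 0 r"
      have "norm y < r + inverse (real (Suc n))" for n
      proof -
        have "norm y \<le> r" using y by simp
        moreover have "0 < inverse (real (Suc n))" by simp
        ultimately show ?thesis by linarith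
      qed
      then have "y \<in> E \<inter> ball 0 (r + inverse (Suc n))" for n using y by (simp only: Int_iff mem_ball_0)
      then show "y \<in> (\<Inter>n. E \<inter> ball 0 (r + inverse (Suc n)))" by blast
    qed
    finally have "m r = (INF n. m (r + inverse (Suc n)))" by (simp add: m_def cb)
    moreover have "u \<le> (INF n. m (r + inverse (Suc n)))"
      by (rule INF_greatest) (rule less_imp_le[OF above], simp)
    ultimately show ?thesis by simp
  qed
  with \<open>m r \<le> u\<close> have mr: "m r = u" by simp
  have "{y \<in> E. emeasure lborel (E \<inter> ball 0 (norm y)) \<le> u} = E \<inter> cball 0 r"
  proof (intro set_eqI iffI)
    fix y assume "y \<in> {y \<in> E. emeasure lborel (E \<inter> ball 0 (norm y)) \<le> u}"
    then have "y \<in> E" "m (norm y) \<le> u" by (auto simp: m_def)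
    with above[of "norm y"] show "y \<in> E \<inter> cball 0 r" by (auto intro: ccontr)
  next
    fix y assume "y \<in> E \<inter> cball 0 r"
    then have "y \<in> E" "m (norm y) \<le> m r" by (auto intro: m_mono)
    with mr show "y \<in> {y \<in> E. emeasure lborel (E \<inter> ball 0 (norm y)) \<le> u}" by (auto simp: m_def)
  qed
  with cb mr show ?thesis by simp
qed

text \<open>
  The measure of the set of points that come before \<open>y\<close> when points are listed by decreasing value
  of \<open>F\<close>, and points of equal value by increasing norm. For \<open>F\<close> with finitely many values this is a
  measure preserving map from \<open>{level_rank F < \<infinity>}\<close> to the half-line. It is explicit, hence jointly
  measurable when \<open>F\<close> depends on a parameter.
\<close>

definition level_rank :: "('a::euclidean_space \<Rightarrow> ennreal) \<Rightarrow> 'a \<Rightarrow> ennreal" where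
  "level_rank F y = emeasure lborel {y'. F y < F y' \<or> F y = F y' \<and> norm y' < norm y}"

lemma level_rank_split:
  assumes [measurable]: "F \<in> borel_measurable borel"
  shows "level_rank F y = distrib lborel F (F y) + emeasure lborel ({y'. F y' = F y} \<inter> ball 0 (norm y))"
proof -
  have "{y'. F y < F y' \<or> F y = F y' \<and> norm y' < norm y} = {y' \<in> space lborel. F y < F y'} \<union> ({y'. F y' = F y} \<inter> ball 0 (norm y))"
    by auto
  then have "level_rank F y = emeasure lborel ({y' \<in> space lborel. F y < F y'} \<union> ({y'. F y' = F y} \<inter> ball 0 (norm y)))"
    unfolding level_rank_def by (rule arg_cong)
  also have "\<dots> = distrib lborel F (F y) + emeasure lborel ({y'. F y' = F y} \<inter> ball 0 (norm y))"
    unfolding distrib_def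
  proof (rule plus_emeasure[symmetric])
    show "{y' \<in> space lborel. F y < F y'} \<inter> ({y'. F y' = F y} \<inter> ball 0 (norm y)) = {}" by auto
  qed measurable
  finally show ?thesis .
qed

text \<open>
  Let \<open>j\<close> be the largest value with \<open>s < |{F \<ge> j}|\<close>. It exists because the set of all points has
  infinite measure and there are finitely many values, and then \<open>|{F > j}| \<le> s\<close>. The points of rank
  at most \<open>s\<close> are those with \<open>F > j\<close> and the innermost part, of measure \<open>s - |{F > j}|\<close>, of \<open>{F = j}\<close>.
\<close>

lemma emeasure_level_rank_le:
  fixes F :: "'a::euclidean_space \<Rightarrow> ennreal"
  assumes F[measurable]: "F \<in> borel_measurable borel" and fin: "finite (range F)" 
  shows "emeasure lborel {y. level_rank F y \<le> ennreal s} = ennreal s"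
proof -
  define J where "J = {j \<in> range F. ennreal s < emeasure lborel {y. j \<le> F y}}"
  have "finite J" using fin by (auto simp: J_def)
  have "Min (range F) \<le> F y" for y using fin by (intro Min_le) auto
  then have "{y. Min (range F) \<le> F y} = UNIV" by blast
  then have "emeasure lborel {y. Min (range F) \<le> F y} = \<infinity>" by simp
  then have "Min (range F) \<in> J" unfolding J_def using Min_in[OF fin]
    by (intro CollectI conjI) (blast, simp)
  define j where "j = Max J"
  have jJ: "j \<in> J" unfolding j_def using \<open>finite J\<close> \<open>Min (range F) \<in> J\<close> by (intro Max_in) auto
  then have jr: "j \<in> range F" and sj: "ennreal s < emeasure lborel {y. j \<le> F y}" by (auto simp: J_def)
  define a where "a = distrib lborel F j"
  define E where "E = {y. F y = j}"
  have E[measurable]: "E \<in> sets borel" unfolding E_def by measurable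
  have a_le: "a \<le> ennreal s"
  proof (rule ccontr)
    assume *: "\<not> a \<le> ennreal s"
    \<comment> \<open>The next larger value would also qualify.\<close>
    define K where "K = {i \<in> range F. j < i}"
    have "finite K" using fin by (auto simp: K_def)
    have "K \<noteq> {}"
    proof
      assume "K = {}"
      then have "{y \<in> space lborel. j < F y} = {}" by (auto simp: K_def)
      then have "a = 0" by (simp only: a_def distrib_def emeasure_empty)
      with * show False by simp
    qed
    have Mi: "Min K \<in> K" using \<open>finite K\<close> \<open>K \<noteq> {}\<close> by (rule Min_in)
    have "{y \<in> space lborel. j < F y} = {y. Min K \<le> F y}"
    proof (intro set_eqI iffI)
      fix y assume "y \<in> {y \<in> space lborel. j < F y}"
      then have "F y \<in> K" by (auto simp: K_def)
      with \<open>finite K\<close> show "y \<in> {y. Min K \<le> F y}" by auto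
    next
      fix y assume "y \<in> {y. Min K \<le> F y}"
      with Mi show "y \<in> {y \<in> space lborel. j < F y}" by (auto simp: K_def)
    qed
    with * have "ennreal s < emeasure lborel {y. Min K \<le> F y}"
      by (simp add: a_def distrib_def)
    with Mi have "Min K \<in> J" by (auto simp: J_def K_def)
    then have "Min K \<le> j" unfolding j_def using \<open>finite J\<close> by simp
    with Mi show False by (auto simp: K_def)
  qed
  have "{y. j \<le> F y} = {y \<in> space lborel. j < F y} \<union> E" by (auto simp: E_def)
  then have "emeasure lborel {y. j \<le> F y} = emeasure lborel ({y \<in> space lborel. j < F y} \<union> E)"
    by (rule arg_cong)
  also have "\<dots> = a + emeasure lborel E"
    unfolding a_def distrib_def
  proof (rule plus_emeasure[symmetric])
    show "{y \<in> space lborel. j < F y} \<inter> E = {}" by (auto simp: E_def)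
  qed auto
  finally have "emeasure lborel {y. j \<le> F y} = a + emeasure lborel E" .
  with sj have s_less: "ennreal s < a + emeasure lborel E" by simp
  have u: "ennreal s - a < emeasure lborel E"
  proof (rule ccontr)
    assume "\<not> ennreal s - a < emeasure lborel E"
    then have "a + emeasure lborel E \<le> a + (ennreal s - a)" by (intro add_left_mono) simp
    also have "\<dots> = ennreal s" using a_le by (rule add_diff_inverse_ennreal)
    finally show False using s_less by simp
  qed
  have eq: "{y. level_rank F y \<le> ennreal s} = {y \<in> space lborel. j < F y} \<union> {y \<in> E. emeasure lborel (E \<inter> ball 0 (norm y)) \<le> ennreal s - a}"
  proof (intro set_eqI)
    fix y
    consider "j < F y" | "F y = j" | "F y < j" by fastforce
    then show "y \<in> {y. level_rank F y \<le> ennreal s} \<longleftrightarrow> y \<in> {y \<in> space lborel. j < F y} \<union> {y \<in> E. emeasure lborel (E \<inter> ball 0 (norm y)) \<le> ennreal s - a}"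
    proof cases
      case 1
      then have "level_rank F y \<le> a"
        unfolding level_rank_def a_def distrib_def by (intro emeasure_mono) auto
      with 1 a_le show ?thesis by auto
    next
      case 2
      then have "level_rank F y = a + emeasure lborel (E \<inter> ball 0 (norm y))"
        by (simp add: level_rank_split a_def E_def)
      with 2 a_le show ?thesis
        by (auto simp: E_def ennreal_le_minus_iff add.commute)
    next
      case 3
      have "emeasure lborel {y. j \<le> F y} \<le> level_rank F y"
        unfolding level_rank_def using 3 by (intro emeasure_mono) auto
      with sj 3 show ?thesis by (auto simp: E_def)
    qed
  qed
  have "emeasure lborel {y. level_rank F y \<le> ennreal s} = a + emeasure lborel {y \<in> E. emeasure lborel (E \<inter> ball 0 (norm y)) \<le> ennreal s - a}"
    unfolding eq a_def distrib_def
  proof (rule plus_emeasure[symmetric])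
    have "(\<lambda>y. emeasure lborel {y' \<in> space lborel. y' \<in> E \<and> norm y' < norm y}) \<in> borel_measurable (lborel :: 'a measure)"
      by measurable
    also have "(\<lambda>y::'a. emeasure lborel {y' \<in> space lborel. y' \<in> E \<and> norm y' < norm y}) = (\<lambda>y. emeasure lborel (E \<inter> ball 0 (norm y)))"
      by (intro ext arg_cong[where f="emeasure lborel"]) auto
    finally have [measurable]: "(\<lambda>y::'a. emeasure lborel (E \<inter> ball 0 (norm y))) \<in> borel_measurable borel"
      by simp
    show "{y \<in> E. emeasure lborel (E \<inter> ball 0 (norm y)) \<le> ennreal s - emeasure lborel {y \<in> space lborel. j < F y}} \<in> sets lborel"
      by simp
    show "{y \<in> space lborel. j < F y} \<inter> {y \<in> E. emeasure lborel (E \<inter> ball 0 (norm y)) \<le> ennreal s - emeasure lborel {y \<in> space lborel. j < F y}} = {}"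
      by (auto simp: E_def)
  qed measurable
  also have "\<dots> = a + (ennreal s - a)"
    using emeasure_sublevel_of_ball_content[OF E u] by simp
  also have "\<dots> = ennreal s" using a_le by (simp add: add_diff_inverse_ennreal)
  finally show ?thesis .
qed

text \<open>
  If \<open>F y \<le> t\<close>, all points of \<open>{F > t}\<close> precede \<open>y\<close>, so the rank of \<open>y\<close> is at least their measure.
  This half of the comparison is enough, since the Hardy-Littlewood inequality bounds the integrals
  from the other side.
\<close>

lemma rearr_level_rank_le:
  assumes F[measurable]: "F \<in> borel_measurable borel"
  shows "rearr lborel F (level_rank F y) \<le> F y"
proof (rule ennreal_leI_less)
  fix t assume "t < rearr lborel F (level_rank F y)"
  then have *: "level_rank F y < distrib lborel F t" by (simp add: less_rearr_iff)
  show "t < F y"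
  proof (rule ccontr)
    assume "\<not> t < F y"
    then have "distrib lborel F t \<le> level_rank F y"
      unfolding distrib_def level_rank_def by (intro emeasure_mono) (auto intro: le_less_trans)
    with * show False by auto
  qed
qed

lemma borel_measurable_level_rank_param:
  fixes F :: "'x \<times> 'a::euclidean_space \<Rightarrow> ennreal"
  assumes [measurable]: "F \<in> borel_measurable (M \<Otimes>\<^sub>M lborel)"
  shows "(\<lambda>(x, y). level_rank (\<lambda>y. F (x, y)) y) \<in> borel_measurable (M \<Otimes>\<^sub>M lborel)"
proof -
  have "(\<lambda>z. emeasure lborel {y' \<in> space lborel. F z < F (fst z, y') \<or> F z = F (fst z, y') \<and> norm y' < norm (snd z)})
    \<in> borel_measurable (M \<Otimes>\<^sub>M lborel)"
    by measurable
  then show ?thesis by (simp add: level_rank_def case_prod_unfold)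
qed

lemma borel_measurable_level_rank:
  fixes F :: "'a::euclidean_space \<Rightarrow> ennreal"
  assumes [measurable]: "F \<in> borel_measurable borel"
  shows "level_rank F \<in> borel_measurable borel"
proof -
  have "(\<lambda>z. emeasure lborel {y' \<in> space lborel. F z < F y' \<or> F z = F y' \<and> norm y' < norm z})
    \<in> borel_measurable lborel"
    by measurable
  then show ?thesis unfolding level_rank_def by simp
qed

text \<open>
  Change of variables along the rank. Points of infinite rank (those of small value, when the
  larger values already fill infinite measure) do not contribute.
\<close>

theorem nn_integral_level_rank:
  fixes F :: "'a::euclidean_space \<Rightarrow> ennreal" and \<phi> :: "real \<Rightarrow> ennreal"
  assumes F[measurable]: "F \<in> borel_measurable borel" and fin: "finite (range F)" 
    and \<phi>[measurable]: "\<phi> \<in> borel_measurable borel"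
  shows "(\<integral>\<^sup>+y. (if level_rank F y < top then \<phi> (enn2real (level_rank F y)) else 0) \<partial>lborel) = (\<integral>\<^sup>+s. \<phi> s \<partial>pos_line)"
proof -
  note [measurable] = borel_measurable_level_rank
  define R where "R = {y. level_rank F y < top}"
  have R[measurable]: "R \<in> sets borel" unfolding R_def by measurable
  define \<nu> where "\<nu> = distr (restrict_space lborel R) borel (\<lambda>y. enn2real (level_rank F y))"
  define \<mu> where "\<mu> = distr pos_line borel (\<lambda>s. s)"
  have mr: "(\<lambda>y. enn2real (level_rank F y)) \<in> borel_measurable (restrict_space lborel R)"
    by (intro measurable_restrict_space1) measurable
  have nu: "emeasure \<nu> {..s} = ennreal s" for s
  proof -
    have "emeasure \<nu> {..s} = emeasure (restrict_space lborel R) ({y \<in> R. enn2real (level_rank F y) \<le> s})"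
      unfolding \<nu>_def using mr by (subst emeasure_distr) (auto simp: space_restrict_space intro!: arg_cong[where f="emeasure _"])
    also have "\<dots> = emeasure lborel {y \<in> R. enn2real (level_rank F y) \<le> s}"
      by (intro emeasure_restrict_space) auto
    also have "\<dots> = ennreal s"
    proof (cases "0 \<le> s")
      case True
      have "enn2real (level_rank F y) \<le> s \<longleftrightarrow> level_rank F y \<le> ennreal s" if "y \<in> R" for y
        using that True by (cases "level_rank F y") (auto simp: R_def ennreal_le_iff)
      moreover have "y \<in> R" if "level_rank F y \<le> ennreal s" for y
        using that unfolding R_def by (auto intro: le_less_trans)
      ultimately have "y \<in> {y \<in> R. enn2real (level_rank F y) \<le> s} \<longleftrightarrow> y \<in> {y. level_rank F y \<le> ennreal s}" for y
        unfolding mem_Collect_eq by (cases "y \<in> R") (simp_all, metis)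
      then have "{y \<in> R. enn2real (level_rank F y) \<le> s} = {y. level_rank F y \<le> ennreal s}"
        by (rule set_eqI)
      then show ?thesis using emeasure_level_rank_le[OF F fin, of s] by simp
    next
      case False
      then have "\<not> enn2real (level_rank F y) \<le> s" for y using enn2real_nonneg[of "level_rank F y"] by linarith
      with False show ?thesis by (simp add: ennreal_neg)
    qed
    finally show ?thesis .
  qed
  have mu: "emeasure \<mu> {..s} = ennreal s" for s
  proof -
    have "emeasure \<mu> {..s} = emeasure pos_line {0<..s}"
      unfolding \<mu>_def by (subst emeasure_distr) (auto intro!: arg_cong[where f="emeasure _"])
    also have "\<dots> = emeasure lborel {0<..s}" by (intro emeasure_restrict_space) auto
    also have "\<dots> = ennreal s" by (cases "0 \<le> s") (auto simp: ennreal_neg)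
    finally show ?thesis .
  qed
  \<comment> \<open>Both image measures give the half-line up to \<open>s\<close> the mass \<open>s\<close>.\<close>
  have "\<nu> = \<mu>"
  proof (rule measure_eqI_generator_eq)
    show "Int_stable (range (\<lambda>s::real. {..s}))"
      by (auto simp: Int_stable_def)
    show "sets \<nu> = sigma_sets UNIV (range (\<lambda>s::real. {..s}))" "sets \<mu> = sigma_sets UNIV (range (\<lambda>s::real. {..s}))"
      by (simp_all add: \<nu>_def \<mu>_def borel_eq_atMost[THEN arg_cong, of sets] )
    show "range (\<lambda>n::nat. {..real n}) \<subseteq> range (\<lambda>s::real. {..s})" by auto
    show "(\<Union>n::nat. {..real n}) = UNIV" using real_arch_simple by auto
  qed (auto simp: nu mu)
  have "(\<integral>\<^sup>+y. (if level_rank F y < top then \<phi> (enn2real (level_rank F y)) else 0) \<partial>lborel)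
      = (\<integral>\<^sup>+y\<in>R. \<phi> (enn2real (level_rank F y)) \<partial>lborel)"
    by (intro nn_integral_cong) (auto simp: R_def indicator_def)
  also have "\<dots> = (\<integral>\<^sup>+y. \<phi> (enn2real (level_rank F y)) \<partial>restrict_space lborel R)"
    by (intro nn_integral_restrict_space[symmetric]) auto
  also have "\<dots> = (\<integral>\<^sup>+s. \<phi> s \<partial>\<nu>)"
    unfolding \<nu>_def using mr by (subst nn_integral_distr) auto
  also have "\<dots> = (\<integral>\<^sup>+s. \<phi> s \<partial>pos_line)"
    unfolding \<open>\<nu> = \<mu>\<close> \<mu>_def by (subst nn_integral_distr) auto
  finally show ?thesis .
qed

section \<open>Polar coordinates\<close>

lemma borel_measure_eqI_lessThan:
  fixes \<alpha> \<beta> :: "real measure"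
  assumes "sets \<alpha> = sets borel" "sets \<beta> = sets borel"
    and eq: "\<And>s. emeasure \<alpha> {..<s} = emeasure \<beta> {..<s}" and fin: "\<And>s. emeasure \<alpha> {..<s} < \<infinity>"
  shows "\<alpha> = \<beta>"
proof (rule measure_eqI_generator_eq)
  have "{..<a} \<inter> {..<b} = {..<min a b}" for a b :: real by auto
  then show "Int_stable (range (\<lambda>s::real. {..<s}))" by (auto simp: Int_stable_def)
  show "sets \<alpha> = sigma_sets UNIV (range (\<lambda>s::real. {..<s}))" "sets \<beta> = sigma_sets UNIV (range (\<lambda>s::real. {..<s}))"
    by (simp_all add: assms(1,2) borel_Iio[THEN arg_cong, of sets])
  show "range (\<lambda>n::nat. {..<real n}) \<subseteq> range (\<lambda>s::real. {..<s})" by auto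
  show "(\<Union>n::nat. {..<real n}) = UNIV" using reals_Archimedean2 by auto
  show "emeasure \<alpha> {..<real i} \<noteq> \<infinity>" for i using fin[of "real i"] by simp
qed (use eq in auto)

text \<open>
  The surface measure before completion, so that Tonelli's theorem applies.
\<close>

definition borel_sphere_measure :: "(real^'k) measure" where
  "borel_sphere_measure = scale_measure (of_nat CARD('k))
     (distr (restrict_space lborel (ball 0 1 - {0})) (restrict_space borel (sphere 0 1))
       (\<lambda>y. y /\<^sub>R norm y))"

lemma sphere_measure_eq_completion: "sphere_measure = completion borel_sphere_measure"
  by (simp add: sphere_measure_def borel_sphere_measure_def)

lemma space_borel_sphere_measure[simp]: "space borel_sphere_measure = sphere 0 1"
  by (simp add: borel_sphere_measure_def space_scale_measure space_restrict_space)

lemma sets_borel_sphere_measure[simp, measurable_cong]: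
  "sets borel_sphere_measure = sets (restrict_space borel (sphere 0 1))"
  by (simp add: borel_sphere_measure_def)

lemma borel_measurable_sphere:
  fixes f :: "real^'k \<Rightarrow> 'b::topological_space"
  assumes "f \<in> borel_measurable borel"
  shows "f \<in> borel_measurable borel_sphere_measure"
  using measurable_cong_sets[OF sets_borel_sphere_measure refl] measurable_restrict_space1[OF assms] by blast

lemma measurable_id_sphere: "(\<lambda>\<theta>. \<theta>) \<in> measurable (borel_sphere_measure :: (real^'k) measure) borel"
  by (rule borel_measurable_sphere) simp

lemma unit_vol_pos: "0 < unit_vol TYPE('k::finite)"
  by (simp add: unit_vol_def content_ball_pos)

lemma measurable_normalize:
  "(\<lambda>y::real^'k. y /\<^sub>R norm y) \<in> measurable (restrict_space lborel S) (restrict_space borel (sphere 0 1))"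
  if "0 \<notin> S"
proof (intro measurable_restrict_space2 measurable_restrict_space1)
  have "x /\<^sub>R norm x \<in> sphere 0 1" if "x \<in> S" for x
    using that \<open>0 \<notin> S\<close> by (cases "x = 0") auto
  then show "(\<lambda>y. y /\<^sub>R norm y) \<in> space (restrict_space lborel S) \<rightarrow> sphere 0 1"
    by (auto simp: space_restrict_space simp del: mem_sphere_0)
qed simp

lemma cone_measurable:
  fixes E :: "(real^'k) set"
  assumes E: "E \<in> sets borel_sphere_measure"
  shows "{y. y \<noteq> 0 \<and> y /\<^sub>R norm y \<in> E} \<in> sets borel"
proof -
  have "(\<lambda>y::real^'k. y /\<^sub>R norm y) -` E \<inter> space (restrict_space lborel (- {0})) \<in> sets (restrict_space lborel (- {0}))"
    using E by (intro measurable_sets[OF measurable_normalize]) auto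
  then have "(\<lambda>y::real^'k. y /\<^sub>R norm y) -` E \<inter> - {0} \<in> sets borel"
    by (auto simp: space_restrict_space sets_restrict_space_iff)
  also have "(\<lambda>y::real^'k. y /\<^sub>R norm y) -` E \<inter> - {0} = {y. y \<noteq> 0 \<and> y /\<^sub>R norm y \<in> E}"
    by auto
  finally show ?thesis .
qed

lemma emeasure_borel_sphere_measure:
  fixes E :: "(real^'k) set"
  assumes E: "E \<in> sets borel_sphere_measure"
  shows "emeasure borel_sphere_measure E =
    of_nat CARD('k) * emeasure lborel {y. y \<noteq> 0 \<and> norm y < 1 \<and> y /\<^sub>R norm y \<in> E}"
proof -
  let ?B = "ball 0 1 - {0::real^'k}" and ?p = "\<lambda>y::real^'k. y /\<^sub>R norm y"
  have m: "?p \<in> measurable (restrict_space lborel ?B) (restrict_space borel (sphere 0 1))"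
    by (intro measurable_normalize) auto
  have "emeasure borel_sphere_measure E = of_nat CARD('k) *
     emeasure (restrict_space lborel ?B) (?p -` E \<inter> ?B)"
    unfolding borel_sphere_measure_def using E m
    by (subst emeasure_scale_measure) (subst emeasure_distr, auto simp: space_restrict_space)
  also have "emeasure (restrict_space lborel ?B) (?p -` E \<inter> ?B) = emeasure lborel (?p -` E \<inter> ?B)"
    by (intro emeasure_restrict_space) auto
  also have "?p -` E \<inter> ?B = {y. y \<noteq> 0 \<and> norm y < 1 \<and> y /\<^sub>R norm y \<in> E}"
    by auto
  finally show ?thesis .
qed

lemma finite_measure_borel_sphere_measure: "finite_measure (borel_sphere_measure :: (real^'k) measure)"
proof (rule finite_measureI)
  have "emeasure lborel {y::real^'k. y \<noteq> 0 \<and> norm y < 1 \<and> y /\<^sub>R norm y \<in> sphere 0 1} \<le> emeasure lborel (ball (0::real^'k) 1)"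
    by (intro emeasure_mono) auto
  also have "\<dots> < \<infinity>" by (intro emeasure_bounded_finite) auto
  finally have "emeasure borel_sphere_measure (sphere (0::real^'k) 1) < \<infinity>"
    by (subst emeasure_borel_sphere_measure)
       (auto simp: sets_restrict_space_iff ennreal_mult_less_top of_nat_less_top)
  then show "emeasure (borel_sphere_measure :: (real^'k) measure) (space borel_sphere_measure) \<noteq> \<infinity>"
    by simp
qed

text \<open>
  Scaling by \<open>r\<close> multiplies the volume of the cone over \<open>E\<close> by \<open>r\<^sup>k\<close>.
\<close>

lemma emeasure_cone:
  fixes E :: "(real^'k) set"
  assumes E: "E \<in> sets borel_sphere_measure" and r: "0 < r"
  shows "of_nat CARD('k) * emeasure lborel {y. y \<noteq> 0 \<and> norm y < r \<and> y /\<^sub>R norm y \<in> E}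
    = ennreal (r ^ CARD('k)) * emeasure borel_sphere_measure E"
proof -
  define C where "C r = {y::real^'k. y \<noteq> 0 \<and> norm y < r \<and> y /\<^sub>R norm y \<in> E}" for r
  have C[measurable]: "C r \<in> sets borel" for r
  proof -
    have "{y. y \<noteq> 0 \<and> y /\<^sub>R norm y \<in> E} \<inter> ball 0 r \<in> sets borel"
      using cone_measurable[OF E] by auto
    also have "{y. y \<noteq> 0 \<and> y /\<^sub>R norm y \<in> E} \<inter> ball 0 r = C r"
      by (auto simp: C_def)
    finally show ?thesis .
  qed
  have vim: "(\<lambda>x::real^'k. 0 + r *\<^sub>R x) -` C r = C 1"
  proof -
    have "inverse r * inverse (norm x) * r = inverse (norm x)" for x :: "real^'k"
      using r by simp
    note inv = this
    show ?thesis using r by (auto simp: C_def inv)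
  qed
  have "emeasure lborel (C r) = emeasure (density (distr lborel borel (\<lambda>x::real^'k. 0 + r *\<^sub>R x)) (\<lambda>_. ennreal (\<bar>r\<bar> ^ DIM(real^'k)))) (C r)"
    using r by (subst lborel_affine[of r "0::real^'k"]) auto
  also have "\<dots> = ennreal (r ^ CARD('k)) * emeasure (distr lborel borel (\<lambda>x::real^'k. 0 + r *\<^sub>R x)) (C r)"
    using r by (subst emeasure_density_const) auto
  also have "emeasure (distr lborel borel (\<lambda>x::real^'k. 0 + r *\<^sub>R x)) (C r) = emeasure lborel (C 1)"
    by (subst emeasure_distr) (auto simp: vim[simplified])
  finally show ?thesis
    unfolding emeasure_borel_sphere_measure[OF E] C_def by (simp add: mult_ac)
qed

lemma norm_less_root_iff:
  fixes y :: "real^'k"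
  assumes "0 \<le> s"
  shows "unit_vol TYPE('k) * norm y ^ CARD('k) < s \<longleftrightarrow> norm y < root CARD('k) (s / unit_vol TYPE('k))"
proof -
  have "unit_vol TYPE('k) * norm y ^ CARD('k) < s \<longleftrightarrow> norm y ^ CARD('k) < s / unit_vol TYPE('k)"
    using unit_vol_pos[where 'k='k] by (simp add: field_simps)
  also have "\<dots> \<longleftrightarrow> root CARD('k) (norm y ^ CARD('k)) < root CARD('k) (s / unit_vol TYPE('k))"
    by (subst real_root_less_iff) auto
  also have "root CARD('k) (norm y ^ CARD('k)) = norm y"
    by (intro real_root_power_cancel) auto
  finally show ?thesis .
qed

text \<open>
  The coordinate \<open>s = \<sigma>\<^sub>k |y|\<^sup>k\<close> is the volume of the ball of radius \<open>|y|\<close>; with it the radial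
  part of the measure is Lebesgue measure without a density. For a fixed set \<open>E\<close> of directions
  both sides are measures in \<open>A\<close>, so it is enough to take \<open>A\<close> a half-line, which is a cone.
\<close>

lemma polar_rectangle:
  fixes E :: "(real^'k) set"
  assumes E: "E \<in> sets borel_sphere_measure" and A: "A \<in> sets borel"
  shows "ennreal (CARD('k) * unit_vol TYPE('k)) * emeasure lborel {y. y \<noteq> 0 \<and> unit_vol TYPE('k) * norm y ^ CARD('k) \<in> A \<and> y /\<^sub>R norm y \<in> E}
    = emeasure (distr pos_line borel (\<lambda>s. s)) A * emeasure borel_sphere_measure E"
proof -
  let ?g = "\<lambda>y::real^'k. unit_vol TYPE('k) * norm y ^ CARD('k)"
  define R where "R = {y::real^'k. y \<noteq> 0 \<and> y /\<^sub>R norm y \<in> E}"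
  have R[measurable]: "R \<in> sets borel" unfolding R_def by (rule cone_measurable[OF E])
  define \<alpha> where "\<alpha> = scale_measure (ennreal (CARD('k) * unit_vol TYPE('k))) (distr (restrict_space lborel R) borel ?g)"
  define \<beta> where "\<beta> = scale_measure (emeasure borel_sphere_measure E) (distr pos_line borel (\<lambda>s. s))"
  have mg: "?g \<in> borel_measurable (restrict_space lborel R)"
    by (intro measurable_restrict_space1) measurable
  have \<alpha>: "emeasure \<alpha> A = ennreal (CARD('k) * unit_vol TYPE('k)) * emeasure lborel {y. y \<noteq> 0 \<and> ?g y \<in> A \<and> y /\<^sub>R norm y \<in> E}"
    if A: "A \<in> sets borel" for A
  proof -
    have "emeasure (distr (restrict_space lborel R) borel ?g) A = emeasure (restrict_space lborel R) (?g -` A \<inter> R)"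
      using mg A by (subst emeasure_distr) (auto simp: space_restrict_space)
    also have "\<dots> = emeasure lborel (?g -` A \<inter> R)"
      by (intro emeasure_restrict_space) auto
    also have "?g -` A \<inter> R = {y. y \<noteq> 0 \<and> ?g y \<in> A \<and> y /\<^sub>R norm y \<in> E}"
      by (auto simp: R_def)
    finally show ?thesis by (simp add: \<alpha>_def)
  qed
  have \<beta>: "emeasure \<beta> A = emeasure (distr pos_line borel (\<lambda>s. s)) A * emeasure borel_sphere_measure E" for A
    by (simp add: \<beta>_def mult.commute)
  have \<beta>_less: "emeasure \<beta> {..<s} = ennreal s * emeasure borel_sphere_measure E" for s
  proof -
    have "emeasure (distr pos_line borel (\<lambda>s. s)) {..<s} = emeasure pos_line {0<..<s}"
      by (subst emeasure_distr) (auto intro!: arg_cong[where f="emeasure _"])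
    also have "\<dots> = emeasure lborel {0<..<s}" by (intro emeasure_restrict_space) auto
    also have "\<dots> = ennreal s" by (cases "0 \<le> s") (auto simp: ennreal_neg)
    finally show ?thesis by (simp add: \<beta>)
  qed
  have \<alpha>_less: "emeasure \<alpha> {..<s} = ennreal s * emeasure borel_sphere_measure E" for s
  proof (cases "0 < s")
    case True
    define r where "r = root CARD('k) (s / unit_vol TYPE('k))"
    have r: "0 < r" "r ^ CARD('k) = s / unit_vol TYPE('k)"
      using True unit_vol_pos[where 'k='k] by (simp_all add: r_def)
    have "emeasure \<alpha> {..<s} = ennreal (CARD('k) * unit_vol TYPE('k)) * emeasure lborel {y. y \<noteq> 0 \<and> norm y < r \<and> y /\<^sub>R norm y \<in> E}"
      using True by (subst \<alpha>) (auto simp: norm_less_root_iff r_def)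
    also have "\<dots> = ennreal (unit_vol TYPE('k)) * (of_nat CARD('k) * emeasure lborel {y. y \<noteq> 0 \<and> norm y < r \<and> y /\<^sub>R norm y \<in> E})"
      using unit_vol_pos[where 'k='k] by (simp add: ennreal_mult ennreal_of_nat_eq_real_of_nat mult_ac)
    also have "\<dots> = ennreal (unit_vol TYPE('k)) * (ennreal (r ^ CARD('k)) * emeasure borel_sphere_measure E)"
      using r by (subst emeasure_cone[OF E]) auto
    also have "\<dots> = ennreal (unit_vol TYPE('k) * r ^ CARD('k)) * emeasure borel_sphere_measure E"
      using r(1) unit_vol_pos[where 'k='k] by (subst ennreal_mult) (auto simp: mult_ac)
    also have "unit_vol TYPE('k) * r ^ CARD('k) = s"
      using r unit_vol_pos[where 'k='k] by simp
    finally show ?thesis .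
  next
    case False
    have "\<not> ?g y < s" for y
    proof -
      have "0 \<le> ?g y" using unit_vol_pos[where 'k='k] by simp
      with False show ?thesis by linarith
    qed
    then have "emeasure \<alpha> {..<s} = 0" by (subst \<alpha>) auto
    with False show ?thesis by (simp add: ennreal_neg)
  qed
  have fin: "emeasure borel_sphere_measure E < \<infinity>"
    using finite_measure.emeasure_finite[OF finite_measure_borel_sphere_measure, of E] by (simp add: less_top)
  have "\<alpha> = \<beta>"
  proof (rule borel_measure_eqI_lessThan)
    show "emeasure \<alpha> {..<s} < \<infinity>" for s
      using fin by (simp add: \<alpha>_less ennreal_mult_less_top)
  qed (simp_all add: \<alpha>_less \<beta>_less, simp_all add: \<alpha>_def \<beta>_def)
  then show ?thesis using \<alpha>[OF A] \<beta>[of A] by simp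
qed

theorem polar_coordinates:
  fixes u :: "real^'k \<Rightarrow> ennreal"
  assumes u[measurable]: "u \<in> borel_measurable borel"
  shows "ennreal (CARD('k) * unit_vol TYPE('k)) * (\<integral>\<^sup>+y. u y \<partial>lborel)
    = (\<integral>\<^sup>+s. (\<integral>\<^sup>+\<theta>. u (root CARD('k) (s / unit_vol TYPE('k)) *\<^sub>R \<theta>) \<partial>borel_sphere_measure) \<partial>pos_line)"
proof -
  let ?g = "\<lambda>y::real^'k. unit_vol TYPE('k) * norm y ^ CARD('k)" and ?p = "\<lambda>y::real^'k. y /\<^sub>R norm y"
  let ?\<sigma> = "borel_sphere_measure :: (real^'k) measure"
  let ?\<mu> = "distr pos_line borel (\<lambda>s. s)"
  let ?L = "restrict_space lborel (- {0::real^'k})"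
  define U where "U = (\<lambda>(s, \<theta>). u (root CARD('k) (s / unit_vol TYPE('k)) *\<^sub>R \<theta>))"
  interpret S: finite_measure ?\<sigma> by (rule finite_measure_borel_sphere_measure)
  have mg: "?g \<in> borel_measurable ?L"
    by (intro measurable_restrict_space1) measurable
  note [measurable] = measurable_id_sphere
  have U[measurable]: "U \<in> borel_measurable (borel \<Otimes>\<^sub>M ?\<sigma>)"
    unfolding U_def by measurable
  have sf: "sigma_finite_measure ?\<mu>"
  proof
    let ?A = "range (\<lambda>n::nat. {..<real n})"
    have "emeasure ?\<mu> {..<real n} \<noteq> \<infinity>" for n
    proof -
      have "emeasure ?\<mu> {..<real n} = emeasure pos_line {0<..<real n}"
        by (subst emeasure_distr) (auto intro!: arg_cong[where f="emeasure _"])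
      also have "\<dots> = emeasure lborel {0<..<real n}" by (intro emeasure_restrict_space) auto
      finally show ?thesis by simp
    qed
    then show "\<exists>A. countable A \<and> A \<subseteq> sets ?\<mu> \<and> \<Union>A = space ?\<mu> \<and> (\<forall>a\<in>A. emeasure ?\<mu> a \<noteq> \<infinity>)"
      using reals_Archimedean2 by (intro exI[of _ ?A]) auto
  qed
  define \<Phi> where "\<Phi> y = (?g y, ?p y)" for y
  have m\<Phi>: "\<Phi> \<in> measurable ?L (borel \<Otimes>\<^sub>M ?\<sigma>)"
  proof -
    have "?p \<in> measurable ?L ?\<sigma>"
    proof -
      have "measurable ?L ?\<sigma> = measurable ?L (restrict_space borel (sphere (0::real^'k) 1))"
        by (rule measurable_cong_sets) simp_all
      then show ?thesis using measurable_normalize[of "- {0::real^'k}"] by simp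
    qed
    with mg show ?thesis unfolding \<Phi>_def by (intro measurable_Pair)
  qed
  define P where "P = scale_measure (ennreal (CARD('k) * unit_vol TYPE('k))) (distr ?L (borel \<Otimes>\<^sub>M ?\<sigma>) \<Phi>)"
  have "?\<mu> \<Otimes>\<^sub>M ?\<sigma> = P"
  proof (rule pair_measure_eqI[OF sf S.sigma_finite_measure_axioms])
    show "sets (?\<mu> \<Otimes>\<^sub>M ?\<sigma>) = sets P"
      by (simp add: P_def cong: sets_pair_measure_cong)
    fix A E assume A: "A \<in> sets ?\<mu>" and E: "E \<in> sets ?\<sigma>"
    then have "A \<times> E \<in> sets (borel \<Otimes>\<^sub>M ?\<sigma>)" by auto
    then have "emeasure (distr ?L (borel \<Otimes>\<^sub>M ?\<sigma>) \<Phi>) (A \<times> E) = emeasure ?L (\<Phi> -` (A \<times> E) \<inter> - {0})"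
      using m\<Phi> by (subst emeasure_distr) (auto simp: space_restrict_space)
    also have "\<dots> = emeasure lborel (\<Phi> -` (A \<times> E) \<inter> - {0})"
      by (intro emeasure_restrict_space) auto
    also have "\<Phi> -` (A \<times> E) \<inter> - {0} = {y. y \<noteq> 0 \<and> ?g y \<in> A \<and> ?p y \<in> E}"
      by (auto simp: \<Phi>_def)
    finally show "emeasure ?\<mu> A * emeasure ?\<sigma> E = emeasure P (A \<times> E)"
      using polar_rectangle[OF E, of A] A by (simp add: P_def)
  qed
  have "ennreal (CARD('k) * unit_vol TYPE('k)) * (\<integral>\<^sup>+y. u y \<partial>lborel)
      = ennreal (CARD('k) * unit_vol TYPE('k)) * (\<integral>\<^sup>+y\<in>- {0}. u y \<partial>lborel)"
  proof (intro arg_cong2[where f="(*)"] refl nn_integral_cong_AE)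
    show "AE y in lborel. u y = u y * indicator (- {0}) y"
      using AE_lborel_singleton[of "0::real^'k"] by eventually_elim auto
  qed
  also have "(\<integral>\<^sup>+y\<in>- {0}. u y \<partial>lborel) = (\<integral>\<^sup>+y. u y \<partial>?L)"
    by (intro nn_integral_restrict_space[symmetric]) auto
  also have "\<dots> = (\<integral>\<^sup>+y. U (\<Phi> y) \<partial>?L)"
  proof (intro nn_integral_cong)
    fix y :: "real^'k" assume "y \<in> space ?L"
    then have "y \<noteq> 0" by (simp add: space_restrict_space)
    moreover have "root CARD('k) (?g y / unit_vol TYPE('k)) = norm y"
      using unit_vol_pos[where 'k='k] by (simp add: real_root_power_cancel)
    ultimately show "u y = U (\<Phi> y)" by (simp add: U_def \<Phi>_def)
  qed
  also have "\<dots> = (\<integral>\<^sup>+z. U z \<partial>distr ?L (borel \<Otimes>\<^sub>M ?\<sigma>) \<Phi>)"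
    by (rule nn_integral_distr[symmetric, OF m\<Phi>]) (simp only: measurable_distr_eq1 U)
  also have "ennreal (CARD('k) * unit_vol TYPE('k)) * \<dots> = (\<integral>\<^sup>+z. U z \<partial>P)"
    unfolding P_def by (rule nn_integral_scale_measure[symmetric]) (simp only: measurable_distr_eq1 U)
  also have "\<dots> = (\<integral>\<^sup>+s. (\<integral>\<^sup>+\<theta>. U (s, \<theta>) \<partial>?\<sigma>) \<partial>?\<mu>)"
    unfolding \<open>?\<mu> \<Otimes>\<^sub>M ?\<sigma> = P\<close>[symmetric]
    by (intro S.nn_integral_fst[symmetric]) (simp add: U cong: measurable_cong_sets)
  also have "\<dots> = (\<integral>\<^sup>+s. (\<integral>\<^sup>+\<theta>. U (s, \<theta>) \<partial>?\<sigma>) \<partial>pos_line)"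
    by (subst nn_integral_distr) measurable
  finally show ?thesis by (simp add: U_def)
qed

section \<open>Fibres of Lebesgue measurable functions\<close>

type_synonym 'k point = "(nat \<Rightarrow> real) \<times> (real^'k)"

lemma sigma_finite_lebesgue_base: "sigma_finite_measure (lebesgue_base m)"
proof -
  interpret product_sigma_finite "\<lambda>_::nat. lborel :: real measure"
    by (intro product_sigma_finite.intro sigma_finite_lborel)
  show ?thesis by (rule sigma_finite) simp
qed

lemma borel_measurable_completion_AE:
  fixes g :: "'a \<Rightarrow> ennreal"
  assumes f: "f \<in> borel_measurable N" and ae: "AE x in N. f x = g x"
  shows "g \<in> borel_measurable (completion N)"
proof (rule measurableI)
  fix A :: "ennreal set" assume A: "A \<in> sets borel"
  show "g -` A \<inter> space (completion N) \<in> sets (completion N)"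
  proof (rule completion.in_sets_AE)
    show "AE x in completion N. x \<in> f -` A \<inter> space N \<longleftrightarrow> x \<in> g -` A \<inter> space (completion N)"
      unfolding AE_completion_iff using ae by eventually_elim auto
    show "f -` A \<inter> space N \<in> sets (completion N)"
      using measurable_sets[OF f A] by auto
  qed simp
qed simp

lemma mem_ball_of_measure:
  fixes y :: "real^'k"
  shows "y \<in> ball_of_measure m \<longleftrightarrow> ennreal (unit_vol TYPE('k) * norm y ^ CARD('k)) < m"
proof (cases m)
  case (real r)
  then show ?thesis
    using norm_less_root_iff[of r y] by (simp add: ball_of_measure_def ennreal_less_iff unit_vol_pos less_imp_le)
qed (simp add: ball_of_measure_def)

lemma decr_rearr_eq_rearr:
  fixes g :: "real^'k \<Rightarrow> real"
  assumes G[measurable]: "G \<in> borel_measurable lborel"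
    and eq: "\<And>t. 0 \<le> t \<Longrightarrow> emeasure lebesgue {y. \<bar>g y\<bar> > t} = distrib lborel G (ennreal t)"
  shows "decr_rearr g s = rearr lborel G (ennreal s)"
proof (rule antisym)
  show "decr_rearr g s \<le> rearr lborel G (ennreal s)"
  proof (rule ccontr)
    assume "\<not> decr_rearr g s \<le> rearr lborel G (ennreal s)"
    then have "rearr lborel G (ennreal s) < decr_rearr g s" by simp
    then obtain t where t: "rearr lborel G (ennreal s) < t" "t < decr_rearr g s"
      by (rule dense[THEN exE]) blast
    then have "t < top" by (meson less_le_trans top_greatest)
    then obtain r where r: "t = ennreal r" "0 \<le> r" by (cases t) auto
    have "\<not> t < rearr lborel G (ennreal s)" using t by auto
    then have "distrib lborel G t \<le> ennreal s" by (simp add: less_rearr_iff not_less)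
    then have "decr_rearr g s \<le> ennreal r"
      unfolding decr_rearr_def using r eq[of r] by (intro INF_lower) auto
    with t r show False by auto
  qed
  show "rearr lborel G (ennreal s) \<le> decr_rearr g s"
    unfolding decr_rearr_def
  proof (rule INF_greatest)
    fix t assume "t \<in> {t. 0 \<le> t \<and> emeasure lebesgue {y. t < \<bar>g y\<bar>} \<le> ennreal s}"
    then have "distrib lborel G (ennreal t) \<le> ennreal s" using eq[of t] by auto
    then have "\<not> ennreal t < rearr lborel G (ennreal s)" by (simp add: less_rearr_iff not_less)
    then show "rearr lborel G (ennreal s) \<le> ennreal t" by simp
  qed
qed

text \<open>
  The weight together with a version \<open>u\<close> that is Borel measurable on the uncompleted product:
  Tonelli's theorem and measurability of all sections need such a version.
\<close>

locale steiner_weight =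
  fixes n :: nat and v :: "'k::finite point \<Rightarrow> real" and u :: "'k point \<Rightarrow> ennreal"
    and M :: "(nat \<Rightarrow> real) measure"
  assumes weight: "weight n v" and M_eq: "M = lebesgue_base (n - CARD('k))"
    and u_measurable[measurable]: "u \<in> borel_measurable (M \<Otimes>\<^sub>M lborel)"
    and u_eq: "AE x in M \<Otimes>\<^sub>M lborel. ennreal (v x) = u x"
begin

text \<open>
  The base \<open>M\<close> times the fibre \<open>R\<^sup>k\<close>, and the base times the half-line, with Borel sets: completing
  them gives the two spaces of the theorem.
\<close>

abbreviation MR :: "'k point measure" where
  "MR \<equiv> M \<Otimes>\<^sub>M lborel"

abbreviation MS :: "((nat \<Rightarrow> real) \<times> real) measure" where
  "MS \<equiv> M \<Otimes>\<^sub>M pos_line"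

lemma Rn_eq: "lebesgue_Rn n = completion MR"
  by (simp add: lebesgue_Rn_def M_eq)

lemma half_eq: "lebesgue_half_space (n - CARD('k)) = completion MS"
  by (simp add: lebesgue_half_space_def M_eq)

sublocale M: sigma_finite_measure M
  unfolding M_eq by (rule sigma_finite_lebesgue_base)

sublocale XL: pair_sigma_finite M "lborel :: (real^'k) measure"
  by (intro pair_sigma_finite.intro M.sigma_finite_measure_axioms sigma_finite_lborel)

sublocale MP: pair_sigma_finite M pos_line
  by (intro pair_sigma_finite.intro M.sigma_finite_measure_axioms sigma_finite_pos_line)

lemma space_Rn: "space (lebesgue_Rn n) = space M \<times> (UNIV :: (real^'k) set)"
  by (simp add: Rn_eq space_pair_measure)

lemma section_measurable:
  assumes "F \<in> borel_measurable (M \<Otimes>\<^sub>M N)" "xb \<in> space M"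
  shows "(\<lambda>y. F (xb, y)) \<in> borel_measurable N"
  using measurable_compose[OF measurable_Pair1'[OF assms(2)] assms(1)] by simp

text \<open>
  Only the absolute value of \<open>f\<close> enters rearrangements, so the Borel version is chosen for \<open>|f|\<close> and
  with values in \<open>[0,\<infinity>]\<close>.
\<close>

definition borel_version :: "('k point \<Rightarrow> real) \<Rightarrow> ('k point \<Rightarrow> ennreal) \<Rightarrow> bool" where
  "borel_version f F \<longleftrightarrow> F \<in> borel_measurable MR \<and> (AE x in MR. ennreal \<bar>f x\<bar> = F x)"

lemma ex_borel_version:
  assumes "f \<in> borel_measurable (lebesgue_Rn n)"
  obtains F where "borel_version f F"
proof -
  have "(\<lambda>x. ennreal \<bar>f x\<bar>) \<in> borel_measurable (completion MR)"
    using assms unfolding Rn_eq by measurable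
  from completion_ex_borel_measurable[OF this] that show ?thesis
    by (auto simp: borel_version_def)
qed

text \<open>
  The base points over which the section of \<open>f\<close> may be replaced by the section of \<open>F\<close>; in particular,
  over such points the section of \<open>f\<close> is Lebesgue measurable.
\<close>

definition good_section :: "('k point \<Rightarrow> real) \<Rightarrow> ('k point \<Rightarrow> ennreal) \<Rightarrow> (nat \<Rightarrow> real) \<Rightarrow> bool" where
  "good_section f F xb \<longleftrightarrow> xb \<in> space M \<and> (\<lambda>y. F (xb, y)) \<in> borel_measurable lborel \<and>
     (AE y in lborel. ennreal \<bar>f (xb, y)\<bar> = F (xb, y))"

lemma AE_good_section:
  assumes "borel_version f F"
  shows "AE xb in M. good_section f F xb"
proof -
  have "AE xb in M. AE y in lborel. ennreal \<bar>f (xb, y)\<bar> = F (xb, y)"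
    using assms unfolding borel_version_def by (intro XL.AE_pair) auto
  then show ?thesis
    using AE_space
  proof eventually_elim
    case (elim xb)
    with assms section_measurable[of F lborel xb] show ?case
      by (auto simp: good_section_def borel_version_def)
  qed
qed

lemma emeasure_good_section:
  assumes "good_section f F xb" "0 \<le> t"
  shows "emeasure lebesgue {y. \<bar>f (xb, y)\<bar> > t} = distrib lborel (\<lambda>y. F (xb, y)) (ennreal t)"
proof -
  have [measurable]: "(\<lambda>y. F (xb, y)) \<in> borel_measurable borel"
    using assms by (simp add: good_section_def)
  define B where "B = {y \<in> space lborel. ennreal t < F (xb, y)}"
  have B: "B \<in> sets borel" unfolding B_def by measurable
  have ae: "AE y in lebesgue. y \<in> B \<longleftrightarrow> y \<in> {y. \<bar>f (xb, y)\<bar> > t}"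
    unfolding AE_completion_iff B_def
    using assms(1)[unfolded good_section_def, THEN conjunct2, THEN conjunct2]
  proof eventually_elim
    case (elim y)
    from elim[symmetric] \<open>0 \<le> t\<close> show ?case by (simp add: ennreal_less_iff)
  qed
  have S: "{y. \<bar>f (xb, y)\<bar> > t} \<in> sets lebesgue"
    using ae by (rule completion.in_sets_AE) (use B in auto)
  have "emeasure lebesgue {y. \<bar>f (xb, y)\<bar> > t} = emeasure lebesgue B"
    using ae S B by (intro emeasure_eq_AE) auto
  also have "\<dots> = distrib lborel (\<lambda>y. F (xb, y)) (ennreal t)"
    using B by (simp add: distrib_def B_def)
  finally show ?thesis .
qed

lemma steiner_rearr_good_section:
  assumes g: "good_section f F xb"
  shows "steiner_rearr n f (xb, y) = rearr lborel (\<lambda>y. F (xb, y)) (ennreal (unit_vol TYPE('k) * norm y ^ CARD('k)))"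
proof -
  let ?s = "ennreal (unit_vol TYPE('k) * norm y ^ CARD('k))"
  have xb: "xb \<in> space M" using g by (simp add: good_section_def)
  have mem: "(xb, y) \<in> steiner n {x \<in> space (lebesgue_Rn n). \<bar>f x\<bar> > t} \<longleftrightarrow> ?s < distrib lborel (\<lambda>y. F (xb, y)) (ennreal t)"
    if "0 < t" for t
    using xb emeasure_good_section[OF g, of t] that
    by (simp add: steiner_def mem_ball_of_measure space_Rn M_eq[symmetric])
  have "steiner_rearr n f (xb, y) = (\<integral>\<^sup>+t. indicator (steiner n {x \<in> space (lebesgue_Rn n). \<bar>f x\<bar> > t}) (xb, y) \<partial>pos_line)"
    unfolding steiner_rearr_def by (rule nn_integral_restrict_space[symmetric]) simp
  also have "\<dots> = (\<integral>\<^sup>+t. indicator {t. ?s < distrib lborel (\<lambda>y. F (xb, y)) (ennreal t)} t \<partial>pos_line)"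
    using mem by (intro nn_integral_cong) (auto simp: indicator_def)
  also have "\<dots> = rearr lborel (\<lambda>y. F (xb, y)) ?s"
    using g by (intro rearr_eq_integral[symmetric]) (simp add: good_section_def)
  finally show ?thesis .
qed

lemma steiner_rearr_half_good_section:
  assumes g: "good_section f F xb"
  shows "steiner_rearr_half f xb s = rearr lborel (\<lambda>y. F (xb, y)) (ennreal s)"
  unfolding steiner_rearr_half_def
  using g emeasure_good_section[OF g] by (intro decr_rearr_eq_rearr) (auto simp: good_section_def)

text \<open>
  The averaged weight \<open>weight_bar v\<close>, computed from the Borel version of \<open>v\<close>.
\<close>

definition w :: "(nat \<Rightarrow> real) \<Rightarrow> real \<Rightarrow> ennreal" where
  "w xb s = (\<integral>\<^sup>+\<theta>. u (xb, root CARD('k) (s / unit_vol TYPE('k)) *\<^sub>R \<theta>) \<partial>borel_sphere_measure)"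

text \<open>
  The Jacobian constant \<open>k \<sigma>\<^sub>k\<close> of the coordinates \<open>s = \<sigma>\<^sub>k |y|\<^sup>k\<close>.
\<close>

definition c_polar :: ennreal where
  "c_polar = ennreal (CARD('k) * unit_vol TYPE('k))"

lemma c_polar: "0 < c_polar" "c_polar < top"
  using unit_vol_pos[where 'k='k] by (simp_all add: c_polar_def)

lemma borel_measurable_sphere_integral:
  assumes [measurable]: "f \<in> borel_measurable MR"
  shows "(\<lambda>(xb, s). \<integral>\<^sup>+\<theta>. f (xb, root CARD('k) (s / unit_vol TYPE('k)) *\<^sub>R \<theta>) \<partial>borel_sphere_measure :: ennreal) \<in> borel_measurable (M \<Otimes>\<^sub>M borel)"
proof -
  interpret S: finite_measure "borel_sphere_measure :: (real^'k) measure" by (rule finite_measure_borel_sphere_measure)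
  have [measurable]: "(\<lambda>z. snd z) \<in> measurable ((M \<Otimes>\<^sub>M (borel :: real measure)) \<Otimes>\<^sub>M (borel_sphere_measure :: (real^'k) measure)) borel"
    by (rule measurable_compose[OF measurable_snd measurable_id_sphere])
  have "(\<lambda>z. f (fst (fst z), root CARD('k) (snd (fst z) / unit_vol TYPE('k)) *\<^sub>R snd z)) \<in> borel_measurable ((M \<Otimes>\<^sub>M borel) \<Otimes>\<^sub>M (borel_sphere_measure :: (real^'k) measure))"
    by measurable
  then have "(\<lambda>z. \<integral>\<^sup>+\<theta>. f (fst z, root CARD('k) (snd z / unit_vol TYPE('k)) *\<^sub>R \<theta>) \<partial>borel_sphere_measure) \<in> borel_measurable (M \<Otimes>\<^sub>M borel)"
    by (intro S.borel_measurable_nn_integral) (simp add: case_prod_unfold)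
  then show ?thesis by (simp add: case_prod_unfold)
qed

lemma w_measurable[measurable]: "(\<lambda>(xb, s). w xb s) \<in> borel_measurable (M \<Otimes>\<^sub>M borel)"
  unfolding w_def by (rule borel_measurable_sphere_integral[OF u_measurable])

lemma measurable_M_pos_line:
  "f \<in> measurable (M \<Otimes>\<^sub>M borel) K \<Longrightarrow> f \<in> measurable MS K"
proof -
  have "(\<lambda>z. (fst z, snd z)) \<in> measurable MS (M \<Otimes>\<^sub>M borel)"
    by (intro measurable_Pair measurable_fst measurable_compose[OF measurable_snd measurable_id_pos_line])
  then show "f \<in> measurable (M \<Otimes>\<^sub>M borel) K \<Longrightarrow> f \<in> measurable MS K"
    using measurable_compose by fastforce
qed

lemma w_measurable_pos: "(\<lambda>(xb, s). w xb s) \<in> borel_measurable MS"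
  by (rule measurable_M_pos_line[OF w_measurable])

lemma w_section: "xb \<in> space M \<Longrightarrow> w xb \<in> borel_measurable borel"
  using section_measurable[OF w_measurable, of xb] by simp

lemma polar_u:
  assumes xb: "xb \<in> space M" and \<phi>[measurable]: "\<phi> \<in> borel_measurable borel"
  shows "c_polar * (\<integral>\<^sup>+y. \<phi> (unit_vol TYPE('k) * norm y ^ CARD('k)) * u (xb, y) \<partial>lborel) = (\<integral>\<^sup>+s. \<phi> s * w xb s \<partial>pos_line)"
proof -
  interpret S: finite_measure "borel_sphere_measure :: (real^'k) measure" by (rule finite_measure_borel_sphere_measure)
  have ub[measurable]: "(\<lambda>y. u (xb, y)) \<in> borel_measurable borel"
    using section_measurable[OF u_measurable xb] by simp
  have "c_polar * (\<integral>\<^sup>+y. \<phi> (unit_vol TYPE('k) * norm y ^ CARD('k)) * u (xb, y) \<partial>lborel)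
    = (\<integral>\<^sup>+s. (\<integral>\<^sup>+\<theta>. \<phi> (unit_vol TYPE('k) * norm (root CARD('k) (s / unit_vol TYPE('k)) *\<^sub>R \<theta>) ^ CARD('k)) * u (xb, root CARD('k) (s / unit_vol TYPE('k)) *\<^sub>R \<theta>) \<partial>borel_sphere_measure) \<partial>pos_line)"
    unfolding c_polar_def by (rule polar_coordinates) measurable
  also have "\<dots> = (\<integral>\<^sup>+s. \<phi> s * w xb s \<partial>pos_line)"
  proof (intro nn_integral_cong)
    fix s :: real assume "s \<in> space pos_line"
    then have s: "0 < s" by simp
    define r where "r = root CARD('k) (s / unit_vol TYPE('k))"
    have r: "0 \<le> r" "unit_vol TYPE('k) * r ^ CARD('k) = s"
      using s unit_vol_pos[where 'k='k] by (simp_all add: r_def)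
    have "(\<integral>\<^sup>+\<theta>. \<phi> (unit_vol TYPE('k) * norm (r *\<^sub>R \<theta>) ^ CARD('k)) * u (xb, r *\<^sub>R \<theta>) \<partial>borel_sphere_measure)
      = (\<integral>\<^sup>+\<theta>. \<phi> s * u (xb, r *\<^sub>R \<theta>) \<partial>borel_sphere_measure)"
      using r by (intro nn_integral_cong) simp
    also have "\<dots> = \<phi> s * (\<integral>\<^sup>+\<theta>. u (xb, r *\<^sub>R \<theta>) \<partial>borel_sphere_measure)"
      by (intro nn_integral_cmult borel_measurable_sphere) measurable
    finally show "(\<integral>\<^sup>+\<theta>. \<phi> (unit_vol TYPE('k) * norm (root CARD('k) (s / unit_vol TYPE('k)) *\<^sub>R \<theta>) ^ CARD('k)) * u (xb, root CARD('k) (s / unit_vol TYPE('k)) *\<^sub>R \<theta>) \<partial>borel_sphere_measure) = \<phi> s * w xb s"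
      by (simp add: r_def w_def)
  qed
  finally show ?thesis .
qed

end

section \<open>The symmetrized integral\<close>

context steiner_weight
begin

lemma AE_fst:
  assumes "sigma_finite_measure N" and ae: "AE xb in M. P xb"
  shows "AE z in M \<Otimes>\<^sub>M N. P (fst z)"
proof -
  interpret N: sigma_finite_measure N by fact
  obtain K where K: "K \<in> null_sets M" "{x \<in> space M. \<not> P x} \<subseteq> K"
    using ae by (auto simp: eventually_ae_filter)
  have "K \<times> space N \<in> null_sets (M \<Otimes>\<^sub>M N)"
    using K(1) by (auto simp: null_sets_def N.emeasure_pair_measure_Times)
  then show ?thesis
    using K(2) by (intro AE_I'[of "K \<times> space N"]) (auto simp: space_pair_measure)
qed

lemma AE_pairI:
  assumes N: "sigma_finite_measure N" and m: "Measurable.pred (M \<Otimes>\<^sub>M N) P"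
    and ae: "AE x in M. AE y in N. P (x, y)"
  shows "AE z in M \<Otimes>\<^sub>M N. P z"
proof -
  interpret pair_sigma_finite M N
    by (intro pair_sigma_finite.intro M.sigma_finite_measure_axioms N)
  show ?thesis using m ae by (intro AE_pair_measure) (auto simp: pred_def)
qed

lemma measurable_rearr_sections:
  assumes [measurable]: "F \<in> borel_measurable MR"
    and [measurable]: "a \<in> borel_measurable K" "b \<in> measurable K M"
  shows "(\<lambda>z. rearr lborel (\<lambda>y. F (b z, y)) (a z)) \<in> borel_measurable K"
proof (rule borel_measurable_rearr_param[where F = "\<lambda>x y. F (x, y)" and M=M and N=lborel])
  show "(\<lambda>(x, y). F (x, y)) \<in> borel_measurable MR" by (simp add: assms(1))
qed (use assms sigma_finite_lborel in auto)

definition choquet :: "('k point \<Rightarrow> real) \<Rightarrow> ennreal" where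
  "choquet f = (\<integral>\<^sup>+x. steiner_rearr n f x * ennreal (v x) \<partial>lebesgue_Rn n)"

text \<open>
  The right-hand side of the duality formula, for a Borel version of \<open>|f|\<close>.
\<close>

definition half_integral :: "('k point \<Rightarrow> ennreal) \<Rightarrow> ennreal" where
  "half_integral F = (\<integral>\<^sup>+xb. (\<integral>\<^sup>+s. rearr lborel (\<lambda>y. F (xb, y)) (ennreal s) * w xb s \<partial>pos_line) \<partial>M)"

lemma measurable_half_integrand:
  assumes F: "F \<in> borel_measurable MR"
  shows "(\<lambda>z. rearr lborel (\<lambda>y. F (fst z, y)) (ennreal (snd z)) * w (fst z) (snd z)) \<in> borel_measurable MS"
proof (rule borel_measurable_times_ennreal)
  have [measurable]: "snd \<in> borel_measurable MS"
    using measurable_compose[OF measurable_snd measurable_id_pos_line] by simp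
  show "(\<lambda>z. rearr lborel (\<lambda>y. F (fst z, y)) (ennreal (snd z))) \<in> borel_measurable MS"
    by (rule measurable_rearr_sections[OF F]) measurable
  show "(\<lambda>z. w (fst z) (snd z)) \<in> borel_measurable MS"
    using w_measurable_pos by (simp add: case_prod_unfold)
qed

lemma AE_steiner_rearr:
  assumes F: "borel_version f F"
  shows "AE z in MR. steiner_rearr n f z = rearr lborel (\<lambda>y. F (fst z, y)) (ennreal (unit_vol TYPE('k) * norm (snd z) ^ CARD('k)))"
  using AE_fst[OF sigma_finite_lborel AE_good_section[OF F]]
proof eventually_elim
  case (elim z)
  from steiner_rearr_good_section[OF this, of "snd z"] show ?case by simp
qed

lemma measurable_steiner_rearr:
  fixes f :: "'k point \<Rightarrow> real"
  assumes f: "f \<in> borel_measurable (lebesgue_Rn n)"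
  shows "steiner_rearr n f \<in> borel_measurable (lebesgue_Rn n)"
proof -
  obtain F where F: "borel_version f F" using f by (rule ex_borel_version)
  then have [measurable]: "F \<in> borel_measurable MR" by (simp add: borel_version_def)
  have "(\<lambda>z. rearr lborel (\<lambda>y. F (fst z, y)) (ennreal (unit_vol TYPE('k) * norm (snd z) ^ CARD('k)))) \<in> borel_measurable MR"
    by (rule measurable_rearr_sections) measurable
  moreover have "AE z in MR. rearr lborel (\<lambda>y. F (fst z, y)) (ennreal (unit_vol TYPE('k) * norm (snd z) ^ CARD('k))) = steiner_rearr n f z"
    using AE_steiner_rearr[OF F] by eventually_elim simp
  ultimately show ?thesis
    unfolding Rn_eq by (rule borel_measurable_completion_AE)
qed

text \<open>
  On a good section the symmetrization depends on \<open>y\<close> only through \<open>\<sigma>\<^sub>k |y|\<^sup>k\<close>, where its value is the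
  rearrangement of the section. Polar coordinates then move all the angular dependence into \<open>w\<close>.
\<close>

theorem choquet_eq_half_integral:
  assumes F: "borel_version f F"
  shows "c_polar * choquet f = half_integral F"
proof -
  have [measurable]: "F \<in> borel_measurable MR" using F by (simp add: borel_version_def)
  let ?r = "\<lambda>z. rearr lborel (\<lambda>y. F (fst z, y)) (ennreal (unit_vol TYPE('k) * norm (snd z) ^ CARD('k)))"
  have mr[measurable]: "?r \<in> borel_measurable MR"
    by (rule measurable_rearr_sections) measurable
  have "choquet f = (\<integral>\<^sup>+z. steiner_rearr n f z * ennreal (v z) \<partial>MR)"
    unfolding choquet_def Rn_eq by (rule nn_integral_completion)
  also have "\<dots> = (\<integral>\<^sup>+z. ?r z * u z \<partial>MR)"
  proof (rule nn_integral_cong_AE)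
    show "AE z in MR. steiner_rearr n f z * ennreal (v z) = ?r z * u z"
      using AE_steiner_rearr[OF F] u_eq by eventually_elim simp
  qed
  also have "\<dots> = (\<integral>\<^sup>+xb. (\<integral>\<^sup>+y. ?r (xb, y) * u (xb, y) \<partial>lborel) \<partial>M)"
    by (intro lborel.nn_integral_fst[symmetric]) measurable
  finally have "c_polar * choquet f = c_polar * (\<integral>\<^sup>+xb. (\<integral>\<^sup>+y. ?r (xb, y) * u (xb, y) \<partial>lborel) \<partial>M)"
    by simp
  also have "\<dots> = (\<integral>\<^sup>+xb. c_polar * (\<integral>\<^sup>+y. ?r (xb, y) * u (xb, y) \<partial>lborel) \<partial>M)"
    by (intro nn_integral_cmult[symmetric] lborel.borel_measurable_nn_integral_fst) measurable
  also have "\<dots> = half_integral F"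
    unfolding half_integral_def
  proof (intro nn_integral_cong)
    fix xb assume xb: "xb \<in> space M"
    have "(\<lambda>s. rearr lborel (\<lambda>y. F (xb, y)) (ennreal s)) \<in> borel_measurable (borel :: real measure)"
      by (rule measurable_rearr_sections) (use xb in auto)
    from polar_u[OF xb this]
    show "c_polar * (\<integral>\<^sup>+y. ?r (xb, y) * u (xb, y) \<partial>lborel) = (\<integral>\<^sup>+s. rearr lborel (\<lambda>y. F (xb, y)) (ennreal s) * w xb s \<partial>pos_line)"
      by simp
  qed
  finally show ?thesis .
qed

text \<open>
  The functions \<open>v\<close> and \<open>u\<close> differ on a null set \<open>K\<close> only. By polar coordinates almost every sphere in
  almost every fibre meets \<open>K\<close> in a set of surface measure zero.
\<close>

lemma AE_weight_bar: "AE z in MS. weight_bar v (fst z) (snd z) = w (fst z) (snd z)"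
proof -
  obtain K where K: "K \<in> null_sets MR" "{x \<in> space MR. ennreal (v x) \<noteq> u x} \<subseteq> K"
    using u_eq by (auto simp: eventually_ae_filter)
  then have [measurable]: "K \<in> sets MR" by auto
  define q where "q xb s = (\<integral>\<^sup>+\<theta>. indicator K (xb, root CARD('k) (s / unit_vol TYPE('k)) *\<^sub>R \<theta>) \<partial>borel_sphere_measure :: ennreal)" for xb s
  have "(\<lambda>(xb, s). q xb s) \<in> borel_measurable (M \<Otimes>\<^sub>M borel)"
    unfolding q_def by (rule borel_measurable_sphere_integral) measurable
  then have q: "(\<lambda>(xb, s). q xb s) \<in> borel_measurable MS"
    by (rule measurable_M_pos_line)
  have "AE z in MR. z \<notin> K" using K(1) by (rule AE_not_in)
  then have "AE xb in M. AE y in lborel. (xb, y) \<notin> K" by (rule XL.AE_pair)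
  then have ae0: "AE xb in M. (\<integral>\<^sup>+s. q xb s \<partial>pos_line) = 0"
    using AE_space
  proof eventually_elim
    case (elim xb)
    have "(\<lambda>y. indicator K (xb, y) :: ennreal) \<in> borel_measurable lborel"
      by (rule section_measurable) (use elim in auto)
    then have "(\<integral>\<^sup>+s. q xb s \<partial>pos_line) = c_polar * (\<integral>\<^sup>+y. indicator K (xb, y) \<partial>lborel)"
      unfolding q_def c_polar_def by (intro polar_coordinates[symmetric]) simp
    also have "(\<integral>\<^sup>+y. indicator K (xb, y) \<partial>lborel) = (\<integral>\<^sup>+y. 0 \<partial>(lborel :: (real^'k) measure))"
      using elim by (intro nn_integral_cong_AE) auto
    finally show ?case by simp
  qed
  have "(\<integral>\<^sup>+z. (\<lambda>(xb, s). q xb s) z \<partial>MS) = (\<integral>\<^sup>+xb. (\<integral>\<^sup>+s. q xb s \<partial>pos_line) \<partial>M)"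
    by (subst pos_line.nn_integral_fst[symmetric, OF q]) simp
  also have "\<dots> = (\<integral>\<^sup>+xb. 0 \<partial>M)" by (rule nn_integral_cong_AE[OF ae0])
  finally have "(\<integral>\<^sup>+z. (\<lambda>(xb, s). q xb s) z \<partial>MS) = 0" by simp
  then have "AE z in MS. (\<lambda>(xb, s). q xb s) z = 0"
    by (subst (asm) nn_integral_0_iff_AE[OF q])
  then show ?thesis using AE_space
  proof eventually_elim
    case (elim z)
    obtain xb s where z: "z = (xb, s)" by (cases z)
    with elim have xb: "xb \<in> space M" and q0: "q xb s = 0" by (auto simp: space_pair_measure)
    define r where "r = root CARD('k) (s / unit_vol TYPE('k))"
    have m: "(\<lambda>\<theta>. indicator K (xb, r *\<^sub>R \<theta>) :: ennreal) \<in> borel_measurable (borel_sphere_measure :: (real^'k) measure)"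
    proof -
      have [measurable]: "(\<lambda>y. indicator K (xb, y) :: ennreal) \<in> borel_measurable borel"
        using section_measurable[of "indicator K" lborel xb] xb by simp
      show ?thesis by (rule borel_measurable_sphere) measurable
    qed
    have "AE \<theta> in borel_sphere_measure. indicator K (xb, r *\<^sub>R \<theta>) = (0::ennreal)"
      using q0 unfolding q_def r_def[symmetric] by (subst (asm) nn_integral_0_iff_AE[OF m])
    then have "AE \<theta> in borel_sphere_measure. ennreal (v (xb, r *\<^sub>R \<theta>)) = u (xb, r *\<^sub>R \<theta>)"
    proof eventually_elim
      case (elim \<theta>)
      then have "(xb, r *\<^sub>R \<theta>) \<notin> K" by (auto simp: indicator_def)
      with K(2) xb show ?case by (auto simp: space_pair_measure)
    qed
    then show ?case
      unfolding z fst_conv snd_conv weight_bar_def w_def sphere_measure_eq_completion nn_integral_completion r_def[symmetric]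
      by (rule nn_integral_cong_AE)
  qed
qed

lemma half_integral_eq:
  assumes F: "borel_version f F"
  shows "(\<integral>\<^sup>+(xb, s). steiner_rearr_half f xb s * weight_bar v xb s \<partial>lebesgue_half_space (n - CARD('k))) = half_integral F"
proof -
  have [measurable]: "F \<in> borel_measurable MR" using F by (simp add: borel_version_def)
  have r: "(\<lambda>z. rearr lborel (\<lambda>y. F (fst z, y)) (ennreal (snd z)) * w (fst z) (snd z)) \<in> borel_measurable MS"
    by (rule measurable_half_integrand) measurable
  have "(\<integral>\<^sup>+(xb, s). steiner_rearr_half f xb s * weight_bar v xb s \<partial>lebesgue_half_space (n - CARD('k)))
      = (\<integral>\<^sup>+z. steiner_rearr_half f (fst z) (snd z) * weight_bar v (fst z) (snd z) \<partial>MS)"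
    unfolding half_eq nn_integral_completion by (simp add: case_prod_unfold)
  also have "\<dots> = (\<integral>\<^sup>+z. rearr lborel (\<lambda>y. F (fst z, y)) (ennreal (snd z)) * w (fst z) (snd z) \<partial>MS)"
  proof (rule nn_integral_cong_AE)
    show "AE z in MS. steiner_rearr_half f (fst z) (snd z) * weight_bar v (fst z) (snd z) =
      rearr lborel (\<lambda>y. F (fst z, y)) (ennreal (snd z)) * w (fst z) (snd z)"
      using AE_fst[OF sigma_finite_pos_line AE_good_section[OF F]] AE_weight_bar
      by eventually_elim (simp add: steiner_rearr_half_good_section)
  qed
  also have "\<dots> = half_integral F"
    unfolding half_integral_def by (subst pos_line.nn_integral_fst[symmetric, OF r]) simp
  finally show ?thesis .
qed

lemma half_integral_SUP:
  assumes F[measurable]: "\<And>i. F i \<in> borel_measurable MR" and inc: "incseq F"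
  shows "half_integral (\<lambda>z. SUP i. F i z) = (SUP i. half_integral (F i))"
proof -
  have m: "(\<lambda>z. rearr lborel (\<lambda>y. F i (fst z, y)) (ennreal (snd z)) * w (fst z) (snd z)) \<in> borel_measurable MS" for i
    by (rule measurable_half_integrand) measurable
  have sec: "(\<lambda>y. F i (xb, y)) \<in> borel_measurable lborel" if "xb \<in> space M" for i xb
    using section_measurable[OF F that] .
  have mono: "rearr lborel (\<lambda>y. F i (xb, y)) s \<le> rearr lborel (\<lambda>y. F j (xb, y)) s" if "i \<le> j" "xb \<in> space M" for i j xb s
    using that inc by (intro rearr_mono sec AE_I2) (auto simp: incseq_def le_fun_def)
  have "half_integral (\<lambda>z. SUP i. F i z) = (\<integral>\<^sup>+xb. (\<integral>\<^sup>+s. (SUP i. rearr lborel (\<lambda>y. F i (xb, y)) (ennreal s) * w xb s) \<partial>pos_line) \<partial>M)"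
    unfolding half_integral_def
  proof (intro nn_integral_cong)
    fix xb s assume xb: "xb \<in> space M"
    have "rearr lborel (\<lambda>y. SUP i. F i (xb, y)) (ennreal s) = (SUP i. rearr lborel (\<lambda>y. F i (xb, y)) (ennreal s))"
      using xb inc by (intro rearr_SUP sec) (auto simp: incseq_def le_fun_def)
    then show "rearr lborel (\<lambda>y. SUP i. F i (xb, y)) (ennreal s) * w xb s = (SUP i. rearr lborel (\<lambda>y. F i (xb, y)) (ennreal s) * w xb s)"
      by (simp add: SUP_mult_right_ennreal)
  qed
  also have "\<dots> = (\<integral>\<^sup>+xb. (SUP i. (\<integral>\<^sup>+s. rearr lborel (\<lambda>y. F i (xb, y)) (ennreal s) * w xb s \<partial>pos_line)) \<partial>M)"
  proof (intro nn_integral_cong nn_integral_monotone_convergence_SUP_AE)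
    fix xb i assume xb: "xb \<in> space M"
    show "(\<lambda>s. rearr lborel (\<lambda>y. F i (xb, y)) (ennreal s) * w xb s) \<in> borel_measurable pos_line"
      using section_measurable[OF m xb, of i] by simp
    show "AE s in pos_line. rearr lborel (\<lambda>y. F i (xb, y)) (ennreal s) * w xb s \<le> rearr lborel (\<lambda>y. F (Suc i) (xb, y)) (ennreal s) * w xb s"
      using mono[OF _ xb, of i "Suc i"] by (auto intro!: mult_right_mono)
  qed
  also have "\<dots> = (SUP i. half_integral (F i))"
    unfolding half_integral_def
  proof (intro nn_integral_monotone_convergence_SUP_AE)
    fix i
    show "(\<lambda>xb. \<integral>\<^sup>+s. rearr lborel (\<lambda>y. F i (xb, y)) (ennreal s) * w xb s \<partial>pos_line) \<in> borel_measurable M"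
      using pos_line.borel_measurable_nn_integral_fst[OF m, of i] by simp
    show "AE xb in M. (\<integral>\<^sup>+s. rearr lborel (\<lambda>y. F i (xb, y)) (ennreal s) * w xb s \<partial>pos_line)
        \<le> (\<integral>\<^sup>+s. rearr lborel (\<lambda>y. F (Suc i) (xb, y)) (ennreal s) * w xb s \<partial>pos_line)"
      using AE_space
    proof eventually_elim
      case (elim xb)
      then show ?case using mono[of i "Suc i" xb] by (intro nn_integral_mono mult_right_mono) auto
    qed
  qed
  finally show ?thesis .
qed

end

section \<open>A decreasing averaged weight gives duality\<close>

context steiner_weight
begin

text \<open>
  The base part of the bounded sets of \<open>locally_integrable\<close>. Every base point lies in all large
  boxes (\<open>ex_box\<close>), also when the base is a single point.
\<close>

definition box :: "real \<Rightarrow> (nat \<Rightarrow> real) set" where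
  "box R = {xb \<in> space M. \<forall>i < n - CARD('k). \<bar>xb i\<bar> \<le> R}"

lemma box_measurable: "box R \<in> sets M"
proof -
  have "box R = (\<Pi>\<^sub>E i\<in>{..<n - CARD('k)}. {-R..R})"
  proof -
    have "space M = (\<Pi>\<^sub>E i\<in>{..<n - CARD('k)}. UNIV)" by (simp add: M_eq space_PiM)
    moreover have "\<bar>x\<bar> \<le> R \<longleftrightarrow> x \<in> {-R..R}" for x by auto
    ultimately show ?thesis unfolding box_def PiE_iff by blast
  qed
  also have "\<dots> \<in> sets M"
    unfolding M_eq by (intro sets_PiM_I_finite) auto
  finally show ?thesis .
qed

lemma ex_box:
  assumes "xb \<in> space M"
  shows "\<exists>N::nat. \<forall>R\<ge>real N. xb \<in> box R"
proof -
  obtain N :: nat where N: "(\<Sum>i<n - CARD('k). \<bar>xb i\<bar>) \<le> real N"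
    using real_arch_simple by blast
  have "\<bar>xb i\<bar> \<le> (\<Sum>i<n - CARD('k). \<bar>xb i\<bar>)" if "i < n - CARD('k)" for i
    using that by (intro member_le_sum) auto
  with N assms show ?thesis by (intro exI[of _ N]) (auto simp: box_def intro: order_trans)
qed

text \<open>
  The primitive of the averaged weight. Up to the constant \<open>c_polar\<close>, the weighted volume of a
  symmetrized set is the integral over the base of \<open>W\<close> at the measure of the section.
\<close>

definition W :: "(nat \<Rightarrow> real) \<Rightarrow> real \<Rightarrow> ennreal" where
  "W xb a = (\<integral>\<^sup>+s. indicator {..<a} s * w xb s \<partial>pos_line)"

lemma measurable_w_indicator:
  assumes A[measurable]: "A \<in> sets borel"
  shows "(\<lambda>(xb, s). indicator A s * w xb s) \<in> borel_measurable MS"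
proof (rule measurable_M_pos_line)
  have "(\<lambda>z. indicator A (snd z) * (\<lambda>(xb, s). w xb s) z) \<in> borel_measurable (M \<Otimes>\<^sub>M borel)"
    by measurable
  then show "(\<lambda>(xb, s). indicator A s * w xb s) \<in> borel_measurable (M \<Otimes>\<^sub>M borel)"
    by (simp add: case_prod_unfold)
qed

lemma measurable_w_integral:
  assumes "A \<in> sets borel"
  shows "(\<lambda>xb. \<integral>\<^sup>+s. indicator A s * w xb s \<partial>pos_line) \<in> borel_measurable M"
  using pos_line.borel_measurable_nn_integral_fst[OF measurable_w_indicator[OF assms]] by simp

lemma W_measurable: "(\<lambda>xb. W xb a) \<in> borel_measurable M"
  unfolding W_def by (rule measurable_w_integral) simp

lemma W_mono: "a \<le> b \<Longrightarrow> W xb a \<le> W xb b"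
  unfolding W_def by (intro nn_integral_mono mult_right_mono) (auto simp: indicator_def)

text \<open>
  Local integrability of \<open>v\<close> on the product of the box with a ball of volume at least \<open>a\<close>.
\<close>

lemma W_box_finite: "(\<integral>\<^sup>+xb. indicator (box R) xb * W xb a \<partial>M) < \<infinity>"
proof -
  define r where "r = max R (root CARD('k) (max 0 a / unit_vol TYPE('k)))"
  define D where "D = {(xb, y::real^'k) \<in> space (lebesgue_Rn n). (\<forall>i < n - CARD('k). \<bar>xb i\<bar> \<le> r) \<and> norm y \<le> r}"
  have nonneg: "0 \<le> v x" if "x \<in> space (lebesgue_Rn n)" for x
    using weight that by (auto simp: weight_def)
  have "set_integrable (lebesgue_Rn n) D v"
    using weight unfolding weight_def locally_integrable_def D_def by blast
  then have "(\<integral>\<^sup>+x. ennreal (norm (indicator D x *\<^sub>R v x)) \<partial>lebesgue_Rn n) < \<infinity>"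
    unfolding set_integrable_def integrable_iff_bounded by blast
  also have "(\<integral>\<^sup>+x. ennreal (norm (indicator D x *\<^sub>R v x)) \<partial>lebesgue_Rn n) = (\<integral>\<^sup>+x. indicator D x * ennreal (v x) \<partial>lebesgue_Rn n)"
    using nonneg by (intro nn_integral_cong) (auto simp: indicator_def)
  also have "\<dots> = (\<integral>\<^sup>+x. indicator D x * ennreal (v x) \<partial>MR)"
    unfolding Rn_eq by (rule nn_integral_completion)
  also have "\<dots> = (\<integral>\<^sup>+x. indicator D x * u x \<partial>MR)"
  proof (rule nn_integral_cong_AE)
    show "AE x in MR. indicator D x * ennreal (v x) = indicator D x * u x"
      using u_eq by eventually_elim simp
  qed
  finally have fin: "(\<integral>\<^sup>+x. indicator D x * u x \<partial>MR) < \<infinity>" .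
  let ?\<phi> = "\<lambda>s. indicator {..<a} s :: ennreal"
  let ?g = "\<lambda>y::real^'k. unit_vol TYPE('k) * norm y ^ CARD('k)"
  have [measurable]: "box R \<in> sets M" by (rule box_measurable)
  have m: "(\<lambda>z. indicator (box R) (fst z) * (?\<phi> (?g (snd z)) * u z)) \<in> borel_measurable MR"
    by measurable
  have "(\<integral>\<^sup>+xb. indicator (box R) xb * W xb a \<partial>M) = (\<integral>\<^sup>+xb. c_polar * (\<integral>\<^sup>+y. indicator (box R) xb * (?\<phi> (?g y) * u (xb, y)) \<partial>lborel) \<partial>M)"
  proof (intro nn_integral_cong)
    fix xb assume xb: "xb \<in> space M"
    have "W xb a = c_polar * (\<integral>\<^sup>+y. ?\<phi> (?g y) * u (xb, y) \<partial>lborel)"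
      unfolding W_def by (intro polar_u[symmetric] xb) simp
    then show "indicator (box R) xb * W xb a = c_polar * (\<integral>\<^sup>+y. indicator (box R) xb * (?\<phi> (?g y) * u (xb, y)) \<partial>lborel)"
      by (auto simp: indicator_def)
  qed
  also have "\<dots> = c_polar * (\<integral>\<^sup>+xb. (\<integral>\<^sup>+y. indicator (box R) xb * (?\<phi> (?g y) * u (xb, y)) \<partial>lborel) \<partial>M)"
    using lborel.borel_measurable_nn_integral_fst[OF m] by (intro nn_integral_cmult) simp
  also have "(\<integral>\<^sup>+xb. (\<integral>\<^sup>+y. indicator (box R) xb * (?\<phi> (?g y) * u (xb, y)) \<partial>lborel) \<partial>M)
    = (\<integral>\<^sup>+z. indicator (box R) (fst z) * (?\<phi> (?g (snd z)) * u z) \<partial>MR)"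
    using lborel.nn_integral_fst[OF m] by simp
  also have "\<dots> \<le> (\<integral>\<^sup>+z. indicator D z * u z \<partial>MR)"
  proof (intro nn_integral_mono)
    fix z assume z: "z \<in> space MR"
    have "z \<in> D" if "fst z \<in> box R" "?g (snd z) < a"
    proof -
      have "0 \<le> ?g (snd z)" using unit_vol_pos[where 'k='k] by simp
      then have "0 < a" using that by linarith
      then have "norm (snd z) < root CARD('k) (a / unit_vol TYPE('k))"
        using norm_less_root_iff[of a "snd z"] that by simp
      then have "norm (snd z) \<le> r" using \<open>0 < a\<close> by (simp add: r_def)
      moreover have "R \<le> r" by (simp add: r_def)
      ultimately show ?thesis using that z
        by (force simp: D_def box_def space_Rn space_pair_measure case_prod_unfold)
    qed
    then show "indicator (box R) (fst z) * (?\<phi> (?g (snd z)) * u z) \<le> indicator D z * u z"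
      by (auto simp: indicator_def)
  qed
  finally show ?thesis
    using fin c_polar by (simp add: ennreal_mult_less_top mult_left_mono order.strict_trans1)
qed

lemma AE_W_finite: "AE xb in M. \<forall>a. W xb a < \<infinity>"
proof -
  have "AE xb in M. \<forall>N::nat. indicator (box (real N)) xb * W xb (real N) \<noteq> \<infinity>"
  proof (subst AE_all_countable, intro allI nn_integral_PInf_AE)
    fix N :: nat
    show "(\<lambda>xb. indicator (box (real N)) xb * W xb (real N)) \<in> borel_measurable M"
      using W_measurable box_measurable by (intro borel_measurable_times_ennreal borel_measurable_indicator)
    show "(\<integral>\<^sup>+xb. indicator (box (real N)) xb * W xb (real N) \<partial>M) \<noteq> \<infinity>"
      using W_box_finite[of "real N" "real N"] by simp
  qed
  then show ?thesis using AE_space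
  proof eventually_elim
    case (elim xb)
    obtain N :: nat where N: "xb \<in> box R" if "real N \<le> R" for R
      using ex_box[OF elim(2)] by blast
    show ?case
    proof
      fix a
      obtain K :: nat where K: "a \<le> real K" using real_arch_simple by blast
      have "W xb a \<le> W xb (real (max N K))" using K by (intro W_mono) auto
      also have "W xb (real (max N K)) = indicator (box (real (max N K))) xb * W xb (real (max N K))"
        using N[of "real (max N K)"] by simp
      also have "\<dots> < \<infinity>" using elim(1) by (metis infinity_ennreal_def less_top)
      finally show "W xb a < \<infinity>" .
    qed
  qed
qed

lemma w_finite_of_W_finite:
  assumes xb: "xb \<in> space M" and fin: "\<forall>a. W xb a < \<infinity>"
  shows "AE s in pos_line. w xb s < \<infinity>"
proof -
  have m: "w xb \<in> borel_measurable pos_line"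
    by (rule borel_measurable_pos_line[OF w_section[OF xb]])
  have "AE s in pos_line. \<forall>N::nat. indicator {..<real N} s * w xb s \<noteq> \<infinity>"
  proof (subst AE_all_countable, intro allI nn_integral_PInf_AE)
    fix N :: nat
    have [measurable]: "(indicator {..<real N} :: real \<Rightarrow> ennreal) \<in> borel_measurable pos_line"
      by (rule borel_measurable_pos_line) simp
    show "(\<lambda>s. indicator {..<real N} s * w xb s) \<in> borel_measurable pos_line"
      using m by measurable
    show "(\<integral>\<^sup>+s. indicator {..<real N} s * w xb s \<partial>pos_line) \<noteq> \<infinity>"
      using fin[rule_format, of "real N"] by (simp add: W_def)
  qed
  then show ?thesis
  proof eventually_elim
    case (elim s)
    obtain N :: nat where "s < real N" using reals_Archimedean2 by blast
    with elim[rule_format, of N] show ?case by (simp add: less_top)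
  qed
qed

definition w_decreasing :: bool where
  "w_decreasing \<longleftrightarrow> (AE xb in M. \<exists>g. antimono_on {0<..} g \<and> (AE s in pos_line. w xb s = g s))"

lemma ae_nonincreasing_iff_w_decreasing:
  "(AE xb in M. ae_nonincreasing (weight_bar v xb)) \<longleftrightarrow> w_decreasing"
proof -
  have ae: "AE xb in M. AE s in pos_line. weight_bar v xb s = w xb s"
    using MP.AE_pair[OF AE_weight_bar] by simp
  have iff: "ae_nonincreasing (weight_bar v xb) \<longleftrightarrow> (\<exists>g. antimono_on {0<..} g \<and> (AE s in pos_line. w xb s = g s))"
    if "AE s in pos_line. weight_bar v xb s = w xb s" for xb
  proof -
    have "(AE s in pos_line. weight_bar v xb s = g s) \<longleftrightarrow> (AE s in pos_line. w xb s = g s)" for g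
    proof
      assume "AE s in pos_line. weight_bar v xb s = g s"
      with that show "AE s in pos_line. w xb s = g s" by eventually_elim simp
    next
      assume "AE s in pos_line. w xb s = g s"
      with that show "AE s in pos_line. weight_bar v xb s = g s" by eventually_elim simp
    qed
    then show ?thesis by (simp add: ae_nonincreasing_def AE_pos_line_iff)
  qed
  have "AE xb in M. ae_nonincreasing (weight_bar v xb) \<longleftrightarrow> (\<exists>g. antimono_on {0<..} g \<and> (AE s in pos_line. w xb s = g s))"
    using ae by eventually_elim (rule iff)
  then show ?thesis unfolding w_decreasing_def by (rule eventually_subst)
qed

definition admissible :: "('k point \<Rightarrow> real) set" where
  "admissible = {h \<in> borel_measurable (lebesgue_Rn n).
     AE (xb, s) in lebesgue_half_space (n - CARD('k)). steiner_rearr_half h xb s = weight_bar v xb s}"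

lemma admissible_rearr:
  assumes h: "h \<in> admissible" and H: "borel_version h H"
  shows "AE xb in M. AE s in pos_line. rearr lborel (\<lambda>y. H (xb, y)) (ennreal s) = w xb s"
proof -
  have "AE z in MS. steiner_rearr_half h (fst z) (snd z) = weight_bar v (fst z) (snd z)"
    using h unfolding admissible_def half_eq AE_completion_iff by (simp add: case_prod_unfold)
  then have "AE z in MS. rearr lborel (\<lambda>y. H (fst z, y)) (ennreal (snd z)) = w (fst z) (snd z)"
    using AE_weight_bar AE_fst[OF sigma_finite_pos_line AE_good_section[OF H]]
    by eventually_elim (simp add: steiner_rearr_half_good_section)
  from MP.AE_pair[OF this] show ?thesis by simp
qed

lemma integral_product_versions:
  assumes F: "borel_version f F" and H: "borel_version h H"
  shows "(\<integral>\<^sup>+x. ennreal \<bar>f x * h x\<bar> \<partial>lebesgue_Rn n) = (\<integral>\<^sup>+xb. (\<integral>\<^sup>+y. F (xb, y) * H (xb, y) \<partial>lborel) \<partial>M)"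
proof -
  have [measurable]: "F \<in> borel_measurable MR" "H \<in> borel_measurable MR"
    using F H by (auto simp: borel_version_def)
  have "(\<integral>\<^sup>+x. ennreal \<bar>f x * h x\<bar> \<partial>lebesgue_Rn n) = (\<integral>\<^sup>+x. ennreal \<bar>f x * h x\<bar> \<partial>MR)"
    unfolding Rn_eq by (rule nn_integral_completion)
  also have "\<dots> = (\<integral>\<^sup>+x. F x * H x \<partial>MR)"
  proof (rule nn_integral_cong_AE)
    have "AE x in MR. ennreal \<bar>f x\<bar> = F x" "AE x in MR. ennreal \<bar>h x\<bar> = H x"
      using F H by (auto simp: borel_version_def)
    then show "AE x in MR. ennreal \<bar>f x * h x\<bar> = F x * H x"
      by eventually_elim (simp add: abs_mult ennreal_mult)
  qed
  also have "\<dots> = (\<integral>\<^sup>+xb. (\<integral>\<^sup>+y. F (xb, y) * H (xb, y) \<partial>lborel) \<partial>M)"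
    by (intro lborel.nn_integral_fst[symmetric]) measurable
  finally show ?thesis .
qed

lemma integral_admissible_le:
  assumes F: "borel_version f F" and h: "h \<in> admissible"
  shows "(\<integral>\<^sup>+x. ennreal \<bar>f x * h x\<bar> \<partial>lebesgue_Rn n) \<le> half_integral F"
proof -
  obtain H where H: "borel_version h H"
    using h ex_borel_version by (auto simp: admissible_def)
  have FH: "F \<in> borel_measurable MR" "H \<in> borel_measurable MR"
    using F H by (auto simp: borel_version_def)
  have "(\<integral>\<^sup>+xb. (\<integral>\<^sup>+y. F (xb, y) * H (xb, y) \<partial>lborel) \<partial>M) \<le> half_integral F"
    unfolding half_integral_def
  proof (rule nn_integral_mono_AE)
    show "AE xb in M. (\<integral>\<^sup>+y. F (xb, y) * H (xb, y) \<partial>lborel) \<le> (\<integral>\<^sup>+s. rearr lborel (\<lambda>y. F (xb, y)) (ennreal s) * w xb s \<partial>pos_line)"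
      using admissible_rearr[OF h H] AE_space
    proof eventually_elim
      case (elim xb)
      have "(\<integral>\<^sup>+y. F (xb, y) * H (xb, y) \<partial>lborel) \<le> (\<integral>\<^sup>+s. rearr lborel (\<lambda>y. F (xb, y)) (ennreal s) * rearr lborel (\<lambda>y. H (xb, y)) (ennreal s) \<partial>pos_line)"
        by (intro Hardy_Littlewood sigma_finite_lborel section_measurable FH elim)
      also have "\<dots> = (\<integral>\<^sup>+s. rearr lborel (\<lambda>y. F (xb, y)) (ennreal s) * w xb s \<partial>pos_line)"
      proof (rule nn_integral_cong_AE)
        show "AE s in pos_line. rearr lborel (\<lambda>y. F (xb, y)) (ennreal s) * rearr lborel (\<lambda>y. H (xb, y)) (ennreal s)
           = rearr lborel (\<lambda>y. F (xb, y)) (ennreal s) * w xb s"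
          using elim(1) by eventually_elim simp
      qed
      finally show ?case .
    qed
  qed
  then show ?thesis by (simp add: integral_product_versions[OF F H])
qed

text \<open>
  On each fibre let \<open>T\<close> be the rank with respect to the section of \<open>F\<close>, and \<open>H = w \<circ> T\<close>. As \<open>T\<close>
  preserves measure, \<open>H\<close> has the distribution of \<open>w\<close>, and \<open>w\<close> is its own rearrangement because it is
  decreasing. Moreover \<open>F\<close> is at least its rearrangement composed with \<open>T\<close>.
\<close>

lemma ex_admissible_for_simple:
  assumes dec: w_decreasing and F: "simple_function MR F"
  obtains h H where "h \<in> admissible" "borel_version h H"
    "half_integral F \<le> (\<integral>\<^sup>+xb. (\<integral>\<^sup>+y. F (xb, y) * H (xb, y) \<partial>lborel) \<partial>M)"
proof -
  have Fm[measurable]: "F \<in> borel_measurable MR"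
    using F by (rule borel_measurable_simple_function)
  define T where "T z = level_rank (\<lambda>y. F (fst z, y)) (snd z)" for z
  have [measurable]: "T \<in> borel_measurable MR"
    using borel_measurable_level_rank_param[OF Fm] by (simp add: T_def[abs_def] case_prod_unfold)
  \<comment> \<open>Outside the domain of \<open>T\<close> the value \<open>0\<close> leaves the distribution unchanged.\<close>
  define H where "H z = (if T z < top then w (fst z) (enn2real (T z)) else 0)" for z
  have wT: "(\<lambda>z. w (fst z) (enn2real (T z))) \<in> borel_measurable MR"
  proof -
    have "(\<lambda>z. (fst z, enn2real (T z))) \<in> measurable MR (M \<Otimes>\<^sub>M borel)"
      by measurable
    from measurable_compose[OF this w_measurable] show ?thesis by simp
  qed
  then have H[measurable]: "H \<in> borel_measurable MR"
    unfolding H_def by measurable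
  define h where "h z = enn2real (H z)" for z
  have hm: "h \<in> borel_measurable (lebesgue_Rn n)"
    unfolding Rn_eq h_def by (intro measurable_completion) measurable
  have Fsec: "(\<lambda>y. F (xb, y)) \<in> borel_measurable borel" "finite (range (\<lambda>y. F (xb, y)))" if "xb \<in> space M" for xb
  proof -
    show "(\<lambda>y. F (xb, y)) \<in> borel_measurable borel"
      using section_measurable[OF Fm that] by simp
    have "range (\<lambda>y. F (xb, y)) \<subseteq> F ` space MR"
      using that by (auto simp: space_pair_measure)
    with simple_functionD(1)[OF F] show "finite (range (\<lambda>y. F (xb, y)))"
      using finite_subset by blast
  qed
  have push: "(\<integral>\<^sup>+y. (if T (xb, y) < top then \<phi> (enn2real (T (xb, y))) else 0) \<partial>lborel) = (\<integral>\<^sup>+s. \<phi> s \<partial>pos_line)"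
    if "xb \<in> space M" "\<phi> \<in> borel_measurable borel" for xb and \<phi> :: "real \<Rightarrow> ennreal"
    unfolding T_def fst_conv snd_conv
    by (rule nn_integral_level_rank[OF Fsec(1)[OF that(1)] Fsec(2)[OF that(1)] that(2)])
  \<comment> \<open>\<open>H\<close> is finite almost everywhere, so \<open>h\<close> represents it.\<close>
  have "AE xb in M. AE y in lborel. H (xb, y) < top"
    using AE_W_finite AE_space
  proof eventually_elim
    case (elim xb)
    have [measurable]: "w xb \<in> borel_measurable borel" by (rule w_section[OF elim(2)])
    have [measurable]: "(\<lambda>y. H (xb, y)) \<in> borel_measurable lborel"
      by (rule section_measurable[OF H elim(2)])
    let ?\<phi> = "\<lambda>s. if w xb s = top then 1 else 0 :: ennreal"
    have "(\<integral>\<^sup>+y. (if H (xb, y) = top then 1 else 0) \<partial>lborel) = (\<integral>\<^sup>+y. (if T (xb, y) < top then ?\<phi> (enn2real (T (xb, y))) else 0) \<partial>lborel)"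
      by (intro nn_integral_cong) (auto simp: H_def)
    also have "\<dots> = (\<integral>\<^sup>+s. ?\<phi> s \<partial>pos_line)"
      by (intro push elim) measurable
    also have "\<dots> = (\<integral>\<^sup>+s. 0 \<partial>pos_line)"
    proof (rule nn_integral_cong_AE)
      show "AE s in pos_line. ?\<phi> s = 0"
        using w_finite_of_W_finite[OF elim(2,1)] by eventually_elim auto
    qed
    finally have "(\<integral>\<^sup>+y. (if H (xb, y) = top then 1 else 0 :: ennreal) \<partial>lborel) = 0" by simp
    then have "AE y in lborel. (if H (xb, y) = top then 1 else 0 :: ennreal) = 0"
      by (subst (asm) nn_integral_0_iff_AE) measurable
    then show ?case by eventually_elim (auto simp: less_top split: if_splits)
  qed
  then have Hfin: "AE z in MR. H z < top"
    by (intro AE_pairI sigma_finite_lborel) measurable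
  have hH: "borel_version h H"
    unfolding borel_version_def
  proof
    show "AE x in MR. ennreal \<bar>h x\<bar> = H x"
      using Hfin by eventually_elim (simp add: h_def)
  qed fact
  \<comment> \<open>The sections of \<open>H\<close> are equimeasurable with those of \<open>w\<close>.\<close>
  have "AE xb in M. AE s in pos_line. rearr lborel (\<lambda>y. H (xb, y)) (ennreal s) = w xb s"
    using dec[unfolded w_decreasing_def] AE_space
  proof eventually_elim
    case (elim xb)
    have wb[measurable]: "w xb \<in> borel_measurable borel" by (rule w_section[OF elim(2)])
    have wp: "w xb \<in> borel_measurable pos_line" by (rule borel_measurable_pos_line[OF wb])
    have Hs[measurable]: "(\<lambda>y. H (xb, y)) \<in> borel_measurable lborel"
      by (rule section_measurable[OF H elim(2)])
    have "distrib lborel (\<lambda>y. H (xb, y)) t = distrib pos_line (w xb) t" for t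
    proof -
      let ?\<phi> = "\<lambda>s. if t < w xb s then 1 else 0 :: ennreal"
      have "distrib lborel (\<lambda>y. H (xb, y)) t = (\<integral>\<^sup>+y. indicator {y \<in> space lborel. t < H (xb, y)} y \<partial>lborel)"
        unfolding distrib_def by (intro nn_integral_indicator[symmetric]) measurable
      also have "\<dots> = (\<integral>\<^sup>+y. (if T (xb, y) < top then ?\<phi> (enn2real (T (xb, y))) else 0) \<partial>lborel)"
        by (intro nn_integral_cong) (auto simp: H_def indicator_def)
      also have "\<dots> = (\<integral>\<^sup>+s. ?\<phi> s \<partial>pos_line)"
        by (intro push elim) measurable
      also have "\<dots> = (\<integral>\<^sup>+s. indicator {s \<in> space pos_line. t < w xb s} s \<partial>pos_line)"
        by (intro nn_integral_cong) (auto simp: indicator_def)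
      also have "\<dots> = distrib pos_line (w xb) t"
        unfolding distrib_def using wp by (intro nn_integral_indicator) measurable
      finally show ?thesis .
    qed
    then have eq: "rearr lborel (\<lambda>y. H (xb, y)) s = rearr pos_line (w xb) s" for s
      by (simp add: rearr_def)
    obtain g where g: "antimono_on {0<..} g" "AE s in pos_line. w xb s = g s"
      using elim(1) by blast
    show ?case unfolding eq by (rule rearr_pos_line_antimono[OF wp g])
  qed
  then have "AE z in MS. rearr lborel (\<lambda>y. H (fst z, y)) (ennreal (snd z)) = w (fst z) (snd z)"
  proof (intro AE_pairI sigma_finite_pos_line)
    have sp: "snd \<in> borel_measurable MS"
      using measurable_compose[OF measurable_snd measurable_id_pos_line] by simp
    have "(\<lambda>z. rearr lborel (\<lambda>y. H (fst z, y)) (ennreal (snd z))) \<in> borel_measurable MS"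
      by (rule measurable_rearr_sections[OF H]) (use sp in auto)
    moreover have "(\<lambda>z. w (fst z) (snd z)) \<in> borel_measurable MS"
      using w_measurable_pos by (simp add: case_prod_unfold)
    ultimately show "Measurable.pred MS (\<lambda>z. rearr lborel (\<lambda>y. H (fst z, y)) (ennreal (snd z)) = w (fst z) (snd z))"
      unfolding pred_def by (rule borel_measurable_eq)
  qed simp
  then have "AE z in MS. steiner_rearr_half h (fst z) (snd z) = weight_bar v (fst z) (snd z)"
    using AE_weight_bar AE_fst[OF sigma_finite_pos_line AE_good_section[OF hH]]
    by eventually_elim (simp add: steiner_rearr_half_good_section)
  then have "h \<in> admissible"
    using hm unfolding admissible_def half_eq AE_completion_iff by (simp add: case_prod_unfold)
  moreover have "half_integral F \<le> (\<integral>\<^sup>+xb. (\<integral>\<^sup>+y. F (xb, y) * H (xb, y) \<partial>lborel) \<partial>M)"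
    unfolding half_integral_def
  proof (intro nn_integral_mono)
    fix xb assume xb: "xb \<in> space M"
    have wb[measurable]: "w xb \<in> borel_measurable borel" by (rule w_section[OF xb])
    let ?\<phi> = "\<lambda>s. rearr lborel (\<lambda>y. F (xb, y)) (ennreal s) * w xb s"
    have [measurable]: "(\<lambda>s. rearr lborel (\<lambda>y. F (xb, y)) (ennreal s)) \<in> borel_measurable (borel :: real measure)"
      by (rule measurable_rearr_sections) (use xb in auto)
    have "(\<integral>\<^sup>+s. ?\<phi> s \<partial>pos_line) = (\<integral>\<^sup>+y. (if T (xb, y) < top then ?\<phi> (enn2real (T (xb, y))) else 0) \<partial>lborel)"
      by (intro push[symmetric] xb) measurable
    also have "\<dots> \<le> (\<integral>\<^sup>+y. F (xb, y) * H (xb, y) \<partial>lborel)"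
      using rearr_level_rank_le[OF Fsec(1)[OF xb]] 
      by (intro nn_integral_mono) (auto simp: H_def T_def intro!: mult_right_mono)
    finally show "(\<integral>\<^sup>+s. ?\<phi> s \<partial>pos_line) \<le> (\<integral>\<^sup>+y. F (xb, y) * H (xb, y) \<partial>lborel)" .
  qed
  ultimately show ?thesis using that hH by blast
qed

text \<open>
  The lower bound is proved for simple functions below \<open>F\<close>, with a different \<open>h\<close> for each of them,
  and passes to \<open>F\<close> by monotone convergence.
\<close>

theorem SUP_admissible_of_decreasing:
  assumes dec: w_decreasing and F: "borel_version f F"
  shows "(SUP h\<in>admissible. \<integral>\<^sup>+x. ennreal \<bar>f x * h x\<bar> \<partial>lebesgue_Rn n) = half_integral F"
proof (rule antisym)
  show "(SUP h\<in>admissible. \<integral>\<^sup>+x. ennreal \<bar>f x * h x\<bar> \<partial>lebesgue_Rn n) \<le> half_integral F"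
    by (intro SUP_least integral_admissible_le F)
  have "F \<in> borel_measurable MR" using F by (simp add: borel_version_def)
  then obtain G where G: "incseq G" "\<And>i. simple_function MR (G i)" "F = (SUP i. G i)"
    using borel_measurable_implies_simple_function_sequence'[of F "MR"]
    by (metis ext SUP_apply)
  have F_SUP: "F = (\<lambda>z. SUP i. G i z)" unfolding G(3) by (rule ext) (rule SUP_apply)
  have "half_integral F = (SUP i. half_integral (G i))"
    unfolding F_SUP using G by (intro half_integral_SUP borel_measurable_simple_function)
  also have "\<dots> \<le> (SUP h\<in>admissible. \<integral>\<^sup>+x. ennreal \<bar>f x * h x\<bar> \<partial>lebesgue_Rn n)"
  proof (rule SUP_least)
    fix i
    obtain h H where h: "h \<in> admissible" "borel_version h H"
      and le: "half_integral (G i) \<le> (\<integral>\<^sup>+xb. (\<integral>\<^sup>+y. G i (xb, y) * H (xb, y) \<partial>lborel) \<partial>M)"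
      using ex_admissible_for_simple[OF dec G(2)[of i]] by blast
    note le
    also have "(\<integral>\<^sup>+xb. (\<integral>\<^sup>+y. G i (xb, y) * H (xb, y) \<partial>lborel) \<partial>M) \<le> (\<integral>\<^sup>+xb. (\<integral>\<^sup>+y. F (xb, y) * H (xb, y) \<partial>lborel) \<partial>M)"
      unfolding F_SUP by (intro nn_integral_mono mult_right_mono SUP_upper) auto
    also have "\<dots> = (\<integral>\<^sup>+x. ennreal \<bar>f x * h x\<bar> \<partial>lebesgue_Rn n)"
      by (rule integral_product_versions[OF F h(2), symmetric])
    also have "\<dots> \<le> (SUP h\<in>admissible. \<integral>\<^sup>+x. ennreal \<bar>f x * h x\<bar> \<partial>lebesgue_Rn n)"
      using h(1) by (rule SUP_upper)
    finally show "half_integral (G i) \<le> (SUP h\<in>admissible. \<integral>\<^sup>+x. ennreal \<bar>f x * h x\<bar> \<partial>lebesgue_Rn n)" .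
  qed
  finally show "half_integral F \<le> (SUP h\<in>admissible. \<integral>\<^sup>+x. ennreal \<bar>f x * h x\<bar> \<partial>lebesgue_Rn n)" .
qed

end

section \<open>Functions whose integrals over shifted intervals decrease\<close>

text \<open>
  The assumption says that the integral over \<open>[b, b + h)\<close> is at most the integral over \<open>[a, a + h)\<close>,
  for rational data: only countably many exceptional null sets can be discarded in the application.
  Exhausting intervals from inside extends it to real data. Then the averages \<open>G n s\<close> over
  \<open>[s, s + 2\<^sup>-\<^sup>n)\<close> decrease in \<open>s\<close>. They increase in \<open>n\<close>, as the right half of an interval contributes at
  most as much as the left half. Their supremum \<open>g\<close> is decreasing, and by monotone convergence it has
  the same integral as \<open>\<omega>\<close> over every interval \<open>[0, y)\<close>.
\<close>

lemma antimono_of_shift_inequality: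
  fixes \<omega> :: "real \<Rightarrow> ennreal"
  assumes \<omega>[measurable]: "\<omega> \<in> borel_measurable borel"
    and fin: "\<And>a. (\<integral>\<^sup>+s. indicator {..<a} s * \<omega> s \<partial>pos_line) < \<infinity>"
    and shift: "\<And>a b h. a \<in> \<rat> \<Longrightarrow> b \<in> \<rat> \<Longrightarrow> h \<in> \<rat> \<Longrightarrow> 0 \<le> a \<Longrightarrow> a \<le> b \<Longrightarrow> 0 \<le> h \<Longrightarrow>
      (\<integral>\<^sup>+s. indicator {..<b + h} s * \<omega> s \<partial>pos_line) + (\<integral>\<^sup>+s. indicator {..<a} s * \<omega> s \<partial>pos_line)
        \<le> (\<integral>\<^sup>+s. indicator {..<a + h} s * \<omega> s \<partial>pos_line) + (\<integral>\<^sup>+s. indicator {..<b} s * \<omega> s \<partial>pos_line)"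
  shows "\<exists>g. antimono_on {0<..} g \<and> (AE s in pos_line. \<omega> s = g s)"
proof -
  note [measurable del] = measurable_id_pos_line
  define \<omega>' where "\<omega>' s = indicator {0<..} s * \<omega> s" for s
  have [measurable]: "\<omega>' \<in> borel_measurable borel" unfolding \<omega>'_def by measurable
  define U where "U a = (\<integral>\<^sup>+s. indicator {..<a} s * \<omega>' s \<partial>lborel)" for a
  define I where "I x y = (\<integral>\<^sup>+s. indicator {x..<y} s * \<omega>' s \<partial>lborel)" for x y
  have U_eq: "(\<integral>\<^sup>+s. indicator {..<a} s * \<omega> s \<partial>pos_line) = U a" for a
    unfolding U_def \<omega>'_def
    by (subst nn_integral_restrict_space) (auto intro!: nn_integral_cong simp: indicator_def)
  have U_fin: "U a < \<infinity>" for a using fin[of a] by (simp add: U_eq)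
  have U_I: "U y = U x + I x y" if "x \<le> y" for x y
  proof -
    have "U y = (\<integral>\<^sup>+s. indicator {..<x} s * \<omega>' s + indicator {x..<y} s * \<omega>' s \<partial>lborel)"
      unfolding U_def using that by (intro nn_integral_cong) (auto simp: indicator_def)
    also have "\<dots> = U x + I x y"
      unfolding U_def I_def by (intro nn_integral_add) measurable
    finally show ?thesis .
  qed
  have I_mono: "I x y \<le> I x' y'" if "x' \<le> x" "y \<le> y'" for x y x' y'
    unfolding I_def using that by (intro nn_integral_mono mult_right_mono) (auto simp: indicator_def)
  have I_add: "I x z = I x y + I y z" if "x \<le> y" "y \<le> z" for x y z
  proof -
    have "I x z = (\<integral>\<^sup>+s. indicator {x..<y} s * \<omega>' s + indicator {y..<z} s * \<omega>' s \<partial>lborel)"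
      unfolding I_def using that by (intro nn_integral_cong) (auto simp: indicator_def)
    also have "\<dots> = I x y + I y z"
      unfolding I_def by (intro nn_integral_add) measurable
    finally show ?thesis .
  qed
  have I_rat: "I b (b + h) \<le> I a (a + h)"
    if "a \<in> \<rat>" "b \<in> \<rat>" "h \<in> \<rat>" "0 \<le> a" "a \<le> b" "0 \<le> h" for a b h
  proof -
    have "U a + U b + I b (b + h) \<le> U a + U b + I a (a + h)"
      using shift[OF that, unfolded U_eq] U_I[of b "b + h"] U_I[of a "a + h"] \<open>0 \<le> h\<close>
      by (simp add: add_ac)
    moreover have "U a + U b \<noteq> top" using U_fin[of a] U_fin[of b] by (auto simp: less_top)
    ultimately show ?thesis by (simp add: ennreal_add_left_cancel_le)
  qed
  \<comment> \<open>Exhaustion of an interval from inside.\<close>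
  have I_SUP: "I x y = (SUP n. I (x + 1 / 2 ^ n) (y - 1 / 2 ^ n))" for x y
  proof -
    have dec: "1 / 2 ^ m \<le> (1 / 2 ^ n :: real)" if "n \<le> m" for n m
      using that by (intro divide_left_mono power_increasing) auto
    have "I x y = (\<integral>\<^sup>+s. indicator {x<..<y} s * \<omega>' s \<partial>lborel)"
      unfolding I_def
    proof (rule nn_integral_cong_AE)
      show "AE s in lborel. indicator {x..<y} s * \<omega>' s = indicator {x<..<y} s * \<omega>' s"
        using AE_lborel_singleton[of x] by eventually_elim (auto simp: indicator_def)
    qed
    also have "\<dots> = (\<integral>\<^sup>+s. (SUP n. indicator {x + 1 / 2 ^ n..<y - 1 / 2 ^ n} s * \<omega>' s) \<partial>lborel)"
    proof (rule nn_integral_cong)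
      fix s :: real
      have "(SUP n. indicator {x + 1 / 2 ^ n..<y - 1 / 2 ^ n} s :: ennreal) = indicator {x<..<y} s"
      proof (cases "s \<in> {x<..<y}")
        case True
        then have "0 < min (s - x) (y - s)" by simp
        then obtain n where n: "(1 / 2) ^ n < min (s - x) (y - s)"
          using real_arch_pow_inv[of "min (s - x) (y - s)" "1/2"] by auto
        have "(1 / 2 :: real) ^ n = 1 / 2 ^ n" by (rule power_one_over)
        then have "s \<in> {x + 1 / 2 ^ n..<y - 1 / 2 ^ n}"
          using n unfolding atLeastLessThan_iff by linarith
        then have "(1 :: ennreal) = indicator {x + 1 / 2 ^ n..<y - 1 / 2 ^ n} s" by (simp only: indicator_simps)
        also have "\<dots> \<le> (SUP n. indicator {x + 1 / 2 ^ n..<y - 1 / 2 ^ n} s)" by (rule SUP_upper) (rule UNIV_I)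
        finally have "1 \<le> (SUP n. indicator {x + 1 / 2 ^ n..<y - 1 / 2 ^ n} s :: ennreal)" .
        moreover have "(SUP n. indicator {x + 1 / 2 ^ n..<y - 1 / 2 ^ n} s :: ennreal) \<le> 1"
          by (intro SUP_least) (simp add: indicator_def)
        ultimately have "(SUP n. indicator {x + 1 / 2 ^ n..<y - 1 / 2 ^ n} s :: ennreal) = 1" by (intro antisym)
        moreover have "(1 :: ennreal) = indicator {x<..<y} s" using True by (simp only: indicator_simps)
        ultimately show ?thesis by (rule trans)
      next
        case False
        have "s \<notin> {x + 1 / 2 ^ n..<y - 1 / 2 ^ n}" for n
        proof
          assume "s \<in> {x + 1 / 2 ^ n..<y - 1 / 2 ^ n}"
          then have "x + 1 / 2 ^ n \<le> s" "s < y - 1 / 2 ^ n" by (simp_all only: atLeastLessThan_iff)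
          moreover have "0 < (1 / 2 ^ n :: real)" by simp
          ultimately have "x < s" "s < y" by linarith+
          with False show False by simp
        qed
        with False show ?thesis by simp
      qed
      then show "indicator {x<..<y} s * \<omega>' s = (SUP n. indicator {x + 1 / 2 ^ n..<y - 1 / 2 ^ n} s * \<omega>' s)"
        by (simp only: SUP_mult_right_ennreal[symmetric])
    qed
    also have "\<dots> = (SUP n. I (x + 1 / 2 ^ n) (y - 1 / 2 ^ n))"
      unfolding I_def
    proof (intro nn_integral_monotone_convergence_SUP)
      show "incseq (\<lambda>n s. indicator {x + 1 / 2 ^ n..<y - 1 / 2 ^ n} s * \<omega>' s)"
        unfolding incseq_def le_fun_def
      proof (intro allI impI mult_right_mono)
        fix m n :: nat and s :: real assume "m \<le> n"
        from dec[OF this] show "indicator {x + 1 / 2 ^ m..<y - 1 / 2 ^ m} s \<le> (indicator {x + 1 / 2 ^ n..<y - 1 / 2 ^ n} s :: ennreal)"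
          by (auto simp: indicator_def)
      qed simp
    qed measurable
    finally show ?thesis .
  qed
  have I_shift: "I b (b + h) \<le> I a (a + h)" if ab: "0 \<le> a" "a \<le> b" and h: "0 < h" for a b h
  proof (cases "a = b")
    case False
    with ab have ab': "a < b" by simp
    show ?thesis
      unfolding I_SUP[of b "b + h"]
    proof (rule SUP_least)
      fix n :: nat
      let ?e = "1 / 2 ^ n :: real"
      have e: "0 < ?e" by simp
      have "b < b + min ?e h" using e h by linarith
      from Rats_dense_in_real[OF this] obtain b' where b': "b' \<in> \<rat>" "b < b'" "b' < b + min ?e h"
        by blast
      have "max 0 (b + h - ?e - b') < b + h - b'" using e b' by linarith
      from Rats_dense_in_real[OF this] obtain h' where h': "h' \<in> \<rat>" "max 0 (b + h - ?e - b') < h'" "h' < b + h - b'"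
        by blast
      have "a < min (a + h - h') b'" using b' h' ab' by linarith
      from Rats_dense_in_real[OF this] obtain a' where a': "a' \<in> \<rat>" "a < a'" "a' < min (a + h - h') b'"
        by blast
      have "I (b + ?e) (b + h - ?e) \<le> I b' (b' + h')" using b' h' by (intro I_mono) linarith+
      also have "\<dots> \<le> I a' (a' + h')"
      proof (rule I_rat)
        show "0 \<le> a'" "a' \<le> b'" "0 \<le> h'" using a' h' ab by linarith+
      qed (use a' b' h' in simp_all)
      also have "\<dots> \<le> I a (a + h)" using a' h' by (intro I_mono) linarith+
      finally show "I (b + ?e) (b + h - ?e) \<le> I a (a + h)" .
    qed
  qed simp
  define G where "G n s = ennreal (2 ^ n) * I s (s + 1 / 2 ^ n)" for n s
  define g where "g s = (SUP n. G n s)" for s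
  have G_anti: "G n b \<le> G n a" if "0 \<le> a" "a \<le> b" for n a b
    unfolding G_def using that by (intro mult_left_mono I_shift) auto
  have g_anti: "antimono_on {0<..} g"
    unfolding monotone_on_def g_def
  proof (intro ballI impI SUP_mono bexI[of _ i for i])
    fix x y :: real and n :: nat assume "x \<in> {0<..}" "y \<in> {0<..}" "x \<le> y"
    then show "G n y \<le> G n x" by (intro G_anti) auto
  qed simp
  have G_Suc: "G n s \<le> G (Suc n) s" if "0 \<le> s" for n s
  proof -
    let ?h = "1 / 2 ^ Suc n :: real"
    have "1 / 2 ^ n = 2 * ?h" by simp
    then have two: "s + 1 / 2 ^ n = (s + ?h) + ?h" by linarith
    have "I s (s + 1 / 2 ^ n) = I s (s + ?h) + I (s + ?h) ((s + ?h) + ?h)"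
      unfolding two
    proof (rule I_add)
      have "0 < ?h" by simp
      then show "s \<le> s + ?h" "s + ?h \<le> s + ?h + ?h" by linarith+
    qed
    also have "\<dots> \<le> I s (s + ?h) + I s (s + ?h)"
    proof (rule add_left_mono[OF I_shift])
      show "0 < ?h" by simp
      then show "s \<le> s + ?h" by linarith
    qed (rule that)
    also have "\<dots> = 2 * I s (s + ?h)" by (rule mult_2[symmetric])
    finally have "G n s \<le> ennreal (2 ^ n) * (2 * I s (s + ?h))"
      unfolding G_def by (rule mult_left_mono) simp
    also have "\<dots> = G (Suc n) s"
    proof -
      have "ennreal (2 ^ Suc n) = ennreal (2 ^ n) * ennreal 2"
        by (subst ennreal_mult[symmetric]) (simp_all add: mult.commute)
      then have "ennreal (2 ^ Suc n) = ennreal (2 ^ n) * 2" by simp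
      then show ?thesis by (simp only: G_def mult.assoc)
    qed
    finally show ?thesis .
  qed
  have Gm[measurable]: "G n \<in> borel_measurable borel" for n
  proof -
    have "(\<lambda>s. \<integral>\<^sup>+t. (if s \<le> t \<and> t < s + 1 / 2 ^ n then 1 else 0) * \<omega>' t \<partial>lborel) \<in> borel_measurable borel"
      by measurable
    also have "(\<lambda>s. \<integral>\<^sup>+t. (if s \<le> t \<and> t < s + 1 / 2 ^ n then 1 else 0) * \<omega>' t \<partial>lborel) = (\<lambda>s. I s (s + 1 / 2 ^ n))"
      unfolding I_def by (intro ext nn_integral_cong) (auto simp: indicator_def)
    finally show ?thesis unfolding G_def by measurable
  qed
  have gm[measurable]: "g \<in> borel_measurable borel" unfolding g_def by measurable
  have I_trans: "I (x + c) (y + c) = (\<integral>\<^sup>+s. indicator {x..<y} s * \<omega>' (s + c) \<partial>lborel)" for x y c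
  proof -
    have "I (x + c) (y + c) = (\<integral>\<^sup>+s. indicator {x + c..<y + c} (c + 1 * s) * \<omega>' (c + 1 * s) \<partial>lborel)"
      unfolding I_def by (subst nn_integral_real_affine[where c=1 and t=c]) auto
    also have "\<dots> = (\<integral>\<^sup>+s. indicator {x..<y} s * \<omega>' (s + c) \<partial>lborel)"
      by (intro nn_integral_cong) (auto simp: indicator_def add.commute)
    finally show ?thesis .
  qed
  \<comment> \<open>Averaging over \<open>[x,y)\<close> is averaging the integrals over the shifted intervals \<open>[x + c, y + c)\<close>.\<close>
  have G_int: "(\<integral>\<^sup>+s. indicator {x..<y} s * G n s \<partial>lborel) = ennreal (2 ^ n) * (\<integral>\<^sup>+c. indicator {0..<1 / 2 ^ n} c * I (x + c) (y + c) \<partial>lborel)" for n x y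
  proof -
    have "(\<integral>\<^sup>+s. indicator {x..<y} s * G n s \<partial>lborel)
      = (\<integral>\<^sup>+s. ennreal (2 ^ n) * (\<integral>\<^sup>+c. indicator {x..<y} s * (indicator {0..<1 / 2 ^ n} c * \<omega>' (s + c)) \<partial>lborel) \<partial>lborel)"
    proof (rule nn_integral_cong)
      fix s :: real
      have "I s (s + 1 / 2 ^ n) = (\<integral>\<^sup>+c. indicator {0..<1 / 2 ^ n} c * \<omega>' (s + c) \<partial>lborel)"
        using I_trans[of 0 s "1 / 2 ^ n"] by (simp add: add.commute)
      then show "indicator {x..<y} s * G n s = ennreal (2 ^ n) * (\<integral>\<^sup>+c. indicator {x..<y} s * (indicator {0..<1 / 2 ^ n} c * \<omega>' (s + c)) \<partial>lborel)"
        by (auto simp: G_def indicator_def)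
    qed
    also have "\<dots> = ennreal (2 ^ n) * (\<integral>\<^sup>+s. (\<integral>\<^sup>+c. indicator {x..<y} s * (indicator {0..<1 / 2 ^ n} c * \<omega>' (s + c)) \<partial>lborel) \<partial>lborel)"
      by (intro nn_integral_cmult) measurable
    also have "(\<integral>\<^sup>+s. (\<integral>\<^sup>+c. indicator {x..<y} s * (indicator {0..<1 / 2 ^ n} c * \<omega>' (s + c)) \<partial>lborel) \<partial>lborel)
      = (\<integral>\<^sup>+c. (\<integral>\<^sup>+s. indicator {x..<y} s * (indicator {0..<1 / 2 ^ n} c * \<omega>' (s + c)) \<partial>lborel) \<partial>lborel)"
      by (intro lborel_pair.Fubini') measurable
    also have "\<dots> = (\<integral>\<^sup>+c. indicator {0..<1 / 2 ^ n} c * I (x + c) (y + c) \<partial>lborel)"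
      by (intro nn_integral_cong) (auto simp: I_trans indicator_def)
    finally show ?thesis .
  qed
  have const: "ennreal (2 ^ n) * (\<integral>\<^sup>+c. indicator {0..<1 / 2 ^ n :: real} c * K \<partial>lborel) = K" for n K
  proof -
    have "(\<integral>\<^sup>+c. indicator {0..<1 / 2 ^ n :: real} c * K \<partial>lborel) = ennreal (1 / 2 ^ n) * K"
      by (subst nn_integral_multc) auto
    then show ?thesis by (simp add: mult.assoc[symmetric] ennreal_mult[symmetric])
  qed
  have g_int: "(\<integral>\<^sup>+s. indicator {0..<y} s * g s \<partial>lborel) = I 0 y" if "0 < y" for y
  proof -
    have "(\<integral>\<^sup>+s. indicator {0..<y} s * g s \<partial>lborel) = (\<integral>\<^sup>+s. (SUP n. indicator {0..<y} s * G n s) \<partial>lborel)"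
      unfolding g_def by (simp add: SUP_mult_left_ennreal)
    also have "\<dots> = (SUP n. \<integral>\<^sup>+s. indicator {0..<y} s * G n s \<partial>lborel)"
    proof (intro nn_integral_monotone_convergence_SUP)
      show "incseq (\<lambda>n s. indicator {0..<y} s * G n s)"
        by (intro incseq_SucI le_funI) (auto simp: indicator_def G_Suc)
    qed measurable
    also have "\<dots> = I 0 y"
    proof (rule antisym)
      show "(SUP n. \<integral>\<^sup>+s. indicator {0..<y} s * G n s \<partial>lborel) \<le> I 0 y"
      proof (rule SUP_least)
        fix n
        have "(\<integral>\<^sup>+c. indicator {0..<1 / 2 ^ n} c * I (0 + c) (y + c) \<partial>lborel) \<le> (\<integral>\<^sup>+c. indicator {0..<1 / 2 ^ n :: real} c * I 0 y \<partial>lborel)"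
        proof (rule nn_integral_mono)
          fix c :: real
          show "indicator {0..<1 / 2 ^ n} c * I (0 + c) (y + c) \<le> indicator {0..<1 / 2 ^ n} c * I 0 y"
            using I_shift[of 0 c y] that by (auto simp: indicator_def add.commute)
        qed
        then have "(\<integral>\<^sup>+s. indicator {0..<y} s * G n s \<partial>lborel) \<le> ennreal (2 ^ n) * (\<integral>\<^sup>+c. indicator {0..<1 / 2 ^ n :: real} c * I 0 y \<partial>lborel)"
          unfolding G_int by (intro mult_left_mono) auto
        then show "(\<integral>\<^sup>+s. indicator {0..<y} s * G n s \<partial>lborel) \<le> I 0 y" by (simp only: const)
      qed
      \<comment> \<open>For shifts below \<open>2\<^sup>-\<^sup>n\<close>, the shifted interval contains \<open>[2\<^sup>-\<^sup>n, y - 2\<^sup>-\<^sup>n)\<close>.\<close>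
      show "I 0 y \<le> (SUP n. \<integral>\<^sup>+s. indicator {0..<y} s * G n s \<partial>lborel)"
        unfolding I_SUP[of 0 y]
      proof (rule SUP_mono)
        fix n
        let ?J = "I (0 + 1 / 2 ^ n) (y - 1 / 2 ^ n)"
        have "(\<integral>\<^sup>+c. indicator {0..<1 / 2 ^ n :: real} c * ?J \<partial>lborel) \<le> (\<integral>\<^sup>+c. indicator {0..<1 / 2 ^ n} c * I (0 + c) (y + c) \<partial>lborel)"
        proof (rule nn_integral_mono)
          fix c :: real
          have "0 < (1 / 2 ^ n :: real)" by simp
          then show "indicator {0..<1 / 2 ^ n} c * ?J \<le> indicator {0..<1 / 2 ^ n} c * I (0 + c) (y + c)"
            using I_mono[of "0 + c" "0 + 1 / 2 ^ n" "y - 1 / 2 ^ n" "y + c"] by (auto simp: indicator_def simp del: zero_less_divide_iff)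
        qed
        then have "ennreal (2 ^ n) * (\<integral>\<^sup>+c. indicator {0..<1 / 2 ^ n :: real} c * ?J \<partial>lborel) \<le> (\<integral>\<^sup>+s. indicator {0..<y} s * G n s \<partial>lborel)"
          unfolding G_int by (intro mult_left_mono) auto
        then have "?J \<le> (\<integral>\<^sup>+s. indicator {0..<y} s * G n s \<partial>lborel)" by (simp only: const)
        then show "\<exists>m\<in>UNIV. ?J \<le> (\<integral>\<^sup>+s. indicator {0..<y} s * G m s \<partial>lborel)" by blast
      qed
    qed
    finally show ?thesis .
  qed
  define g' where "g' s = indicator {0..} s * g s" for s
  have [measurable]: "g' \<in> borel_measurable borel" unfolding g'_def by measurable
  have "density lborel \<omega>' = density lborel g'"
  proof (rule borel_measure_eqI_lessThan)
    fix y :: real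
    have 1: "emeasure (density lborel \<omega>') {..<y} = U y"
      unfolding U_def by (subst emeasure_density) (auto simp: mult.commute)
    have 2: "emeasure (density lborel g') {..<y} = (\<integral>\<^sup>+s. indicator {0..<y} s * g s \<partial>lborel)"
      unfolding g'_def by (subst emeasure_density) (auto intro!: nn_integral_cong simp: indicator_def)
    show "emeasure (density lborel \<omega>') {..<y} < \<infinity>" using U_fin[of y] by (simp add: 1)
    have U0: "U y = I 0 y"
      unfolding U_def I_def by (intro nn_integral_cong) (auto simp: \<omega>'_def indicator_def)
    show "emeasure (density lborel \<omega>') {..<y} = emeasure (density lborel g') {..<y}"
    proof (cases "0 < y")
      case True
      then show ?thesis unfolding 1 2 by (simp add: g_int U0)
    next
      case False
      then show ?thesis unfolding 1 2 by (simp add: U0 I_def)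
    qed
  qed simp_all
  then have "AE s in lborel. \<omega>' s = g' s"
    by (intro sigma_finite_measure.density_unique[OF sigma_finite_lborel]) auto
  then have "AE s in pos_line. \<omega> s = g s"
    unfolding AE_pos_line_iff by eventually_elim (auto simp: \<omega>'_def g'_def)
  with g_anti show ?thesis by blast
qed

section \<open>Powers and step functions\<close>

lemma steiner_empty: "steiner n {} = {}"
  by (auto simp: steiner_def mem_ball_of_measure)

lemma nn_integral_interval_pos_line:
  assumes "0 \<le> a" "a \<le> b"
  shows "(\<integral>\<^sup>+t. indicator {a..<b} t \<partial>pos_line) = ennreal (b - a)"
proof -
  have "(\<integral>\<^sup>+t. indicator {a..<b} t \<partial>pos_line) = (\<integral>\<^sup>+t. indicator {a..<b} t * indicator {0<..} t \<partial>lborel)"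
    by (intro nn_integral_restrict_space) simp
  also have "\<dots> = (\<integral>\<^sup>+t. indicator {a..<b} t \<partial>lborel)"
  proof (rule nn_integral_cong_AE)
    show "AE t in lborel. indicator {a..<b} t * indicator {0<..} t = (indicator {a..<b} t :: ennreal)"
      using AE_lborel_singleton[of "0::real"] by eventually_elim (use assms in \<open>auto simp: indicator_def\<close>)
  qed
  also have "\<dots> = ennreal (b - a)" using assms by simp
  finally show ?thesis .
qed

text \<open>
  A Galois connection again, which is what commuting powers with rearrangement needs.
\<close>

lemma ennreal_powr_less_iff:
  assumes "0 < p"
  shows "ennreal_powr t (1 / p) < x \<longleftrightarrow> t < ennreal_powr x p"
proof (cases t)
  case (real a)
  show ?thesis
  proof (cases x)
    case (real b)
    have "a powr (1 / p) < b \<longleftrightarrow> a < b powr p"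
    proof
      assume "a powr (1 / p) < b"
      then have "(a powr (1 / p)) powr p < b powr p"
        using assms by (intro powr_less_mono2) auto
      then show "a < b powr p" using assms \<open>0 \<le> a\<close> by (simp add: powr_powr)
    next
      assume "a < b powr p"
      then have "a powr (1 / p) < (b powr p) powr (1 / p)"
        using assms \<open>0 \<le> a\<close> by (intro powr_less_mono2) auto
      then show "a powr (1 / p) < b" using assms \<open>0 \<le> b\<close> by (simp add: powr_powr)
    qed
    with real \<open>t = ennreal a\<close> \<open>0 \<le> a\<close> show ?thesis by (simp add: ennreal_powr_def ennreal_less_iff)
  next
    case top
    with real show ?thesis by (simp add: ennreal_powr_def)
  qed
next
  case top
  then show ?thesis by (simp add: ennreal_powr_def)
qed

lemma ennreal_powr_inverse: "0 < p \<Longrightarrow> ennreal_powr (ennreal_powr x p) (1 / p) = x"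
  by (cases x) (auto simp: ennreal_powr_def powr_powr)

lemma ennreal_powr_inverse': "0 < p \<Longrightarrow> ennreal_powr (ennreal_powr x (1 / p)) p = x"
  using ennreal_powr_inverse[of "1 / p" x] by simp

lemma ennreal_powr_ennreal: "0 \<le> r \<Longrightarrow> ennreal_powr (ennreal r) a = ennreal (r powr a)"
  by (simp add: ennreal_powr_def)

lemma ennreal_powr_mono:
  assumes "0 < p" "x \<le> y"
  shows "ennreal_powr x p \<le> ennreal_powr y p"
  using assms ennreal_powr_less_iff[OF assms(1)] by (intro ennreal_leI_less) (meson less_le_trans)

lemma borel_measurable_ennreal_powr:
  assumes [measurable]: "F \<in> borel_measurable N"
  shows "(\<lambda>z. ennreal_powr (F z) p) \<in> borel_measurable N"
  unfolding ennreal_powr_def by measurable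

lemma rearr_powr:
  assumes p: "0 < p" and F: "F \<in> borel_measurable N"
  shows "rearr N (\<lambda>y. ennreal_powr (F y) p) s = ennreal_powr (rearr N F s) p"
proof (rule ennreal_eqI_less)
  fix t
  have "distrib N (\<lambda>y. ennreal_powr (F y) p) t = distrib N F (ennreal_powr t (1 / p))"
    unfolding distrib_def by (simp add: ennreal_powr_less_iff[OF p])
  then have "t < rearr N (\<lambda>y. ennreal_powr (F y) p) s \<longleftrightarrow> s < distrib N F (ennreal_powr t (1 / p))"
    using borel_measurable_ennreal_powr[OF F] by (simp add: less_rearr_iff)
  also have "\<dots> \<longleftrightarrow> ennreal_powr t (1 / p) < rearr N F s"
    using F by (simp add: less_rearr_iff)
  finally show "t < rearr N (\<lambda>y. ennreal_powr (F y) p) s \<longleftrightarrow> t < ennreal_powr (rearr N F s) p"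
    by (simp only: ennreal_powr_less_iff[OF p])
qed

context steiner_weight
begin

text \<open>
  The superlevel sets are \<open>B\<close> below the level \<open>\<beta>\<close>, \<open>A\<close> between \<open>\<beta>\<close> and \<open>\<alpha> + \<beta>\<close>, and empty above. On
  nested sets the symmetrization is therefore additive.
\<close>

lemma steiner_rearr_two_step:
  fixes A B :: "'k point set"
  assumes AB: "A \<subseteq> B" "B \<subseteq> space (lebesgue_Rn n)" and nonneg: "0 \<le> \<alpha>" "0 \<le> \<beta>"
  shows "steiner_rearr n (\<lambda>x. \<alpha> * indicator A x + \<beta> * indicator B x) x
    = ennreal \<alpha> * indicator (steiner n A) x + ennreal \<beta> * indicator (steiner n B) x"
proof -
  let ?f = "\<lambda>x. \<alpha> * indicator A x + \<beta> * indicator B x :: real"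
  have level: "{x \<in> space (lebesgue_Rn n). \<bar>?f x\<bar> > t} = (if t < \<beta> then B else if t < \<alpha> + \<beta> then A else {})" if "0 < t" for t
    using that AB nonneg by (auto simp: indicator_def split: if_splits)
  have "steiner_rearr n ?f x = (\<integral>\<^sup>+t. indicator (steiner n {x \<in> space (lebesgue_Rn n). \<bar>?f x\<bar> > t}) x \<partial>pos_line)"
    unfolding steiner_rearr_def by (rule nn_integral_restrict_space[symmetric]) simp
  also have "\<dots> = (\<integral>\<^sup>+t. indicator {\<beta>..<\<alpha> + \<beta>} t * indicator (steiner n A) x + indicator {0..<\<beta>} t * indicator (steiner n B) x \<partial>pos_line)"
  proof (rule nn_integral_cong)
    fix t assume "t \<in> space pos_line"
    then have "0 < t" by simp
    then show "indicator (steiner n {x \<in> space (lebesgue_Rn n). \<bar>?f x\<bar> > t}) x =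
      (indicator {\<beta>..<\<alpha> + \<beta>} t * indicator (steiner n A) x + indicator {0..<\<beta>} t * indicator (steiner n B) x :: ennreal)"
      unfolding level[OF \<open>0 < t\<close>] using nonneg by (simp add: indicator_def steiner_empty)
  qed
  also have "\<dots> = (\<integral>\<^sup>+t. indicator {\<beta>..<\<alpha> + \<beta>} t * indicator (steiner n A) x \<partial>pos_line) + (\<integral>\<^sup>+t. indicator {0..<\<beta>} t * indicator (steiner n B) x \<partial>pos_line)"
    by (intro nn_integral_add borel_measurable_pos_line) measurable
  also have "\<dots> = (\<integral>\<^sup>+t. indicator {\<beta>..<\<alpha> + \<beta>} t \<partial>pos_line) * indicator (steiner n A) x + (\<integral>\<^sup>+t. indicator {0..<\<beta>} t \<partial>pos_line) * indicator (steiner n B) x"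
    by (subst (1 2) nn_integral_multc) (auto intro!: borel_measurable_pos_line)
  also have "\<dots> = ennreal \<alpha> * indicator (steiner n A) x + ennreal \<beta> * indicator (steiner n B) x"
    using nonneg by (simp add: nn_integral_interval_pos_line)
  finally show ?thesis .
qed

lemma steiner_rearr_indicator:
  fixes A :: "'k point set"
  assumes "A \<subseteq> space (lebesgue_Rn n)"
  shows "steiner_rearr n (indicator A) x = indicator (steiner n A) x"
  using steiner_rearr_two_step[of A A 0 1 x] assms by simp

lemma steiner_sets:
  fixes A :: "'k point set"
  assumes A: "A \<in> sets (lebesgue_Rn n)"
  shows "steiner n A \<in> sets (lebesgue_Rn n)"
proof -
  have "A \<subseteq> space (lebesgue_Rn n)" using A by (rule sets.sets_into_space)
  from steiner_rearr_indicator[OF this]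
  have "steiner_rearr n (indicator A) = (indicator (steiner n A) :: _ \<Rightarrow> ennreal)" by (rule ext)
  moreover have "steiner_rearr n (indicator A) \<in> borel_measurable (lebesgue_Rn n)"
    using A by (intro measurable_steiner_rearr) simp
  ultimately have "(indicator (steiner n A) :: _ \<Rightarrow> ennreal) \<in> borel_measurable (lebesgue_Rn n)" by simp
  then have "(indicator (steiner n A) :: _ \<Rightarrow> ennreal) -` {1} \<inter> space (lebesgue_Rn n) \<in> sets (lebesgue_Rn n)"
    by (rule measurable_sets) simp
  also have "(indicator (steiner n A) :: _ \<Rightarrow> ennreal) -` {1} \<inter> space (lebesgue_Rn n) = steiner n A"
    by (auto simp: indicator_def steiner_def space_Rn M_eq split: if_splits)
  finally show ?thesis .
qed

definition V :: "'k point set \<Rightarrow> ennreal" where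
  "V A = weighted_vol n v (steiner n A)"

lemma v_measurable: "(\<lambda>x. ennreal (v x)) \<in> borel_measurable (lebesgue_Rn n)"
  using weight by (auto simp: weight_def locally_integrable_def)

lemma choquet_two_step:
  assumes A: "A \<in> sets (lebesgue_Rn n)" and B: "B \<in> sets (lebesgue_Rn n)" and "A \<subseteq> B" "0 \<le> \<alpha>" "0 \<le> \<beta>"
  shows "choquet (\<lambda>x. \<alpha> * indicator A x + \<beta> * indicator B x) = ennreal \<alpha> * V A + ennreal \<beta> * V B"
proof -
  note [measurable] = v_measurable steiner_sets[OF A] steiner_sets[OF B]
  have "choquet (\<lambda>x. \<alpha> * indicator A x + \<beta> * indicator B x)
    = (\<integral>\<^sup>+x. ennreal \<alpha> * (ennreal (v x) * indicator (steiner n A) x) + ennreal \<beta> * (ennreal (v x) * indicator (steiner n B) x) \<partial>lebesgue_Rn n)"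
    unfolding choquet_def
    using steiner_rearr_two_step[OF \<open>A \<subseteq> B\<close> sets.sets_into_space[OF B] \<open>0 \<le> \<alpha>\<close> \<open>0 \<le> \<beta>\<close>]
    by (intro nn_integral_cong) (simp add: algebra_simps)
  also have "\<dots> = ennreal \<alpha> * V A + ennreal \<beta> * V B"
    unfolding V_def weighted_vol_def
    by (subst nn_integral_add, measurable, measurable) (simp add: nn_integral_cmult)
  finally show ?thesis .
qed

lemma choquet_indicator: "A \<in> sets (lebesgue_Rn n) \<Longrightarrow> choquet (indicator A) = V A"
  using choquet_two_step[of A A 0 1] by simp

lemma choquet_mono:
  assumes f: "f \<in> borel_measurable (lebesgue_Rn n)" and g: "g \<in> borel_measurable (lebesgue_Rn n)"
    and le: "\<And>x. \<bar>f x\<bar> \<le> \<bar>g x\<bar>"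
  shows "choquet f \<le> choquet g"
proof -
  obtain F G where F: "borel_version f F" and G: "borel_version g G"
    using f g ex_borel_version by metis
  have "AE z in MR. steiner_rearr n f z \<le> steiner_rearr n g z"
    using AE_fst[OF sigma_finite_lborel AE_good_section[OF F]] AE_fst[OF sigma_finite_lborel AE_good_section[OF G]]
  proof eventually_elim
    case (elim z)
    have "rearr lborel (\<lambda>y. F (fst z, y)) s \<le> rearr lborel (\<lambda>y. G (fst z, y)) s" for s
    proof (rule rearr_mono)
      have "AE y in lborel. ennreal \<bar>f (fst z, y)\<bar> = F (fst z, y)" "AE y in lborel. ennreal \<bar>g (fst z, y)\<bar> = G (fst z, y)"
        using elim by (auto simp: good_section_def)
      then show "AE y in lborel. F (fst z, y) \<le> G (fst z, y)"
      proof eventually_elim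
        case (elim y)
        then show ?case using ennreal_leI[OF le[of "(fst z, y)"]] by simp
      qed
    qed (use elim in \<open>auto simp: good_section_def\<close>)
    then show ?case
      using steiner_rearr_good_section[OF elim(1), of "snd z"] steiner_rearr_good_section[OF elim(2), of "snd z"] by simp
  qed
  then have ae: "AE z in MR. steiner_rearr n f z * ennreal (v z) \<le> steiner_rearr n g z * ennreal (v z)"
    by eventually_elim (auto intro: mult_right_mono)
  then show ?thesis
    unfolding choquet_def Rn_eq nn_integral_completion by (rule nn_integral_mono_AE)
qed

end

section \<open>Consequences of duality\<close>

context steiner_weight
begin

text \<open>Statement (d), with the right-hand side in terms of \<open>choquet\<close> (see \<open>duality_iff\<close>).\<close>

definition duality :: bool where
  "duality \<longleftrightarrow> (\<forall>f\<in>borel_measurable (lebesgue_Rn n).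
     (SUP h\<in>admissible. \<integral>\<^sup>+x. ennreal \<bar>f x * h x\<bar> \<partial>lebesgue_Rn n) = c_polar * choquet f)"

lemma duality_of_decreasing: "w_decreasing \<Longrightarrow> duality"
  unfolding duality_def
proof
  fix f :: "'k point \<Rightarrow> real" assume dec: w_decreasing and f: "f \<in> borel_measurable (lebesgue_Rn n)"
  obtain F where F: "borel_version f F" using f by (rule ex_borel_version)
  show "(SUP h\<in>admissible. \<integral>\<^sup>+x. ennreal \<bar>f x * h x\<bar> \<partial>lebesgue_Rn n) = c_polar * choquet f"
    by (simp add: SUP_admissible_of_decreasing[OF dec F] choquet_eq_half_integral[OF F])
qed

lemma space_Rn_emeasure_pos: "0 < emeasure (lebesgue_Rn n) (space M \<times> (UNIV :: (real^'k) set))"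
proof -
  interpret P: product_sigma_finite "\<lambda>_::nat. lborel :: real measure"
    by (intro product_sigma_finite.intro sigma_finite_lborel)
  have "emeasure M (space M) = (\<Prod>i<n - CARD('k). emeasure (lborel :: real measure) UNIV)"
    unfolding M_eq by (simp add: space_PiM P.emeasure_PiM)
  also have "\<dots> \<noteq> 0" by simp
  finally have "emeasure M (space M) * emeasure lborel (UNIV :: (real^'k) set) \<noteq> 0" by simp
  then have "emeasure MR (space M \<times> (UNIV :: (real^'k) set)) \<noteq> 0"
    by (simp add: lborel.emeasure_pair_measure_Times)
  then show ?thesis by (simp add: Rn_eq zero_less_iff_neq_zero)
qed

lemma V_pos:
  assumes "A \<in> sets (lebesgue_Rn n)" "0 < emeasure (lebesgue_Rn n) A"
  shows "0 < V A"
  using weight assms unfolding weight_def V_def weighted_vol_def by blast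

text \<open>
  Were no function admissible, the supremum would be \<open>0\<close>, whereas \<open>choquet\<close> is positive on the
  constant \<open>1\<close>. The rearrangement of an admissible function is a decreasing version of \<open>w\<close>.
\<close>

lemma decreasing_of_duality:
  assumes duality shows w_decreasing
proof -
  let ?S = "space M \<times> (UNIV :: (real^'k) set)"
  have S: "?S \<in> sets (lebesgue_Rn n)" using sets.top[of "lebesgue_Rn n :: 'k point measure"] by (simp add: space_Rn)
  then have "0 < choquet (indicator ?S)"
    using V_pos[OF S space_Rn_emeasure_pos] by (simp add: choquet_indicator)
  then have "0 < c_polar * choquet (indicator ?S)"
    using c_polar by (simp add: ennreal_zero_less_mult_iff)
  also have "\<dots> = (SUP h\<in>admissible. \<integral>\<^sup>+x. ennreal \<bar>indicator ?S x * h x\<bar> \<partial>lebesgue_Rn n)"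
    using bspec[OF \<open>duality\<close>[unfolded duality_def], of "indicator ?S"] S by simp
  finally have "admissible \<noteq> {}" by auto
  then obtain h where h: "h \<in> admissible" by blast
  then obtain H where H: "borel_version h H"
    using ex_borel_version by (auto simp: admissible_def)
  have "AE xb in M. AE s in pos_line. w xb s = rearr lborel (\<lambda>y. H (xb, y)) (ennreal s)"
    using admissible_rearr[OF h H] by (rule eventually_mono) (auto elim: eventually_mono)
  moreover have "antimono_on {0<..} (\<lambda>s. rearr lborel (\<lambda>y. H (xb, y)) (ennreal s))" for xb
    by (auto simp: monotone_on_def intro!: rearr_antimono ennreal_leI)
  ultimately show ?thesis
    unfolding w_decreasing_def by (rule_tac eventually_mono) (assumption, blast)
qed

text \<open>
  For each fixed \<open>h\<close> the integral of \<open>|f h|\<close> is subadditive in \<open>f\<close>.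
\<close>

lemma choquet_add:
  assumes duality and f: "f \<in> borel_measurable (lebesgue_Rn n)" and g: "g \<in> borel_measurable (lebesgue_Rn n)"
  shows "choquet (\<lambda>x. f x + g x) \<le> choquet f + choquet g"
proof -
  have d: "c_polar * choquet f = (SUP h\<in>admissible. \<integral>\<^sup>+x. ennreal \<bar>f x * h x\<bar> \<partial>lebesgue_Rn n)"
    if "f \<in> borel_measurable (lebesgue_Rn n)" for f
    using \<open>duality\<close> that by (simp add: duality_def)
  have "c_polar * choquet (\<lambda>x. f x + g x) \<le> c_polar * choquet f + c_polar * choquet g"
    unfolding d[OF f] d[OF g] d[OF borel_measurable_add[OF f g]]
  proof (rule SUP_least)
    fix h assume h: "h \<in> admissible"
    then have hm: "h \<in> borel_measurable (lebesgue_Rn n)" by (simp add: admissible_def)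
    have "(\<integral>\<^sup>+x. ennreal \<bar>(f x + g x) * h x\<bar> \<partial>lebesgue_Rn n) \<le> (\<integral>\<^sup>+x. ennreal \<bar>f x * h x\<bar> + ennreal \<bar>g x * h x\<bar> \<partial>lebesgue_Rn n)"
    proof (rule nn_integral_mono)
      fix x
      have "\<bar>(f x + g x) * h x\<bar> \<le> \<bar>f x * h x\<bar> + \<bar>g x * h x\<bar>"
        by (simp add: distrib_right abs_triangle_ineq)
      then show "ennreal \<bar>(f x + g x) * h x\<bar> \<le> ennreal \<bar>f x * h x\<bar> + ennreal \<bar>g x * h x\<bar>"
        by (simp add: ennreal_plus[symmetric] ennreal_leI del: ennreal_plus)
    qed
    also have "\<dots> = (\<integral>\<^sup>+x. ennreal \<bar>f x * h x\<bar> \<partial>lebesgue_Rn n) + (\<integral>\<^sup>+x. ennreal \<bar>g x * h x\<bar> \<partial>lebesgue_Rn n)"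
      by (intro nn_integral_add) (use f g hm in measurable)
    also have "\<dots> \<le> (SUP h\<in>admissible. \<integral>\<^sup>+x. ennreal \<bar>f x * h x\<bar> \<partial>lebesgue_Rn n) + (SUP h\<in>admissible. \<integral>\<^sup>+x. ennreal \<bar>g x * h x\<bar> \<partial>lebesgue_Rn n)"
      using h by (intro add_mono SUP_upper)
    finally show "(\<integral>\<^sup>+x. ennreal \<bar>(f x + g x) * h x\<bar> \<partial>lebesgue_Rn n) \<le> \<dots>" .
  qed
  then have "c_polar * choquet (\<lambda>x. f x + g x) \<le> c_polar * (choquet f + choquet g)"
    by (simp add: distrib_left)
  then show ?thesis using c_polar by (subst (asm) ennreal_mult_le_mult_iff) auto
qed

lemma choquet_cmult:
  assumes duality and f: "f \<in> borel_measurable (lebesgue_Rn n)"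
  shows "choquet (\<lambda>x. c * f x) = ennreal \<bar>c\<bar> * choquet f"
proof -
  have d: "c_polar * choquet f = (SUP h\<in>admissible. \<integral>\<^sup>+x. ennreal \<bar>f x * h x\<bar> \<partial>lebesgue_Rn n)"
    if "f \<in> borel_measurable (lebesgue_Rn n)" for f
    using \<open>duality\<close> that by (simp add: duality_def)
  have cf: "(\<lambda>x. c * f x) \<in> borel_measurable (lebesgue_Rn n)" using f by measurable
  have "c_polar * choquet (\<lambda>x. c * f x) = (SUP h\<in>admissible. ennreal \<bar>c\<bar> * (\<integral>\<^sup>+x. ennreal \<bar>f x * h x\<bar> \<partial>lebesgue_Rn n))"
    unfolding d[OF cf]
  proof (rule SUP_cong[OF refl])
    fix h assume "h \<in> admissible"
    then have hm: "h \<in> borel_measurable (lebesgue_Rn n)" by (simp add: admissible_def)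
    have "(\<integral>\<^sup>+x. ennreal \<bar>c * f x * h x\<bar> \<partial>lebesgue_Rn n) = (\<integral>\<^sup>+x. ennreal \<bar>c\<bar> * ennreal \<bar>f x * h x\<bar> \<partial>lebesgue_Rn n)"
      by (intro nn_integral_cong) (simp add: abs_mult ennreal_mult[symmetric] mult.assoc)
    also have "\<dots> = ennreal \<bar>c\<bar> * (\<integral>\<^sup>+x. ennreal \<bar>f x * h x\<bar> \<partial>lebesgue_Rn n)"
      by (intro nn_integral_cmult) (use f hm in measurable)
    finally show "(\<integral>\<^sup>+x. ennreal \<bar>c * f x * h x\<bar> \<partial>lebesgue_Rn n) = ennreal \<bar>c\<bar> * (\<integral>\<^sup>+x. ennreal \<bar>f x * h x\<bar> \<partial>lebesgue_Rn n)" .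
  qed
  also have "\<dots> = ennreal \<bar>c\<bar> * (c_polar * choquet f)"
    unfolding d[OF f] by (rule SUP_mult_left_ennreal[symmetric])
  finally have "c_polar * choquet (\<lambda>x. c * f x) = c_polar * (ennreal \<bar>c\<bar> * choquet f)"
    by (simp only: mult.left_commute)
  then show ?thesis using c_polar by (subst (asm) ennreal_mult_cancel_left) auto
qed

text \<open>
  The sum of the indicators of \<open>A\<close> and \<open>B\<close> is that of \<open>A \<inter> B\<close> and \<open>A \<union> B\<close>, which are nested.
\<close>

lemma submodular_of_duality:
  assumes duality and A: "A \<in> sets (lebesgue_Rn n)" and B: "B \<in> sets (lebesgue_Rn n)"
  shows "V (A \<union> B) + V (A \<inter> B) \<le> V A + V B"
proof -
  have "V (A \<union> B) + V (A \<inter> B) = choquet (\<lambda>x. 1 * indicator (A \<inter> B) x + 1 * indicator (A \<union> B) x)"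
    using A B by (subst choquet_two_step) (auto simp: add.commute)
  also have "(\<lambda>x. 1 * indicator (A \<inter> B) x + 1 * indicator (A \<union> B) x) = (\<lambda>x. indicator A x + indicator B x :: real)"
    by (auto simp: indicator_def)
  also have "choquet (\<lambda>x. indicator A x + indicator B x) \<le> choquet (indicator A) + choquet (indicator B)"
    using A B by (intro choquet_add \<open>duality\<close>) auto
  finally show ?thesis using A B by (simp add: choquet_indicator)
qed

text \<open>
  Rearrangement commutes with the power \<open>p\<close>.
\<close>

lemma lorentz_norm_eq:
  assumes p: "0 < p" and f: "f \<in> borel_measurable (lebesgue_Rn n)"
  shows "lorentz_norm n p v f = ennreal_powr (choquet (\<lambda>x. \<bar>f x\<bar> powr p)) (1 / p)"
proof -
  obtain F where F: "borel_version f F" using f by (rule ex_borel_version)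
  have "AE z in MR. ennreal_powr (steiner_rearr n f z) p * ennreal (v z) = steiner_rearr n (\<lambda>x. \<bar>f x\<bar> powr p) z * ennreal (v z)"
    using AE_fst[OF sigma_finite_lborel AE_good_section[OF F]]
  proof eventually_elim
    case (elim z)
    have m: "(\<lambda>y. F (fst z, y)) \<in> borel_measurable lborel" using elim by (simp add: good_section_def)
    have "AE y in lborel. ennreal \<bar>f (fst z, y)\<bar> = F (fst z, y)" using elim by (simp add: good_section_def)
    then have "AE y in lborel. ennreal \<bar>\<bar>f (fst z, y)\<bar> powr p\<bar> = ennreal_powr (F (fst z, y)) p"
      by eventually_elim (auto simp: ennreal_powr_ennreal[symmetric])
    with elim have "good_section (\<lambda>x. \<bar>f x\<bar> powr p) (\<lambda>z. ennreal_powr (F z) p) (fst z)"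
      using borel_measurable_ennreal_powr[OF m] by (simp add: good_section_def)
    from steiner_rearr_good_section[OF this, of "snd z"] steiner_rearr_good_section[OF elim, of "snd z"]
    show ?case by (simp add: rearr_powr[OF p m])
  qed
  then have "(\<integral>\<^sup>+x. ennreal_powr (steiner_rearr n f x) p * ennreal (v x) \<partial>lebesgue_Rn n) = choquet (\<lambda>x. \<bar>f x\<bar> powr p)"
    unfolding choquet_def Rn_eq nn_integral_completion by (rule nn_integral_cong_AE)
  then show ?thesis by (simp add: lorentz_norm_def)
qed

end

lemma powr_convex_nonneg:
  fixes p :: real
  assumes p: "1 \<le> p" and "0 \<le> x" "0 \<le> y" and l: "0 < l" "0 < m" "l + m = 1"
  shows "(l * x + m * y) powr p \<le> l * x powr p + m * y powr p"
proof -
  have *: "(m * y) powr p \<le> m * y powr p" if "0 < m" "m \<le> 1" "0 \<le> y" for m y :: real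
  proof -
    have "m powr p \<le> m powr 1" using that p by (intro powr_mono') auto
    then have "m powr p * y powr p \<le> m * y powr p" using that by (intro mult_right_mono) auto
    then show ?thesis using that by (simp add: powr_mult)
  qed
  show ?thesis
  proof (cases "x = 0 \<or> y = 0")
    case True
    moreover have "(m * y) powr p \<le> m * y powr p" "(l * x) powr p \<le> l * x powr p"
      using assms by (auto intro!: *)
    moreover have "(0::real) powr p = 0" using p by simp
    ultimately show ?thesis by auto
  next
    case False
    then have "0 < x" "0 < y" using assms by auto
    moreover have lm: "1 - m = l" using l by simp
    ultimately show ?thesis
      using convex_onD[OF powr_convex[OF p], of m x y] l by (simp add: lm)
  qed
qed

text \<open>
  The triangle inequality for two step functions that agree at \<open>\<delta> = 0\<close>. It is an equality at
  \<open>\<delta> = 0\<close>, so the derivative there of the right-hand side minus the left-hand side is non-negative;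
  it is \<open>C\<^sup>1\<^sup>/\<^sup>p\<^sup>-\<^sup>1 (a + b - C - D)\<close>.
\<close>

lemma submodular_of_two_step_triangle:
  fixes a b C D p :: real
  assumes p: "1 \<le> p" and nonneg: "0 \<le> a" "0 \<le> b" "0 \<le> D" and C: "0 < C"
    and tri: "\<And>\<delta>. 0 < \<delta> \<Longrightarrow> (((2 + 2 * \<delta>) powr p - (2 + \<delta>) powr p) * D + (2 + \<delta>) powr p * C) powr (1 / p)
      \<le> (((1 + \<delta>) powr p - 1) * a + C) powr (1 / p) + (((1 + \<delta>) powr p - 1) * b + C) powr (1 / p)"
  shows "C + D \<le> a + b"
proof (rule ccontr)
  assume "\<not> C + D \<le> a + b"
  define f where "f \<delta> = (((1 + \<delta>) powr p - 1) * a + C) powr (1 / p) + (((1 + \<delta>) powr p - 1) * b + C) powr (1 / p)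
     - (((2 + 2 * \<delta>) powr p - (2 + \<delta>) powr p) * D + (2 + \<delta>) powr p * C) powr (1 / p)" for \<delta> :: real
  have f0: "f 0 = 0"
    using C p by (simp add: f_def powr_mult powr_powr)
  have d1: "((\<lambda>\<delta>. (((1 + \<delta>) powr p - 1) * a + C) powr (1 / p)) has_real_derivative C powr (1 / p - 1) * a) (at 0)" for a
  proof -
    have "((\<lambda>\<delta>. (1 + \<delta>) powr p) has_real_derivative p * (1 + 0) powr (p - of_nat 1) * 1) (at 0)"
      by (rule DERIV_fun_powr) (auto intro!: derivative_eq_intros)
    then have "((\<lambda>\<delta>. ((1 + \<delta>) powr p - 1) * a + C) has_real_derivative p * a) (at 0)"
      by (auto intro!: derivative_eq_intros)
    then have "((\<lambda>\<delta>. (((1 + \<delta>) powr p - 1) * a + C) powr (1 / p)) has_real_derivative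
      1 / p * (((1 + 0) powr p - 1) * a + C) powr (1 / p - of_nat 1) * (p * a)) (at 0)"
      by (rule DERIV_fun_powr) (use C in simp)
    then show ?thesis using p by (simp add: mult_ac)
  qed
  have d2: "((\<lambda>\<delta>. (((2 + 2 * \<delta>) powr p - (2 + \<delta>) powr p) * D + (2 + \<delta>) powr p * C) powr (1 / p))
    has_real_derivative C powr (1 / p - 1) * (C + D)) (at 0)"
  proof -
    have "((\<lambda>\<delta>. (2 + 2 * \<delta>) powr p) has_real_derivative p * (2 + 2 * 0) powr (p - of_nat 1) * 2) (at 0)"
      by (rule DERIV_fun_powr) (auto intro!: derivative_eq_intros)
    moreover have "((\<lambda>\<delta>. (2 + \<delta>) powr p) has_real_derivative p * (2 + 0) powr (p - of_nat 1) * 1) (at 0)"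
      by (rule DERIV_fun_powr) (auto intro!: derivative_eq_intros)
    ultimately have "((\<lambda>\<delta>. ((2 + 2 * \<delta>) powr p - (2 + \<delta>) powr p) * D + (2 + \<delta>) powr p * C) has_real_derivative
      (p * 2 powr (p - 1) * 2 - p * 2 powr (p - 1)) * D + p * 2 powr (p - 1) * C) (at 0)"
      by (auto intro!: derivative_eq_intros)
    also have "(p * 2 powr (p - 1) * 2 - p * 2 powr (p - 1)) * D + p * 2 powr (p - 1) * C = p * 2 powr (p - 1) * (C + D)"
      by (simp add: algebra_simps)
    finally have "((\<lambda>\<delta>. (((2 + 2 * \<delta>) powr p - (2 + \<delta>) powr p) * D + (2 + \<delta>) powr p * C) powr (1 / p)) has_real_derivative
      1 / p * (((2 + 2 * 0) powr p - (2 + 0) powr p) * D + (2 + 0) powr p * C) powr (1 / p - of_nat 1) * (p * 2 powr (p - 1) * (C + D))) (at 0)"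
      by (rule DERIV_fun_powr) (use C in simp)
    also have "1 / p * (((2 + 2 * 0) powr p - (2 + 0) powr p) * D + (2 + 0) powr p * C) powr (1 / p - of_nat 1) * (p * 2 powr (p - 1) * (C + D))
      = C powr (1 / p - 1) * (C + D)"
    proof -
      have e: "p * (1 / p - 1) + (p - 1) = 0" using p by (simp add: field_simps)
      have "(2 powr p * C) powr (1 / p - 1) * 2 powr (p - 1) = 2 powr (p * (1 / p - 1) + (p - 1)) * C powr (1 / p - 1)"
        using C by (simp add: powr_mult powr_powr powr_add mult_ac)
      also have "\<dots> = C powr (1 / p - 1)" unfolding e by simp
      finally show ?thesis using p by (simp add: mult_ac)
    qed
    finally show ?thesis .
  qed
  have "(f has_real_derivative C powr (1 / p - 1) * a + C powr (1 / p - 1) * b - C powr (1 / p - 1) * (C + D)) (at 0)"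
    unfolding f_def by (intro DERIV_add DERIV_diff d1 d2)
  moreover have "C powr (1 / p - 1) * a + C powr (1 / p - 1) * b - C powr (1 / p - 1) * (C + D) = C powr (1 / p - 1) * (a + b - (C + D))"
    by (simp add: algebra_simps)
  moreover have "C powr (1 / p - 1) * (a + b - (C + D)) < 0"
    using C \<open>\<not> C + D \<le> a + b\<close> by (intro mult_pos_neg) auto
  ultimately have "\<exists>d>0. \<forall>h>0. h < d \<longrightarrow> f 0 > f (0 + h)"
    by (intro DERIV_neg_dec_right) auto
  then obtain d where "0 < d" and d: "\<And>h. 0 < h \<Longrightarrow> h < d \<Longrightarrow> f 0 > f (0 + h)"
    by auto
  then have "f (d / 2) < 0" using f0 d[of "d / 2"] by simp
  moreover have "0 \<le> f (d / 2)" using tri[of "d / 2"] \<open>0 < d\<close> by (simp add: f_def)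
  ultimately show False by simp
qed

lemma rearr_indicator:
  assumes T: "T \<in> sets N"
  shows "rearr N (indicator T) s = (if s < emeasure N T then 1 else 0)"
proof (rule ennreal_eqI_less)
  fix t :: ennreal
  have "{y \<in> space N. t < indicator T y} = (if t < 1 then T else {})"
    using sets.sets_into_space[OF T] by (auto simp: indicator_def not_less_zero split: if_splits)
  then have "distrib N (indicator T) t = (if t < 1 then emeasure N T else 0)"
    by (simp add: distrib_def)
  then show "t < rearr N (indicator T) s \<longleftrightarrow> t < (if s < emeasure N T then 1 else 0)"
    using T by (auto simp: less_rearr_iff)
qed

context steiner_weight
begin

text \<open>
  For reals \<open>a\<close>, \<open>b\<close> slightly larger than the two norms, \<open>(f + g)/(a + b)\<close> is a convex combination of
  \<open>f/a\<close> and \<open>g/b\<close>. Convexity of the power \<open>p\<close> and sublinearity of \<open>choquet\<close> show that its norm is at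
  most \<open>1\<close>. The margin \<open>e\<close> keeps \<open>a\<close> and \<open>b\<close> positive when a norm vanishes.
\<close>

lemma lorentz_norm_add:
  assumes duality and p: "1 \<le> p"
    and f: "f \<in> borel_measurable (lebesgue_Rn n)" and g: "g \<in> borel_measurable (lebesgue_Rn n)"
  shows "lorentz_norm n p v (\<lambda>x. f x + g x) \<le> lorentz_norm n p v f + lorentz_norm n p v g"
proof (rule ennreal_le_epsilon)
  fix e :: real
  assume fin: "lorentz_norm n p v f + lorentz_norm n p v g < top" and e: "0 < e"
  have p0: "0 < p" using p by simp
  have Q: "choquet (\<lambda>x. \<bar>f x\<bar> powr p) = ennreal (r powr p)"
    if "f \<in> borel_measurable (lebesgue_Rn n)" "lorentz_norm n p v f = ennreal r" "0 \<le> r" for f r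
  proof -
    have "choquet (\<lambda>x. \<bar>f x\<bar> powr p) = ennreal_powr (lorentz_norm n p v f) p"
      by (simp only: lorentz_norm_eq[OF p0 that(1)] ennreal_powr_inverse'[OF p0])
    then show ?thesis using that by (simp add: ennreal_powr_ennreal)
  qed
  obtain A where A: "lorentz_norm n p v f = ennreal A" "0 \<le> A" using fin by (cases "lorentz_norm n p v f") auto
  obtain B where B: "lorentz_norm n p v g = ennreal B" "0 \<le> B" using fin by (cases "lorentz_norm n p v g") auto
  define a where "a = A + e / 2"
  define b where "b = B + e / 2"
  have ab: "0 < a" "0 < b" "A \<le> a" "B \<le> b" "a + b = A + B + e" using A B e by (auto simp: a_def b_def)
  define c where "c = (a + b) powr p * (a / (a + b)) / a powr p"
  define d where "d = (a + b) powr p * (b / (a + b)) / b powr p"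
  have cd: "0 \<le> c" "0 \<le> d" using ab by (auto simp: c_def d_def)
  have le: "\<bar>f x + g x\<bar> powr p \<le> c * \<bar>f x\<bar> powr p + d * \<bar>g x\<bar> powr p" for x
  proof -
    have "\<bar>f x + g x\<bar> powr p \<le> (\<bar>f x\<bar> + \<bar>g x\<bar>) powr p" using p by (intro powr_mono2) auto
    also have "\<bar>f x\<bar> + \<bar>g x\<bar> = (a + b) * ((a / (a + b)) * (\<bar>f x\<bar> / a) + (b / (a + b)) * (\<bar>g x\<bar> / b))"
      using ab(1,2) by (simp add: distrib_left)
    also have "\<dots> powr p = (a + b) powr p * ((a / (a + b)) * (\<bar>f x\<bar> / a) + (b / (a + b)) * (\<bar>g x\<bar> / b)) powr p"
      using ab(1,2) by (intro powr_mult)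
    also have "\<dots> \<le> (a + b) powr p * ((a / (a + b)) * (\<bar>f x\<bar> / a) powr p + (b / (a + b)) * (\<bar>g x\<bar> / b) powr p)"
      using ab(1,2) p by (intro mult_left_mono powr_convex_nonneg) (auto simp: add_divide_distrib[symmetric])
    also have "\<dots> = c * \<bar>f x\<bar> powr p + d * \<bar>g x\<bar> powr p"
      using ab(1,2) by (simp add: c_def d_def powr_divide distrib_left)
    finally show ?thesis .
  qed
  note [measurable] = f g
  have "choquet (\<lambda>x. \<bar>f x + g x\<bar> powr p) \<le> choquet (\<lambda>x. c * \<bar>f x\<bar> powr p + d * \<bar>g x\<bar> powr p)"
  proof (rule choquet_mono)
    show "\<bar>\<bar>f x + g x\<bar> powr p\<bar> \<le> \<bar>c * \<bar>f x\<bar> powr p + d * \<bar>g x\<bar> powr p\<bar>" for x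
      using le[of x] cd by simp
  qed measurable
  also have "\<dots> \<le> choquet (\<lambda>x. c * \<bar>f x\<bar> powr p) + choquet (\<lambda>x. d * \<bar>g x\<bar> powr p)"
    by (intro choquet_add \<open>duality\<close>) measurable
  also have "\<dots> = ennreal c * ennreal (A powr p) + ennreal d * ennreal (B powr p)"
    using choquet_cmult[OF \<open>duality\<close>, of "\<lambda>x. \<bar>f x\<bar> powr p" c] choquet_cmult[OF \<open>duality\<close>, of "\<lambda>x. \<bar>g x\<bar> powr p" d] cd
    by (simp add: Q[OF f A] Q[OF g B])
  also have "\<dots> = ennreal (c * A powr p + d * B powr p)"
    using cd by (simp add: ennreal_mult)
  also have "\<dots> \<le> ennreal ((a + b) powr p)"
  proof (rule ennreal_leI)
    have "c * A powr p \<le> c * a powr p" "d * B powr p \<le> d * b powr p"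
      using cd ab A B p by (auto intro!: mult_left_mono powr_mono2)
    moreover have "c * a powr p = (a + b) powr p * (a / (a + b))" "d * b powr p = (a + b) powr p * (b / (a + b))"
      using ab(1,2) by (simp_all add: c_def d_def)
    moreover have "(a + b) powr p * (a / (a + b)) + (a + b) powr p * (b / (a + b)) = (a + b) powr p"
      using ab(1,2) by (simp add: distrib_left[symmetric] add_divide_distrib[symmetric])
    ultimately show "c * A powr p + d * B powr p \<le> (a + b) powr p" by linarith
  qed
  finally have "ennreal_powr (choquet (\<lambda>x. \<bar>f x + g x\<bar> powr p)) (1 / p) \<le> ennreal_powr (ennreal ((a + b) powr p)) (1 / p)"
    using p0 by (intro ennreal_powr_mono) auto
  also have "\<dots> = ennreal (a + b)"
    using ab(1,2) p0 by (simp add: ennreal_powr_ennreal powr_powr)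
  also have "\<dots> = lorentz_norm n p v f + lorentz_norm n p v g + ennreal e"
    using A B e by (simp add: ab ennreal_plus[symmetric] del: ennreal_plus)
  finally show "lorentz_norm n p v (\<lambda>x. f x + g x) \<le> lorentz_norm n p v f + lorentz_norm n p v g + ennreal e"
    by (simp add: lorentz_norm_eq[OF p0])
qed

lemma lorentz_norm_cmult:
  assumes duality and p: "1 \<le> p" and f: "f \<in> borel_measurable (lebesgue_Rn n)"
  shows "lorentz_norm n p v (\<lambda>x. c * f x) = ennreal \<bar>c\<bar> * lorentz_norm n p v f"
proof -
  have p0: "0 < p" using p by simp
  have fp: "(\<lambda>x. \<bar>f x\<bar> powr p) \<in> borel_measurable (lebesgue_Rn n)" using f by measurable
  have "choquet (\<lambda>x. \<bar>c * f x\<bar> powr p) = choquet (\<lambda>x. \<bar>c\<bar> powr p * \<bar>f x\<bar> powr p)"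
    by (simp add: abs_mult powr_mult)
  also have "\<dots> = ennreal (\<bar>c\<bar> powr p) * choquet (\<lambda>x. \<bar>f x\<bar> powr p)"
    by (simp add: choquet_cmult[OF \<open>duality\<close> fp])
  finally have eq: "choquet (\<lambda>x. \<bar>c * f x\<bar> powr p) = ennreal (\<bar>c\<bar> powr p) * choquet (\<lambda>x. \<bar>f x\<bar> powr p)" .
  have cf: "(\<lambda>x. c * f x) \<in> borel_measurable (lebesgue_Rn n)" using f by measurable
  have "ennreal_powr (ennreal (\<bar>c\<bar> powr p) * X) (1 / p) = ennreal \<bar>c\<bar> * ennreal_powr X (1 / p)" for X
  proof (cases X)
    case (real r)
    then show ?thesis using p0
      by (simp add: ennreal_mult[symmetric] ennreal_powr_ennreal powr_mult powr_powr)
  next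
    case top
    then show ?thesis using p0
      by (cases "c = 0") (auto simp: ennreal_powr_def ennreal_mult_top)
  qed
  then show ?thesis by (simp add: lorentz_norm_eq[OF p0 cf] lorentz_norm_eq[OF p0 f] eq)
qed

lemma lorentz_norm_eq_0_iff:
  assumes duality and p: "1 \<le> p" and f: "f \<in> borel_measurable (lebesgue_Rn n)"
  shows "lorentz_norm n p v f = 0 \<longleftrightarrow> (AE x in lebesgue_Rn n. f x = 0)"
proof
  have p0: "0 < p" using p by simp
  note [measurable] = f
  define F where "F x = \<bar>f x\<bar> powr p" for x
  have F[measurable]: "F \<in> borel_measurable (lebesgue_Rn n)" unfolding F_def by measurable
  have N: "lorentz_norm n p v f = ennreal_powr (choquet F) (1 / p)"
    unfolding F_def by (rule lorentz_norm_eq[OF p0 f])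
  {
    assume "AE x in lebesgue_Rn n. f x = 0"
    then have ae: "AE x in lebesgue_Rn n. F x = 0" by eventually_elim (use p0 in \<open>simp add: F_def\<close>)
    have "c_polar * choquet F = (SUP h\<in>admissible. \<integral>\<^sup>+x. ennreal \<bar>F x * h x\<bar> \<partial>lebesgue_Rn n)"
      using \<open>duality\<close> F by (simp add: duality_def)
    also have "\<dots> \<le> 0"
    proof (rule SUP_least)
      fix h :: "'k point \<Rightarrow> real"
      have "(\<integral>\<^sup>+x. ennreal \<bar>F x * h x\<bar> \<partial>lebesgue_Rn n) = (\<integral>\<^sup>+x. 0 \<partial>(lebesgue_Rn n :: 'k point measure))"
      proof (rule nn_integral_cong_AE)
        show "AE x in lebesgue_Rn n. ennreal \<bar>F x * h x\<bar> = 0"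
          using ae by eventually_elim simp
      qed
      then show "(\<integral>\<^sup>+x. ennreal \<bar>F x * h x\<bar> \<partial>lebesgue_Rn n) \<le> 0" by simp
    qed
    finally have "choquet F = 0" using c_polar by auto
    then show "lorentz_norm n p v f = 0" using N p0 by (simp add: ennreal_powr_def)
  }
  assume "lorentz_norm n p v f = 0"
  then have "ennreal_powr (ennreal_powr (choquet F) (1 / p)) p = ennreal_powr 0 p" using N by simp
  then have "choquet F = ennreal_powr 0 p" by (simp only: ennreal_powr_inverse'[OF p0])
  then have C0: "choquet F = 0" using p0 by (simp add: ennreal_powr_def)
  \<comment> \<open>A level set of positive measure would have a symmetrization of positive weighted volume.\<close>
  have null: "AE x in lebesgue_Rn n. \<not> inverse (real (Suc m)) < F x" for m
  proof (rule ccontr)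
    let ?t = "inverse (real (Suc m))"
    let ?A = "{x \<in> space (lebesgue_Rn n). ?t < F x}"
    assume *: "\<not> (AE x in lebesgue_Rn n. \<not> ?t < F x)"
    have A: "?A \<in> sets (lebesgue_Rn n)" by measurable
    then have "emeasure (lebesgue_Rn n) ?A \<noteq> 0"
      using * by (subst (asm) AE_iff_measurable[OF _ refl]) auto
    then have "0 < V ?A" using A by (intro V_pos) (auto simp: zero_less_iff_neq_zero)
    then have "0 < choquet (\<lambda>x. 0 * indicator ?A x + ?t * indicator ?A x)"
      using A by (subst choquet_two_step) (auto simp: ennreal_zero_less_mult_iff simp del: of_nat_Suc)
    also have "\<dots> \<le> choquet F"
    proof (rule choquet_mono)
      show "\<bar>0 * indicator ?A x + ?t * indicator ?A x\<bar> \<le> \<bar>F x\<bar>" for x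
        by (auto simp: indicator_def F_def simp del: of_nat_Suc)
    qed (use A in measurable)
    finally show False using C0 by simp
  qed
  then have "AE x in lebesgue_Rn n. \<forall>m. \<not> inverse (real (Suc m)) < F x"
    by (subst AE_all_countable) blast
  then show "AE x in lebesgue_Rn n. f x = 0"
  proof eventually_elim
    case (elim x)
    have "\<not> 0 < F x" using elim reals_Archimedean by blast
    then show ?case by (simp add: F_def)
  qed
qed

theorem norm_of_duality:
  assumes duality and p: "1 \<le> p"
  shows "is_norm_mod_ae (lebesgue_Rn n) (lorentz_space n p v) (lorentz_norm n p v)"
proof -
  have L: "f \<in> lorentz_space n p v \<longleftrightarrow> f \<in> borel_measurable (lebesgue_Rn n) \<and> lorentz_norm n p v f < \<infinity>" for f
    by (simp add: lorentz_space_def)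
  have zero: "lorentz_norm n p v (\<lambda>_. 0) = 0"
    by (subst lorentz_norm_eq_0_iff[OF assms]) auto
  show ?thesis
    unfolding is_norm_mod_ae_def
  proof (intro conjI ballI allI)
    show "(\<lambda>_. 0) \<in> lorentz_space n p v" by (simp add: L zero)
    fix f g :: "'k point \<Rightarrow> real" and c :: real
    assume f: "f \<in> lorentz_space n p v"
    then have fm[measurable]: "f \<in> borel_measurable (lebesgue_Rn n)" and ff: "lorentz_norm n p v f < \<infinity>" by (auto simp: L)
    show "lorentz_norm n p v f < \<infinity>" by fact
    show "lorentz_norm n p v f = 0 \<longleftrightarrow> (AE x in lebesgue_Rn n. f x = 0)"
      by (rule lorentz_norm_eq_0_iff[OF assms fm])
    show cm: "lorentz_norm n p v (\<lambda>x. c * f x) = ennreal \<bar>c\<bar> * lorentz_norm n p v f"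
      by (rule lorentz_norm_cmult[OF assms fm])
    show "(\<lambda>x. c * f x) \<in> lorentz_space n p v"
      using ff by (simp add: L cm ennreal_mult_less_top)
    assume g: "g \<in> lorentz_space n p v"
    then have gm[measurable]: "g \<in> borel_measurable (lebesgue_Rn n)" and gf: "lorentz_norm n p v g < \<infinity>" by (auto simp: L)
    show add: "lorentz_norm n p v (\<lambda>x. f x + g x) \<le> lorentz_norm n p v f + lorentz_norm n p v g"
      by (rule lorentz_norm_add[OF assms fm gm])
    show "(\<lambda>x. f x + g x) \<in> lorentz_space n p v"
      using ff gf add by (auto simp: L intro: le_less_trans)
  qed
qed

end

section \<open>From the norm to submodularity and to a decreasing averaged weight\<close>

context steiner_weight
begin

text \<open>
  Finiteness is what the argument from the norm needs: step functions on \<open>A \<union> B\<close> have to belong to the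
  space.
\<close>

definition finite_submodular :: bool where
  "finite_submodular \<longleftrightarrow> (\<forall>A\<in>sets (lebesgue_Rn n). \<forall>B\<in>sets (lebesgue_Rn n).
     V (A \<union> B) < \<infinity> \<longrightarrow> V (A \<union> B) + V (A \<inter> B) \<le> V A + V B)"

lemma V_mono:
  assumes "A \<in> sets (lebesgue_Rn n)" "B \<in> sets (lebesgue_Rn n)" "A \<subseteq> B"
  shows "V A \<le> V B"
  using assms choquet_mono[of "indicator A" "indicator B"]
  by (auto simp: choquet_indicator indicator_def)

text \<open>
  The triangle inequality for \<open>\<delta> \<chi>\<^sub>A + \<chi>\<close> and \<open>\<delta> \<chi>\<^sub>B + \<chi>\<close>, where \<open>\<chi>\<close> is the indicator of \<open>A \<union> B\<close>. The
  \<open>p\<close>-th powers of these functions and of their sum are again combinations of indicators of two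
  nested sets, so all three norms are known exactly.
\<close>

lemma submodular_of_norm:
  assumes norm: "is_norm_mod_ae (lebesgue_Rn n) (lorentz_space n p v) (lorentz_norm n p v)" and p: "1 \<le> p"
  shows finite_submodular
  unfolding finite_submodular_def
proof (intro ballI impI)
  fix A B :: "'k point set"
  assume A[measurable]: "A \<in> sets (lebesgue_Rn n)" and B[measurable]: "B \<in> sets (lebesgue_Rn n)" and fin: "V (A \<union> B) < \<infinity>"
  have p0: "0 < p" using p by simp
  have triangle: "\<forall>f\<in>lorentz_space n p v. \<forall>g\<in>lorentz_space n p v.
      lorentz_norm n p v (\<lambda>x. f x + g x) \<le> lorentz_norm n p v f + lorentz_norm n p v g"
    using norm unfolding is_norm_mod_ae_def by (elim conjE)
  have le: "V A \<le> V (A \<union> B)" "V B \<le> V (A \<union> B)" "V (A \<inter> B) \<le> V (A \<union> B)"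
    by (intro V_mono; auto)+
  obtain C where C: "V (A \<union> B) = ennreal C" "0 \<le> C" using fin by (cases "V (A \<union> B)") auto
  obtain a where a: "V A = ennreal a" "0 \<le> a" using le(1) C by (cases "V A") (auto simp: top_unique)
  obtain b where b: "V B = ennreal b" "0 \<le> b" using le(2) C by (cases "V B") (auto simp: top_unique)
  obtain D where D: "V (A \<inter> B) = ennreal D" "0 \<le> D" using le(3) C by (cases "V (A \<inter> B)") (auto simp: top_unique)
  have two: "lorentz_norm n p v f = ennreal ((\<alpha> * x + \<beta> * C) powr (1 / p))"
    if f: "f \<in> borel_measurable (lebesgue_Rn n)"
      and fp: "\<And>z. \<bar>f z\<bar> powr p = \<alpha> * indicator E z + \<beta> * indicator (A \<union> B) z"
      and E: "E \<in> sets (lebesgue_Rn n)" "E \<subseteq> A \<union> B" "V E = ennreal x" "0 \<le> x" and nonneg: "0 \<le> \<alpha>" "0 \<le> \<beta>" for f E x \<alpha> \<beta>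
  proof -
    have "choquet (\<lambda>z. \<bar>f z\<bar> powr p) = ennreal \<alpha> * V E + ennreal \<beta> * V (A \<union> B)"
      unfolding fp using E nonneg by (intro choquet_two_step) auto
    also have "\<dots> = ennreal (\<alpha> * x + \<beta> * C)"
      using E C nonneg by (simp add: ennreal_mult)
    finally show ?thesis
      using E C nonneg by (simp add: lorentz_norm_eq[OF p0 f] ennreal_powr_ennreal del: ennreal_plus)
  qed
  have "C + D \<le> a + b"
  proof (cases "C = 0")
    case True
    then have "D \<le> 0" using le(3) C D by simp
    with True a b show ?thesis by simp
  next
    case False
    show ?thesis
    proof (rule submodular_of_two_step_triangle[OF p])
      show "0 < C" using False C by simp
      fix \<delta> :: real assume \<delta>: "0 < \<delta>"
      let ?f = "\<lambda>z. \<delta> * indicator A z + indicator (A \<union> B) z :: real"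
      let ?g = "\<lambda>z. \<delta> * indicator B z + indicator (A \<union> B) z :: real"
      have g1: "1 \<le> (1 + \<delta>) powr p" using \<delta> p0 by (intro ge_one_powr_ge_zero) auto
      have g2: "(2 + \<delta>) powr p \<le> (2 + 2 * \<delta>) powr p" using \<delta> p0 by (intro powr_mono2) auto
      have nf: "lorentz_norm n p v ?f = ennreal ((((1 + \<delta>) powr p - 1) * a + 1 * C) powr (1 / p))"
        using a g1 \<delta> by (intro two) (auto simp: indicator_def add.commute)
      have ng: "lorentz_norm n p v ?g = ennreal ((((1 + \<delta>) powr p - 1) * b + 1 * C) powr (1 / p))"
        using b g1 \<delta> by (intro two) (auto simp: indicator_def add.commute)
      have nfg: "lorentz_norm n p v (\<lambda>z. ?f z + ?g z) = ennreal ((((2 + 2 * \<delta>) powr p - (2 + \<delta>) powr p) * D + (2 + \<delta>) powr p * C) powr (1 / p))"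
        using D g2 \<delta> by (intro two) (auto simp: indicator_def algebra_simps)
      have "?f \<in> lorentz_space n p v" "?g \<in> lorentz_space n p v"
        unfolding lorentz_space_def by (auto simp: nf ng simp del: mult_1)
      then have "lorentz_norm n p v (\<lambda>z. ?f z + ?g z) \<le> lorentz_norm n p v ?f + lorentz_norm n p v ?g"
        by (rule triangle[rule_format])
      then show "(((2 + 2 * \<delta>) powr p - (2 + \<delta>) powr p) * D + (2 + \<delta>) powr p * C) powr (1 / p)
        \<le> (((1 + \<delta>) powr p - 1) * a + C) powr (1 / p) + (((1 + \<delta>) powr p - 1) * b + C) powr (1 / p)"
        unfolding nf ng nfg by (simp add: ennreal_plus[symmetric] del: ennreal_plus)
    qed (use a b D in auto)
  qed
  then show "V (A \<union> B) + V (A \<inter> B) \<le> V A + V B"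
    using C D a b by (simp add: ennreal_plus[symmetric] del: ennreal_plus)
qed

lemma c_polar_V_rectangle:
  assumes E: "E \<in> sets M" and T: "T \<in> sets borel" "emeasure lborel T = ennreal a"
  shows "E \<times> T \<in> sets (lebesgue_Rn n)"
    and "c_polar * V (E \<times> T) = (\<integral>\<^sup>+xb. indicator E xb * W xb a \<partial>M)"
proof -
  have ET: "E \<times> T \<in> sets MR" using E T by auto
  then show S: "E \<times> T \<in> sets (lebesgue_Rn n)" unfolding Rn_eq by auto
  have "borel_version (indicator (E \<times> T)) (indicator (E \<times> T))"
    unfolding borel_version_def using ET by (auto simp: indicator_def)
  from choquet_eq_half_integral[OF this]
  have "c_polar * V (E \<times> T) = half_integral (indicator (E \<times> T))"
    by (simp add: choquet_indicator[OF S])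
  also have "\<dots> = (\<integral>\<^sup>+xb. indicator E xb * W xb a \<partial>M)"
    unfolding half_integral_def
  proof (rule nn_integral_cong)
    fix xb
    show "(\<integral>\<^sup>+s. rearr lborel (\<lambda>y. indicator (E \<times> T) (xb, y)) (ennreal s) * w xb s \<partial>pos_line) = indicator E xb * W xb a"
    proof (cases "xb \<in> E")
      case True
      then have "(\<lambda>y. indicator (E \<times> T) (xb, y)) = (indicator T :: real^'k \<Rightarrow> ennreal)"
        by (auto simp: indicator_def)
      then have "rearr lborel (\<lambda>y. indicator (E \<times> T) (xb, y)) (ennreal s) = indicator {..<a} s" if "0 < s" for s
        using T that by (simp add: rearr_indicator ennreal_less_iff indicator_def)
      then have "(\<integral>\<^sup>+s. rearr lborel (\<lambda>y. indicator (E \<times> T) (xb, y)) (ennreal s) * w xb s \<partial>pos_line) = W xb a"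
        unfolding W_def by (intro nn_integral_cong) simp
      then show ?thesis using True by simp
    next
      case False
      then have e: "(\<lambda>y. indicator (E \<times> T) (xb, y)) = (indicator {} :: real^'k \<Rightarrow> ennreal)"
        by (auto simp: indicator_def)
      show ?thesis unfolding e using False by (simp add: rearr_indicator)
    qed
  qed
  finally show "c_polar * V (E \<times> T) = (\<integral>\<^sup>+xb. indicator E xb * W xb a \<partial>M)" .
qed

text \<open>
  Submodularity for \<open>E \<times> T\<close> and \<open>E \<times> Q b\<close>, where \<open>Q r\<close> is the ball of volume \<open>r\<close> and \<open>T\<close> is \<open>Q a\<close> with the
  ring between \<open>Q b\<close> and \<open>Q (b + h)\<close>: the sections of the two sets, their union and their
  intersection have the measures \<open>a + h\<close>, \<open>b\<close>, \<open>b + h\<close> and \<open>a\<close>.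
\<close>

lemma integral_shift_inequality:
  assumes sub: finite_submodular and E: "E \<in> sets M" "E \<subseteq> box R" and abh: "0 \<le> a" "a \<le> b" "0 \<le> h"
  shows "(\<integral>\<^sup>+xb. indicator E xb * (W xb (b + h) + W xb a) \<partial>M) \<le> (\<integral>\<^sup>+xb. indicator E xb * (W xb (a + h) + W xb b) \<partial>M)"
proof -
  define Q where "Q r = (ball_of_measure (ennreal r) :: (real^'k) set)" for r
  have Qs[measurable]: "Q r \<in> sets borel" for r by (auto simp: Q_def ball_of_measure_def)
  have Qm: "emeasure lborel (Q r) = ennreal r" for r
    using emeasure_ball_of_measure[of "ennreal r", where 'k='k] Qs[of r] by (simp add: Q_def)
  have Q_mono: "Q r \<subseteq> Q r'" if "r \<le> r'" for r r'
    using ennreal_leI[OF that] by (auto simp: Q_def mem_ball_of_measure)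
  define T where "T = Q a \<union> (Q (b + h) - Q b)"
  have [measurable]: "T \<in> sets borel" unfolding T_def by measurable
  have "emeasure lborel (Q (b + h) - Q b) = ennreal (b + h) - ennreal b"
    using Q_mono[of b "b + h"] abh by (subst emeasure_Diff) (auto simp: Qm)
  also have "\<dots> = ennreal h" using abh by (simp add: ennreal_minus)
  finally have ring: "emeasure lborel (Q (b + h) - Q b) = ennreal h" .
  have Tm: "emeasure lborel T = ennreal (a + h)"
  proof -
    have "emeasure lborel T = emeasure lborel (Q a) + emeasure lborel (Q (b + h) - Q b)"
      unfolding T_def using Q_mono[of a b] abh by (intro plus_emeasure[symmetric]) auto
    then show ?thesis using abh by (simp add: Qm ring)
  qed
  have TQ: "E \<times> T \<union> E \<times> Q b = E \<times> Q (b + h)" "E \<times> T \<inter> E \<times> Q b = E \<times> Q a"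
    using Q_mono[of a b] Q_mono[of b "b + h"] abh by (auto simp: T_def)
  have s: "E \<times> T \<in> sets (lebesgue_Rn n)" "E \<times> Q r \<in> sets (lebesgue_Rn n)" for r
    by (rule c_polar_V_rectangle(1)[OF E(1) _ Tm] c_polar_V_rectangle(1)[OF E(1) _ Qm], measurable)+
  have VT: "c_polar * V (E \<times> T) = (\<integral>\<^sup>+xb. indicator E xb * W xb (a + h) \<partial>M)"
    by (rule c_polar_V_rectangle(2)[OF E(1) _ Tm]) measurable
  have VQ: "c_polar * V (E \<times> Q r) = (\<integral>\<^sup>+xb. indicator E xb * W xb r \<partial>M)" for r
    by (rule c_polar_V_rectangle(2)[OF E(1) _ Qm]) measurable
  have "c_polar * V (E \<times> Q (b + h)) \<le> (\<integral>\<^sup>+xb. indicator (box R) xb * W xb (b + h) \<partial>M)"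
    unfolding VQ using E(2) by (intro nn_integral_mono mult_right_mono) (auto simp: indicator_def)
  also have "\<dots> < \<infinity>" by (rule W_box_finite)
  finally have "V (E \<times> T \<union> E \<times> Q b) < \<infinity>"
    unfolding TQ using c_polar by (auto simp: ennreal_mult_less_top)
  then have "V (E \<times> Q (b + h)) + V (E \<times> Q a) \<le> V (E \<times> T) + V (E \<times> Q b)"
    using sub[unfolded finite_submodular_def, rule_format, OF s(1) s(2)[of b]] by (simp only: TQ)
  then have "c_polar * V (E \<times> Q (b + h)) + c_polar * V (E \<times> Q a) \<le> c_polar * V (E \<times> T) + c_polar * V (E \<times> Q b)"
    unfolding distrib_left[symmetric] by (rule mult_left_mono) simp
  moreover have "(\<integral>\<^sup>+xb. indicator E xb * (W xb x + W xb y) \<partial>M) = (\<integral>\<^sup>+xb. indicator E xb * W xb x \<partial>M) + (\<integral>\<^sup>+xb. indicator E xb * W xb y \<partial>M)" for x y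
    unfolding distrib_left
    by (intro nn_integral_add borel_measurable_times_ennreal borel_measurable_indicator W_measurable E(1))
  ultimately show ?thesis by (simp only: VT VQ)
qed

text \<open>
  An integral inequality that holds over all bounded base sets holds pointwise almost everywhere.
  With rational \<open>a\<close>, \<open>b\<close>, \<open>h\<close> one null set serves for all.
\<close>

lemma decreasing_of_submodular:
  assumes sub: finite_submodular
  shows w_decreasing
proof -
  have "AE xb in M. W xb (b + h) + W xb a \<le> W xb (a + h) + W xb b" if abh: "0 \<le> a" "a \<le> b" "0 \<le> h" for a b h
  proof -
    let ?l = "\<lambda>xb. W xb (b + h) + W xb a" and ?r = "\<lambda>xb. W xb (a + h) + W xb b"
    note [measurable] = W_measurable box_measurable
    have "AE xb in M. \<forall>R::nat. xb \<in> box (real R) \<longrightarrow> ?l xb \<le> ?r xb"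
    proof (subst AE_all_countable, rule allI)
      fix R :: nat
      define E where "E = {xb \<in> space M. xb \<in> box (real R) \<and> ?r xb < ?l xb}"
      have [measurable]: "E \<in> sets M" unfolding E_def by measurable
      have "E \<subseteq> box (real R)" by (auto simp: E_def)
      from integral_shift_inequality[OF sub _ this abh]
      have le: "(\<integral>\<^sup>+xb. indicator E xb * ?l xb \<partial>M) \<le> (\<integral>\<^sup>+xb. indicator E xb * ?r xb \<partial>M)"
        by simp
      have "(\<integral>\<^sup>+xb. indicator E xb * ?r xb \<partial>M) \<le> (\<integral>\<^sup>+xb. indicator (box (real R)) xb * W xb (a + h) + indicator (box (real R)) xb * W xb b \<partial>M)"
        by (intro nn_integral_mono) (auto simp: indicator_def E_def)
      also have "\<dots> = (\<integral>\<^sup>+xb. indicator (box (real R)) xb * W xb (a + h) \<partial>M) + (\<integral>\<^sup>+xb. indicator (box (real R)) xb * W xb b \<partial>M)"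
        by (intro nn_integral_add) measurable
      also have "\<dots> < \<infinity>" using W_box_finite[of "real R" "a + h"] W_box_finite[of "real R" b] by simp
      finally have fin: "(\<integral>\<^sup>+xb. indicator E xb * ?r xb \<partial>M) \<noteq> \<infinity>" by simp
      have "AE xb in M. indicator E xb * ?l xb \<le> indicator E xb * ?r xb"
      proof (rule ccontr)
        assume "\<not> (AE xb in M. indicator E xb * ?l xb \<le> indicator E xb * ?r xb)"
        then have "(\<integral>\<^sup>+xb. indicator E xb * ?r xb \<partial>M) < (\<integral>\<^sup>+xb. indicator E xb * ?l xb \<partial>M)"
          by (intro nn_integral_less fin) (measurable, auto simp: indicator_def E_def)
        with le show False by simp
      qed
      then show "AE xb in M. xb \<in> box (real R) \<longrightarrow> ?l xb \<le> ?r xb"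
        using AE_space
      proof eventually_elim
        case (elim xb)
        show ?case
        proof (intro impI, rule ccontr)
          assume "xb \<in> box (real R)" "\<not> ?l xb \<le> ?r xb"
          with elim(2) have "xb \<in> E" by (simp add: E_def)
          with elim(1) have "?l xb \<le> ?r xb" by simp
          with \<open>\<not> ?l xb \<le> ?r xb\<close> show False by simp
        qed
      qed
    qed
    then show ?thesis using AE_space
    proof eventually_elim
      case (elim xb)
      obtain N :: nat where "xb \<in> box (real N)" using ex_box[OF elim(2)] by blast
      with elim(1) show ?case by blast
    qed
  qed
  then have "AE xb in M. \<forall>a b h :: rat. 0 \<le> a \<longrightarrow> a \<le> b \<longrightarrow> 0 \<le> h \<longrightarrow>
    W xb (of_rat b + of_rat h) + W xb (of_rat a) \<le> W xb (of_rat a + of_rat h) + W xb (of_rat b)"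
    by (auto simp: AE_all_countable of_rat_less_eq)
  then show ?thesis
    unfolding w_decreasing_def using AE_W_finite AE_space
  proof eventually_elim
    case (elim xb)
    show ?case
    proof (rule antimono_of_shift_inequality)
      show "w xb \<in> borel_measurable borel" by (rule w_section[OF elim(3)])
      show "(\<integral>\<^sup>+s. indicator {..<a} s * w xb s \<partial>pos_line) < \<infinity>" for a
        using elim(2) by (simp add: W_def)
      fix a b h :: real assume "a \<in> \<rat>" "b \<in> \<rat>" "h \<in> \<rat>" and abh: "0 \<le> a" "a \<le> b" "0 \<le> h"
      then obtain a' b' h' where "a = of_rat a'" "b = of_rat b'" "h = of_rat h'" by (auto elim!: Rats_cases)
      with elim(1)[rule_format, of a' b' h'] abh
      show "(\<integral>\<^sup>+s. indicator {..<b + h} s * w xb s \<partial>pos_line) + (\<integral>\<^sup>+s. indicator {..<a} s * w xb s \<partial>pos_line)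
        \<le> (\<integral>\<^sup>+s. indicator {..<a + h} s * w xb s \<partial>pos_line) + (\<integral>\<^sup>+s. indicator {..<b} s * w xb s \<partial>pos_line)"
        by (simp add: W_def of_rat_less_eq)
    qed
  qed
qed

lemma duality_iff:
  "duality \<longleftrightarrow> (\<forall>f \<in> borel_measurable (lebesgue_Rn n).
     (SUP h\<in>admissible. \<integral>\<^sup>+x. ennreal \<bar>f x * h x\<bar> \<partial>lebesgue_Rn n)
       = (\<integral>\<^sup>+(xb, s). steiner_rearr_half f xb s * weight_bar v xb s \<partial>lebesgue_half_space (n - CARD('k))))"
proof -
  have "(\<integral>\<^sup>+(xb, s). steiner_rearr_half f xb s * weight_bar v xb s \<partial>lebesgue_half_space (n - CARD('k))) = c_polar * choquet f"
    if f: "f \<in> borel_measurable (lebesgue_Rn n)" for f :: "'k point \<Rightarrow> real"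
  proof -
    obtain F where F: "borel_version f F" using f by (rule ex_borel_version)
    show ?thesis by (simp add: half_integral_eq[OF F] choquet_eq_half_integral[OF F])
  qed
  then show ?thesis unfolding duality_def by simp
qed

end

theorem theorem3p17:
  fixes n :: nat and p :: real and v :: "(nat \<Rightarrow> real) \<times> (real^'k) \<Rightarrow> real"
  assumes "n \<ge> 2" and "CARD('k) \<le> n" and "weight n v" and "p \<ge> 1"
  shows "let
      a = is_norm_mod_ae (lebesgue_Rn n) (lorentz_space n p v) (lorentz_norm n p v);
      b = (\<forall>A \<in> sets (lebesgue_Rn n). \<forall>B \<in> sets (lebesgue_Rn n).
           weighted_vol n v (steiner n (A \<union> B)) + weighted_vol n v (steiner n (A \<inter> B))
             \<le> weighted_vol n v (steiner n A) + weighted_vol n v (steiner n B));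
      c = (AE xb in lebesgue_base (n - CARD('k)). ae_nonincreasing (weight_bar v xb));
      d = (\<forall>f :: (nat \<Rightarrow> real) \<times> (real^'k) \<Rightarrow> real \<in> borel_measurable (lebesgue_Rn n).
           (SUP h :: (nat \<Rightarrow> real) \<times> (real^'k) \<Rightarrow> real \<in> {h \<in> borel_measurable (lebesgue_Rn n).
                AE (xb, s) in lebesgue_half_space (n - CARD('k)).
                  steiner_rearr_half h xb s = weight_bar v xb s}.
              \<integral>\<^sup>+x. ennreal \<bar>f x * h x\<bar> \<partial>lebesgue_Rn n)
           = (\<integral>\<^sup>+(xb, s). steiner_rearr_half f xb s * weight_bar v xb s
                \<partial>lebesgue_half_space (n - CARD('k))))
    in (a \<longleftrightarrow> b) \<and> (b \<longleftrightarrow> c) \<and> (c \<longleftrightarrow> d)"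
proof -
  have "(\<lambda>x. ennreal (v x)) \<in> borel_measurable (completion (lebesgue_base (n - CARD('k)) \<Otimes>\<^sub>M (lborel :: (real^'k) measure)))"
    using \<open>weight n v\<close> by (auto simp: weight_def locally_integrable_def lebesgue_Rn_def)
  from completion_ex_borel_measurable[OF this]
  obtain u where "u \<in> borel_measurable (lebesgue_base (n - CARD('k)) \<Otimes>\<^sub>M (lborel :: (real^'k) measure))"
    "AE x in lebesgue_base (n - CARD('k)) \<Otimes>\<^sub>M (lborel :: (real^'k) measure). ennreal (v x) = u x"
    by blast
  then interpret steiner_weight n v u "lebesgue_base (n - CARD('k))"
    using \<open>weight n v\<close> by unfold_locales simp_all
  define a where "a = is_norm_mod_ae (lebesgue_Rn n) (lorentz_space n p v) (lorentz_norm n p v)"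
  define b where "b \<longleftrightarrow> (\<forall>A \<in> sets (lebesgue_Rn n). \<forall>B \<in> sets (lebesgue_Rn n). V (A \<union> B) + V (A \<inter> B) \<le> V A + V B)"
  have "w_decreasing \<Longrightarrow> duality" by (rule duality_of_decreasing)
  moreover have "duality \<Longrightarrow> a" unfolding a_def by (rule norm_of_duality[OF _ \<open>p \<ge> 1\<close>])
  moreover have "duality \<Longrightarrow> b" unfolding b_def using submodular_of_duality by blast
  moreover have "a \<Longrightarrow> finite_submodular" unfolding a_def by (rule submodular_of_norm[OF _ \<open>p \<ge> 1\<close>])
  moreover have "b \<Longrightarrow> finite_submodular" unfolding b_def finite_submodular_def by blast
  moreover have "finite_submodular \<Longrightarrow> w_decreasing" by (rule decreasing_of_submodular)
  moreover have "duality \<Longrightarrow> w_decreasing" by (rule decreasing_of_duality)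
  ultimately have "(a \<longleftrightarrow> b) \<and> (b \<longleftrightarrow> w_decreasing) \<and> (w_decreasing \<longleftrightarrow> duality)" by blast
  then show ?thesis
    unfolding Let_def a_def b_def V_def ae_nonincreasing_iff_w_decreasing[symmetric] duality_iff admissible_def .
qed

end
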